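(* Let $\mathcal{D}\subset\mathbb{R}^+\cup\{0\}$ with $0\in\mathcal{D}$ be a digit set with $\#\mathcal{D}=4$, let $0<\rho<1$, and let $\mathbf{p}$ be a probability vector. Suppose that the self-similar measure $\mu_{\rho,\mathcal{D},\mathbf{p}}$ is a spectral measure. Then: (i) $\mathbf{p}$ is an equal-weighted probability vector. (ii) $\rho=\frac1N$ where $N=2^{\beta}m$ for some integer $\beta\ge 1$ and $m$ is an odd integer. (iii) By rescaling (that is, after replacing $\mathcal{D}$ by $c\mathcal{D}$ for some $c>0$), $\mathcal{D}=\{0,\,a,\,2^{t}\ell,\,a+2^{t}\ell'\}$, where $a,\ell,\ell'$ are odd integers and $t\ge1$ is an integer that is not a multiple of $\beta$. In particular, for this rescaled $\mathcal{D}$, if we write $t=\beta k+r$ for some $0<r\le\beta-1$ (with $k$ an integer), then $(N,\,m^k\mathcal{D},\,\mathcal{L}_1\oplus\mathcal{L}_2)$ is a product-form Hadamard triple with $\mathcal{L}_1=\{0,\frac N2\}$ and $\mathcal{L}_2=\{0,N2^{r-1}\}$. Hence, the modified Łaba–Wang conjecture holds (for digit sets of cardinality four).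
   Context: For $0<\rho<1$, a finite digit set $\mathcal{D}=\{d_0,\dots,d_{q-1}\}\subset\mathbb{R}$ and a probability vector $\mathbf{p}=(p_0,\dots,p_{q-1})$, let $\phi_j(x)=\rho(x+d_j)$. The self-similar measure $\mu_{\rho,\mathcal{D},\mathbf{p}}$ is the unique Borel probability measure on $\mathbb{R}$ with $\mu(E)=\sum_j p_j\,\mu(\phi_j^{-1}(E))$ for all Borel $E$. The vector $\mathbf{p}$ is equal-weighted if $p_j=1/q$ for all $j$. A Borel probability measure $\mu$ on $\mathbb{R}$ is a spectral measure if there is a countable set $\Lambda\subset\mathbb{R}$ such that $\{e^{2\pi i\lambda x}\}_{\lambda\in\Lambda}$ is an orthonormal basis of $L^2(\mu)$. For an integer $N\ge2$ and finite sets $\mathcal{E},\mathcal{L}\subset\mathbb{Z}$ of the same cardinality, $(N,\mathcal{E},\mathcal{L})$ is a Hadamard triple if the matrix $\frac{1}{\sqrt{\#\mathcal{E}}}\bigl(e^{-2\pi i d\lambda/N}\bigr)_{d\in\mathcal{E},\lambda\in\mathcal{L}}$ is unitary (equivalently, the equal-weighted discrete measure on $\mathcal{E}$ has spectrum $\frac1N\mathcal{L}$). $A\oplus B$ denotes $\{a+b:a\in A,\,b\in B\}$ when all these sums are distinct; $A+B=\{a+b:a\in A,\,b\in B\}$ and $cA=\{ca:a\in A\}$. $(N,\mathcal{E},\mathcal{L}_1\oplus\mathcal{L}_2)$ is a product-form Hadamard triple if there exist $\mathcal{A}$ and, for each $x\in\mathcal{A}$, a set $\mathcal{B}_x$ such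 that $\mathcal{E}=\bigcup_{x\in\mathcal{A}}(x+N\mathcal{B}_x)$ and, for each $x\in\mathcal{A}$, $(N,\mathcal{A},\mathcal{L}_1)$, $(N,\mathcal{B}_x,\mathcal{L}_2)$ and $(N,\mathcal{A}\oplus\mathcal{B}_x,\mathcal{L}_1\oplus\mathcal{L}_2)$ are Hadamard triples. The modified Łaba–Wang conjecture states: if $\mu_{\rho,\mathcal{D},\mathbf{p}}$ is a spectral measure and $\mathcal{D}\subset\mathbb{Z}^+\cup\{0\}$ with $0\in\mathcal{D}$, then (1) $\mathbf{p}$ is equal-weighted; (2) $\rho=1/N$ for some integer $N\ge2$; (3) there exists $\alpha>0$ such that $\mathcal{D}=\alpha\mathcal{C}$, and there exist $M>0$ and $K>0$ such that, with $\mathbf{D}_K=(M\mathcal{C})+N(M\mathcal{C})+\cdots+N^{K-1}(M\mathcal{C})$, $(N^K,\mathbf{D}_K,\mathcal{L}_1\oplus\mathcal{L}_2)$ forms a product-form Hadamard triple for some $\mathcal{L}_1,\mathcal{L}_2$.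
   Formalization: Weights are taken strictly positive (with zero weights (i) is false); L_2 is {0, N/2^{r+1}} instead of {0, N2^{r-1}}, which never works; and for m^k D the product form uses x+N^k B_x instead of x+N B_x, which fails for k≠1. *)

theory Defs
  imports "HOL-Probability.Probability"
begin

text \<open>
  Digit sets are finite sets of reals, and weights are functions on the digits: \<open>p d\<close> is the
  weight of the map \<open>x \<mapsto> \<rho> (x + d)\<close>.  Weights are strictly positive: a digit of weight zero does
  not contribute to the measure, and results that recover the digits from the measure fail if such
  digits are admitted.
\<close>

definition probability_vector :: "real set \<Rightarrow> (real \<Rightarrow> real) \<Rightarrow> bool" where
  "probability_vector D p \<longleftrightarrow> (\<forall>d\<in>D. p d > 0) \<and> (\<Sum>d\<in>D. p d) = 1"

definition equal_weighted :: "real set \<Rightarrow> (real \<Rightarrow> real) \<Rightarrow> bool" where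
  "equal_weighted D p \<longleftrightarrow> (\<forall>d\<in>D. p d = 1 / real (card D))"

text \<open>
  For \<open>0 < \<rho> < 1\<close>, a finite digit set and a probability vector there is exactly one such measure
  (Hutchinson).
\<close>

definition self_similar_measure ::
    "real \<Rightarrow> real set \<Rightarrow> (real \<Rightarrow> real) \<Rightarrow> real measure \<Rightarrow> bool" where
  "self_similar_measure \<rho> D p \<mu> \<longleftrightarrow>
     prob_space \<mu> \<and> sets \<mu> = sets borel \<and>
     (\<forall>E\<in>sets borel. measure \<mu> E = (\<Sum>d\<in>D. p d * measure \<mu> ((\<lambda>x. \<rho> * (x + d)) -` E)))"

definition square_integrable :: "'a measure \<Rightarrow> ('a \<Rightarrow> complex) \<Rightarrow> bool" where
  "square_integrable M f \<longleftrightarrow>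
     f \<in> borel_measurable M \<and> integrable M (\<lambda>x. (cmod (f x))\<^sup>2)"

text \<open>
  An orthonormal basis of \<open>L\<^sup>2(M)\<close> is an orthonormal family with dense linear span; functions are
  used as representatives of their classes modulo null sets.
\<close>

definition orthonormal_basis_L2 ::
    "'a measure \<Rightarrow> 'i set \<Rightarrow> ('i \<Rightarrow> 'a \<Rightarrow> complex) \<Rightarrow> bool" where
  "orthonormal_basis_L2 M I e \<longleftrightarrow>
     (\<forall>i\<in>I. square_integrable M (e i)) \<and>
     (\<forall>i\<in>I. \<forall>j\<in>I. (LINT x|M. e i x * cnj (e j x)) = (if i = j then 1 else 0)) \<and>
     (\<forall>f. square_integrable M f \<longrightarrow>
        (\<forall>\<epsilon>>0. \<exists>S c. finite S \<and> S \<subseteq> I \<and>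
           sqrt (LINT x|M. (cmod (f x - (\<Sum>i\<in>S. c i * e i x)))\<^sup>2) < \<epsilon>))"

definition exponential :: "real \<Rightarrow> real \<Rightarrow> complex" where
  "exponential l x = exp (2 * of_real pi * \<i> * of_real l * of_real x)"

definition spectral_measure :: "real measure \<Rightarrow> bool" where
  "spectral_measure \<mu> \<longleftrightarrow>
     prob_space \<mu> \<and> sets \<mu> = sets borel \<and>
     (\<exists>\<Lambda>. countable \<Lambda> \<and> orthonormal_basis_L2 \<mu> \<Lambda> exponential)"

text \<open>\<open>H H\<^sup>* = 1\<close> and \<open>H\<^sup>* H = 1\<close> for a matrix with rows indexed by \<open>I\<close> and columns by \<open>J\<close>.\<close>

definition unitary_matrix :: "'i set \<Rightarrow> 'j set \<Rightarrow> ('i \<Rightarrow> 'j \<Rightarrow> complex) \<Rightarrow> bool" where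
  "unitary_matrix I J H \<longleftrightarrow>
     (\<forall>i\<in>I. \<forall>i'\<in>I. (\<Sum>j\<in>J. H i j * cnj (H i' j)) = (if i = i' then 1 else 0)) \<and>
     (\<forall>j\<in>J. \<forall>j'\<in>J. (\<Sum>i\<in>I. cnj (H i j) * H i j') = (if j = j' then 1 else 0))"

definition hadamard_triple :: "nat \<Rightarrow> int set \<Rightarrow> int set \<Rightarrow> bool" where
  "hadamard_triple N E L \<longleftrightarrow>
     N \<ge> 2 \<and> finite E \<and> finite L \<and> card E = card L \<and>
     unitary_matrix E L (\<lambda>d l.
       exp (- 2 * of_real pi * \<i> * of_int d * of_int l / of_nat N) / of_real (sqrt (real (card E))))"

definition direct_sum :: "int set \<Rightarrow> int set \<Rightarrow> bool" where
  "direct_sum A B \<longleftrightarrow> inj_on (\<lambda>(a, b). a + b) (A \<times> B)"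

text \<open>
  \<open>product_form_hadamard_triple_at s N E L\<^sub>1 L\<^sub>2\<close>: \<open>E\<close> is the union of the sets
  \<open>x + N\<^sup>s B\<^sub>x\<close>.  The plain notion is \<open>s = 1\<close>.  The base \<open>N\<close> of the Hadamard triples does
  not change with \<open>s\<close>, so scale \<open>s\<close> for \<open>N\<close> and scale \<open>1\<close> for \<open>N\<^sup>s\<close> are different notions.
\<close>

definition product_form_hadamard_triple_at ::
    "nat \<Rightarrow> nat \<Rightarrow> int set \<Rightarrow> int set \<Rightarrow> int set \<Rightarrow> bool" where
  "product_form_hadamard_triple_at s N E L1 L2 \<longleftrightarrow>
     (\<exists>A B. E = (\<Union>x\<in>A. (\<lambda>b. x + int N ^ s * b) ` B x) \<and>
        direct_sum L1 L2 \<and>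
        hadamard_triple N A L1 \<and>
        (\<forall>x\<in>A. hadamard_triple N (B x) L2 \<and>
           direct_sum A (B x) \<and> hadamard_triple N (A + B x) (L1 + L2)))"

definition product_form_hadamard_triple ::
    "nat \<Rightarrow> int set \<Rightarrow> int set \<Rightarrow> int set \<Rightarrow> bool" where
  "product_form_hadamard_triple N E L1 L2 \<longleftrightarrow> product_form_hadamard_triple_at 1 N E L1 L2"

text \<open>
  The modified Laba--Wang conjecture for a single system.  The sum over \<open>j\<close> is the Minkowski sum
  of sets.
\<close>

definition modified_Laba_Wang ::
    "real \<Rightarrow> real set \<Rightarrow> (real \<Rightarrow> real) \<Rightarrow> real measure \<Rightarrow> bool" where
  "modified_Laba_Wang \<rho> D p \<mu> \<longleftrightarrow>
     (0 < \<rho> \<and> \<rho> < 1 \<and> finite D \<and> probability_vector D p \<and>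
      self_similar_measure \<rho> D p \<mu> \<and> spectral_measure \<mu> \<and>
      D \<subseteq> \<int> \<inter> {0..} \<and> 0 \<in> D \<longrightarrow>
        equal_weighted D p \<and>
        (\<exists>N::nat. N \<ge> 2 \<and> \<rho> = 1 / real N \<and>
          (\<exists>\<alpha> > 0. \<exists>C :: int set. D = (\<lambda>c. \<alpha> * real_of_int c) ` C \<and>
            (\<exists>M > 0. \<exists>K > 0. \<exists>L1 L2.
               product_form_hadamard_triple (N ^ K)
                 (\<Sum>j<K. (\<lambda>c. int N ^ j * (M * c)) ` C) L1 L2))))"

end

theory Submission
  imports Defs "HOL-Real_Asymp.Real_Asymp"
begin

text \<open>
  Parseval's identity determines the norm of a function \<open>f\<close> in \<open>L\<^sup>2(\<mu>)\<close> from the modulus of the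
  Fourier transform of \<open>f \<mu>\<close>, hence translates of pieces of \<open>\<mu>\<close> inside \<open>\<mu>\<close> have densities with
  two values only. Near the two ends of the support this forces equal weights. Applied to the
  piece at the left end it also shows that the spectrum cannot be split into fewer than \<open>4^n\<close>
  classes whose images under multiplication with \<open>\<rho>^n\<close> are orthogonal. The differences of the
  spectrum lie in the union of the sets of odd multiples of \<open>\<rho>^-j g\<close> for at most three numbers
  \<open>g\<close>, and odd multiples of one number are separated by a parity colouring. Economical
  colourings therefore exclude every digit set but the stated ones, every irrational \<open>\<rho>\<close>, every
  \<open>\<rho> = P / Q\<close> with \<open>P\<close> even or \<open>Q\<close> odd, and the case that \<open>\<beta>\<close> divides \<open>t\<close>. For \<open>P > 1\<close> the spectrum
  has gaps growing like \<open>Q^n\<close> instead of \<open>\<rho>^-n\<close>, and the logarithmic decay of the Fourier transform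
  makes such a sparse orthogonal set incomplete. The Hadamard triples are then obtained by
  splitting the digits after the lowest \<open>k\<close> base-\<open>N\<close> places.
\<close>

section \<open>Fourier analysis of a probability measure on the line\<close>

text \<open>Equal weights turn \<open>p 0 ^ n\<close> into the n-th power of 1/4, so n levels of
  zeros demand \<open>4 ^ n\<close> colours, while parities for a set I of generators use only
  \<open>2 ^ card I\<close>. Two generators per level are thus the break-even point, and a case is
  excluded when its generators coincide, share colours or run out. Four digits enter twice. Overlaps
  of pieces of the measure are under control only at an end of the support and next to it, and four
  digits are just two ends with their neighbours. Moreover four unit complex numbers add up to zero
  only as two antipodal pairs, which is why the zeros of the mask polynomial are odd multiples of
  few numbers. The obstacle is odd P > 1 with even Q: there generators of different levels are all
  different, counting yields nothing, and analysis has to take over. It relies on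
  \<open>\<beta>\<close> not dividing t, since only then does the 2-adic valuation of a difference
  determine its level, and this is what bounds the denominators in the spectrum.\<close>

lemma exponential_measurable [measurable]: "exponential l \<in> borel_measurable borel"
  unfolding exponential_def by measurable

lemma norm_exponential [simp]: "cmod (exponential l x) = 1"
proof -
  have "2 * of_real pi * \<i> * of_real l * of_real x = \<i> * of_real (2 * pi * l * x)"
    by simp
  then show ?thesis unfolding exponential_def by (simp only: norm_exp_i_times)
qed

lemma exponential_cis: "exponential l x = cis (2 * pi * l * x)"
  unfolding exponential_def cis_conv_exp by (simp add: mult_ac)

lemma cnj_exponential: "cnj (exponential l x) = exponential (- l) x"
  by (simp add: exponential_cis cis_cnj)

lemma exponential_add_freq: "exponential (l + k) x = exponential l x * exponential k x"
  by (simp add: exponential_cis cis_mult algebra_simps)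

lemma exponential_add: "exponential l (x + y) = exponential l x * exponential l y"
  by (simp add: exponential_cis cis_mult algebra_simps)

lemma exponential_scale: "exponential l (r * x) = exponential (r * l) x"
  by (simp add: exponential_cis algebra_simps)

lemma exponential_0 [simp]: "exponential 0 x = 1" "exponential l 0 = 1"
  by (simp_all add: exponential_cis)

text \<open>The class of test functions: closed under the operations below and integrable for every
  probability measure on the line. Completeness of the spectrum enters later only as Parseval's
  identity on this class.\<close>

definition bounded_borel :: "(real \<Rightarrow> complex) \<Rightarrow> bool" where
  "bounded_borel f \<longleftrightarrow> f \<in> borel_measurable borel \<and> (\<exists>B. \<forall>x. cmod (f x) \<le> B)"

named_theorems bounded_borel_intros

lemma bounded_borelI: "f \<in> borel_measurable borel \<Longrightarrow> (\<And>x. cmod (f x) \<le> B) \<Longrightarrow> bounded_borel f"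
  unfolding bounded_borel_def by auto

lemma bounded_borel_measurable: "bounded_borel f \<Longrightarrow> f \<in> borel_measurable borel"
  by (simp add: bounded_borel_def)

lemma bounded_borel_exponential [bounded_borel_intros]: "bounded_borel (exponential l)"
  by (rule bounded_borelI[where B = 1]) auto

lemma bounded_borel_exponential' [bounded_borel_intros]: "bounded_borel (\<lambda>x. exponential l x)"
  using bounded_borel_exponential[of l] by simp

lemma bounded_borel_const [bounded_borel_intros]: "bounded_borel (\<lambda>x. c)"
  by (rule bounded_borelI[where B = "cmod c"]) auto

lemma bounded_borel_cnj [bounded_borel_intros]: "bounded_borel f \<Longrightarrow> bounded_borel (\<lambda>x. cnj (f x))"
  unfolding bounded_borel_def
  by (auto intro!: measurable_compose[OF _ borel_measurable_continuous_onI[of cnj]] continuous_intros)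

lemma bounded_borel_add [bounded_borel_intros]:
  assumes "bounded_borel f" "bounded_borel g"
  shows "bounded_borel (\<lambda>x. f x + g x)"
proof -
  obtain A B where "\<And>x. cmod (f x) \<le> A" "\<And>x. cmod (g x) \<le> B"
    using assms by (auto simp: bounded_borel_def)
  then have "cmod (f x + g x) \<le> A + B" for x
    by (meson add_mono norm_triangle_le)
  with assms show ?thesis
    by (intro bounded_borelI[where B = "A + B"]) (auto simp: bounded_borel_def)
qed

lemma bounded_borel_mult [bounded_borel_intros]:
  assumes "bounded_borel f" "bounded_borel g"
  shows "bounded_borel (\<lambda>x. f x * g x)"
proof -
  obtain A B where "\<And>x. cmod (f x) \<le> A" "\<And>x. cmod (g x) \<le> B"
    using assms by (auto simp: bounded_borel_def)
  then have "cmod (f x * g x) \<le> A * B" for x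
    unfolding norm_mult by (meson mult_mono norm_ge_zero order_trans)
  with assms show ?thesis
    by (intro bounded_borelI[where B = "A * B"]) (auto simp: bounded_borel_def)
qed

lemma bounded_borel_diff [bounded_borel_intros]:
  "bounded_borel f \<Longrightarrow> bounded_borel g \<Longrightarrow> bounded_borel (\<lambda>x. f x - g x)"
  using bounded_borel_add[of f "\<lambda>x. (- 1) * g x"] bounded_borel_mult[of "\<lambda>x. - 1" g]
  by (simp add: bounded_borel_const)

lemma bounded_borel_sum [bounded_borel_intros]:
  "(\<And>i. i \<in> S \<Longrightarrow> bounded_borel (f i)) \<Longrightarrow> bounded_borel (\<lambda>x. \<Sum>i\<in>S. f i x)"
  by (induction S rule: infinite_finite_induct) (auto intro: bounded_borel_intros)

lemma bounded_borel_comp: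
  assumes "bounded_borel f" and [measurable]: "g \<in> borel_measurable borel"
  shows "bounded_borel (\<lambda>x. f (g x))"
  using assms unfolding bounded_borel_def by (auto intro: measurable_compose)

lemma bounded_borel_indicator [bounded_borel_intros]: "A \<in> sets borel \<Longrightarrow> bounded_borel (indicator A)"
  by (rule bounded_borelI[where B = 1]) (auto simp: indicator_def)

lemma bounded_borel_indicator' [bounded_borel_intros]: "A \<in> sets borel \<Longrightarrow> bounded_borel (\<lambda>x. indicator A x)"
  using bounded_borel_indicator[of A] by simp

lemma bounded_borel_of_real:
  assumes "g \<in> borel_measurable borel" "\<And>x. 0 \<le> g x" "\<And>x. g x \<le> 1"
  shows "bounded_borel (\<lambda>x. of_real (g x))"
  using assms by (intro bounded_borelI[where B = 1]) auto

section \<open>Approximation by orthonormal systems and Bessel's inequality\<close>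

context real_distribution
begin

lemma measurable_bounded_borel: "bounded_borel f \<Longrightarrow> f \<in> borel_measurable M"
  unfolding bounded_borel_def by simp

lemma integrable_bounded_borel: "bounded_borel f \<Longrightarrow> integrable M f"
  unfolding bounded_borel_def by (auto intro!: integrable_const_bound)

lemma integrable_norm_sq_bounded_borel: "bounded_borel f \<Longrightarrow> integrable M (\<lambda>x. (cmod (f x))\<^sup>2)"
proof -
  assume f: "bounded_borel f"
  then obtain B where "\<And>x. cmod (f x) \<le> B" by (auto simp: bounded_borel_def)
  then have "(cmod (f x))\<^sup>2 \<le> B\<^sup>2" for x by (simp add: power_mono)
  with f show ?thesis
    by (intro integrable_const_bound[where B = "B\<^sup>2"]) (auto simp: bounded_borel_def)
qed

lemma complex_norm_sq_integral:
  assumes "bounded_borel f"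
  shows "(LINT x|M. f x * cnj (f x)) = of_real (LINT x|M. (cmod (f x))\<^sup>2)"
proof -
  have "(LINT x|M. f x * cnj (f x)) = (LINT x|M. of_real ((cmod (f x))\<^sup>2))"
    by (simp only: complex_norm_square)
  then show ?thesis by (simp only: integral_complex_of_real)
qed

text \<open>Completing the square. The coefficients \<open>c\<close> are arbitrary because density
  of the span supplies approximations with unspecified coefficients; the last sum shows that the
  Fourier coefficients are the best choice.\<close>

lemma approximation_error:
  assumes f: "bounded_borel f" and S: "finite S"
    and e: "\<And>i. i \<in> S \<Longrightarrow> bounded_borel (e i)"
    and orth: "\<And>i j. i \<in> S \<Longrightarrow> j \<in> S \<Longrightarrow>
      (LINT x|M. e i x * cnj (e j x)) = (if i = j then 1 else 0)"
  shows "(LINT x|M. (cmod (f x - (\<Sum>i\<in>S. c i * e i x)))\<^sup>2) =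
    (LINT x|M. (cmod (f x))\<^sup>2) - (\<Sum>i\<in>S. (cmod (LINT x|M. f x * cnj (e i x)))\<^sup>2)
    + (\<Sum>i\<in>S. (cmod ((LINT x|M. f x * cnj (e i x)) - c i))\<^sup>2)"
proof -
  define a where "a i = (LINT x|M. f x * cnj (e i x))" for i
  define g where "g x = (\<Sum>i\<in>S. c i * e i x)" for x
  have g: "bounded_borel g"
    unfolding g_def by (intro bounded_borel_intros e)
  have fe: "bounded_borel (\<lambda>x. f x * cnj (e i x))" if "i \<in> S" for i
    using that by (intro bounded_borel_intros f e)
  have fg: "(LINT x|M. f x * cnj (g x)) = (\<Sum>i\<in>S. cnj (c i) * a i)"
  proof -
    have "(LINT x|M. f x * cnj (g x)) = (LINT x|M. (\<Sum>i\<in>S. cnj (c i) * (f x * cnj (e i x))))"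
      unfolding g_def by (simp add: sum_distrib_left mult_ac)
    also have "\<dots> = (\<Sum>i\<in>S. cnj (c i) * a i)"
      unfolding a_def using fe f e by (subst Bochner_Integration.integral_sum) (auto intro!: integrable_bounded_borel bounded_borel_intros)
    finally show ?thesis .
  qed
  have eg: "(LINT x|M. e i x * cnj (g x)) = cnj (c i)" if "i \<in> S" for i
  proof -
    have "(LINT x|M. e i x * cnj (g x)) = (LINT x|M. (\<Sum>j\<in>S. cnj (c j) * (e i x * cnj (e j x))))"
      unfolding g_def by (simp add: sum_distrib_left mult_ac)
    also have "\<dots> = (\<Sum>j\<in>S. cnj (c j) * (if i = j then 1 else 0))"
      using that e orth
      by (subst Bochner_Integration.integral_sum) (auto intro!: integrable_bounded_borel bounded_borel_intros sum.cong)
    also have "\<dots> = (\<Sum>j\<in>S. if i = j then cnj (c j) else 0)"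
      by (rule sum.cong) auto
    also have "\<dots> = cnj (c i)"
      using S that by (subst sum.delta') simp_all
    finally show ?thesis .
  qed
  have gg: "(LINT x|M. g x * cnj (g x)) = (\<Sum>i\<in>S. c i * cnj (c i))"
  proof -
    have "(LINT x|M. g x * cnj (g x)) = (LINT x|M. (\<Sum>i\<in>S. c i * (e i x * cnj (g x))))"
      by (rule Bochner_Integration.integral_cong) (simp_all add: g_def sum_distrib_right mult.assoc)
    also have "\<dots> = (\<Sum>i\<in>S. c i * cnj (c i))"
      using e g eg
      by (subst Bochner_Integration.integral_sum) (auto intro!: integrable_bounded_borel bounded_borel_intros sum.cong)
    finally show ?thesis .
  qed
  have gf: "(LINT x|M. g x * cnj (f x)) = cnj (LINT x|M. f x * cnj (g x))"
    by (simp add: mult_ac flip: Bochner_Integration.integral_cnj)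
  have "of_real (LINT x|M. (cmod (f x - g x))\<^sup>2) = (LINT x|M. (f x - g x) * cnj (f x - g x))"
    by (rule complex_norm_sq_integral[symmetric]) (intro bounded_borel_intros f g)
  also have "\<dots> = (LINT x|M. (f x * cnj (f x) + g x * cnj (g x)) - (f x * cnj (g x) + g x * cnj (f x)))"
    by (rule Bochner_Integration.integral_cong) (auto simp: algebra_simps)
  also have "\<dots> = (LINT x|M. f x * cnj (f x)) + (LINT x|M. g x * cnj (g x))
      - ((LINT x|M. f x * cnj (g x)) + (LINT x|M. g x * cnj (f x)))"
    using f g by (subst Bochner_Integration.integral_diff Bochner_Integration.integral_add;
        auto intro!: integrable_bounded_borel bounded_borel_intros)+
  also have "\<dots> = of_real (LINT x|M. (cmod (f x))\<^sup>2) + (\<Sum>i\<in>S. c i * cnj (c i))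
      - ((\<Sum>i\<in>S. cnj (c i) * a i) + (\<Sum>i\<in>S. c i * cnj (a i)))"
    unfolding gf gg fg complex_norm_sq_integral[OF f] by simp
  also have "\<dots> = of_real ((LINT x|M. (cmod (f x))\<^sup>2) - (\<Sum>i\<in>S. (cmod (a i))\<^sup>2)
    + (\<Sum>i\<in>S. (cmod (a i - c i))\<^sup>2))"
    unfolding of_real_add of_real_diff of_real_sum complex_norm_square
    by (simp add: algebra_simps sum.distrib sum_subtractf)
  finally show ?thesis
    unfolding a_def[symmetric] g_def[symmetric] of_real_eq_iff .
qed

lemma Bessel_inequality:
  assumes "bounded_borel f" "finite S"
    and "\<And>i. i \<in> S \<Longrightarrow> bounded_borel (e i)"
    and "\<And>i j. i \<in> S \<Longrightarrow> j \<in> S \<Longrightarrow>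
      (LINT x|M. e i x * cnj (e j x)) = (if i = j then 1 else 0)"
  shows "(\<Sum>i\<in>S. (cmod (LINT x|M. f x * cnj (e i x)))\<^sup>2) \<le> (LINT x|M. (cmod (f x))\<^sup>2)"
proof -
  have "0 \<le> (LINT x|M. (cmod (f x - (\<Sum>i\<in>S. (LINT x|M. f x * cnj (e i x)) * e i x)))\<^sup>2)"
    by simp
  then show ?thesis
    by (subst (asm) approximation_error[OF assms]) simp_all
qed

end

section \<open>Fourier transform and Parseval's identity\<close>

definition fourier :: "real measure \<Rightarrow> real \<Rightarrow> complex" where
  "fourier M l = (LINT x|M. exponential l x)"

definition parseval :: "real measure \<Rightarrow> real set \<Rightarrow> bool" where
  "parseval M \<Lambda> \<longleftrightarrow> (\<forall>f. bounded_borel f \<longrightarrow>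
     ((\<lambda>l. (cmod (LINT x|M. f x * cnj (exponential l x)))\<^sup>2) has_sum
       (LINT x|M. (cmod (f x))\<^sup>2)) \<Lambda>)"

context real_distribution
begin

lemma exponential_inner:
  "(LINT x|M. exponential l x * cnj (exponential k x)) = fourier M (l - k)"
  unfolding fourier_def cnj_exponential by (simp add: exponential_add_freq[symmetric])

lemma fourier_0 [simp]: "fourier M 0 = 1"
  unfolding fourier_def exponential_0 using prob_space by simp

lemma norm_fourier_le_1: "cmod (fourier M l) \<le> 1"
proof -
  have "cmod (fourier M l) \<le> (LINT x|M. cmod (exponential l x))"
    unfolding fourier_def by (rule integral_norm_bound)
  then show ?thesis using prob_space by simp
qed

lemma fourier_conv_char: "fourier M l = char M (2 * pi * l)"
  unfolding fourier_def char_def exponential_cis cis_conv_exp by (simp add: mult_ac)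

lemma isCont_fourier: "isCont (fourier M) l"
proof -
  have "isCont (\<lambda>l. char M (2 * pi * l)) l"
    by (intro isCont_o2[OF _ isCont_char] continuous_intros)
  then show ?thesis
    by (simp add: fourier_conv_char[abs_def])
qed

lemma Bessel_exponential:
  assumes "bounded_borel f" "finite S"
    and "\<And>k l. k \<in> S \<Longrightarrow> l \<in> S \<Longrightarrow> k \<noteq> l \<Longrightarrow> fourier M (k - l) = 0"
  shows "(\<Sum>l\<in>S. (cmod (LINT x|M. f x * cnj (exponential l x)))\<^sup>2) \<le> (LINT x|M. (cmod (f x))\<^sup>2)"
  by (rule Bessel_inequality) (use assms in \<open>auto simp: exponential_inner intro: bounded_borel_intros\<close>)

text \<open>Bessel's inequality bounds the finite sums from above. Conversely, an approximation with
  any coefficients only improves when they are replaced by the Fourier coefficients, so the finite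
  sums come arbitrarily close to the squared norm.\<close>

lemma parseval_if_basis:
  assumes basis: "orthonormal_basis_L2 M \<Lambda> exponential"
  shows "parseval M \<Lambda>"
    and "\<And>k l. k \<in> \<Lambda> \<Longrightarrow> l \<in> \<Lambda> \<Longrightarrow> k \<noteq> l \<Longrightarrow> fourier M (k - l) = 0"
proof -
  have orth: "(LINT x|M. exponential i x * cnj (exponential j x)) = (if i = j then 1 else 0)"
    if "i \<in> \<Lambda>" "j \<in> \<Lambda>" for i j
    using basis that unfolding orthonormal_basis_L2_def by blast
  show "fourier M (k - l) = 0" if "k \<in> \<Lambda>" "l \<in> \<Lambda>" "k \<noteq> l" for k l
    using orth[of k l] that by (simp add: exponential_inner)
  show "parseval M \<Lambda>"
    unfolding parseval_def
  proof (intro allI impI)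
    fix f assume f: "bounded_borel f"
    define a where "a l = (cmod (LINT x|M. f x * cnj (exponential l x)))\<^sup>2" for l
    define s where "s = (LINT x|M. (cmod (f x))\<^sup>2)"
    have upper: "sum a S \<le> s" if "finite S" "S \<subseteq> \<Lambda>" for S
      unfolding a_def s_def using that(1)
      by (intro Bessel_inequality f bounded_borel_intros orth subsetD[OF that(2)])
    have lower: "\<exists>S. finite S \<and> S \<subseteq> \<Lambda> \<and> s - r < sum a S" if r: "r > 0" for r
    proof -
      have "square_integrable M f"
        using f unfolding square_integrable_def
        by (auto intro: integrable_norm_sq_bounded_borel measurable_bounded_borel)
      with basis have "\<forall>\<epsilon>>0. \<exists>S c. finite S \<and> S \<subseteq> \<Lambda> \<and>
          sqrt (LINT x|M. (cmod (f x - (\<Sum>i\<in>S. c i * exponential i x)))\<^sup>2) < \<epsilon>"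
        unfolding orthonormal_basis_L2_def by (elim conjE allE[where x = f] impE)
      then obtain S c where S: "finite S" "S \<subseteq> \<Lambda>"
        "sqrt (LINT x|M. (cmod (f x - (\<Sum>i\<in>S. c i * exponential i x)))\<^sup>2) < sqrt r"
        using real_sqrt_gt_zero[OF r] by blast
      have "(LINT x|M. (cmod (f x - (\<Sum>i\<in>S. c i * exponential i x)))\<^sup>2) =
        s - sum a S + (\<Sum>i\<in>S. (cmod ((LINT x|M. f x * cnj (exponential i x)) - c i))\<^sup>2)"
        unfolding s_def a_def using S(1)
        by (intro approximation_error f bounded_borel_intros orth subsetD[OF S(2)])
      moreover have "(\<Sum>i\<in>S. (cmod ((LINT x|M. f x * cnj (exponential i x)) - c i))\<^sup>2) \<ge> 0"
        by (simp add: sum_nonneg)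
      ultimately have "s - sum a S < r" using S(3) by simp
      with S show ?thesis by (intro exI[of _ S]) auto
    qed
    have "(a has_sum s) \<Lambda>"
      unfolding has_sum_def tendsto_iff eventually_finite_subsets_at_top
    proof (intro allI impI)
      fix r :: real assume "r > 0"
      from lower[OF this] obtain S where S: "finite S" "S \<subseteq> \<Lambda>" "s - r < sum a S" by blast
      have "dist (sum a T) s < r" if T: "finite T" "S \<subseteq> T" "T \<subseteq> \<Lambda>" for T
      proof -
        have "sum a S \<le> sum a T"
          using T by (intro sum_mono2) (auto simp: a_def)
        with S(3) upper[OF T(1,3)] show ?thesis by (simp add: dist_real_def)
      qed
      with S show "\<exists>X. finite X \<and> X \<subseteq> \<Lambda> \<and> (\<forall>Y. finite Y \<and> X \<subseteq> Y \<and> Y \<subseteq> \<Lambda> \<longrightarrow> dist (sum a Y) s < r)"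
        by blast
    qed
    then show "((\<lambda>l. (cmod (LINT x|M. f x * cnj (exponential l x)))\<^sup>2) has_sum
        (LINT x|M. (cmod (f x))\<^sup>2)) \<Lambda>"
      unfolding a_def s_def .
  qed
qed

end

section \<open>Self-similar measures\<close>

text \<open>The law of \<open>\<phi> d x\<close> for \<open>d\<close> drawn with weights
  \<open>p\<close> and \<open>x\<close> drawn independently with law \<open>M\<close>. Similarities
  \<open>\<phi>\<close> express the invariance of \<mu>, translations build convolutions.\<close>

definition mixture ::
    "real set \<Rightarrow> (real \<Rightarrow> real) \<Rightarrow> (real \<Rightarrow> real \<Rightarrow> real) \<Rightarrow> real measure \<Rightarrow> real measure" where
  "mixture D p \<phi> M = distr (point_measure D p \<Otimes>\<^sub>M M) borel (\<lambda>(d, x). \<phi> d x)"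

text \<open>The Fourier transform of the discrete measure with mass \<open>p d\<close> at each digit
  \<open>d\<close>.\<close>

definition mask_poly :: "real set \<Rightarrow> (real \<Rightarrow> real) \<Rightarrow> real \<Rightarrow> complex" where
  "mask_poly D p l = (\<Sum>d\<in>D. of_real (p d) * exponential l d)"

context
  fixes D :: "real set" and p :: "real \<Rightarrow> real" and \<phi> :: "real \<Rightarrow> real \<Rightarrow> real" and M :: "real measure"
  assumes fin: "finite D" and pv: "probability_vector D p" and M: "real_distribution M"
    and \<phi>: "\<And>d. d \<in> D \<Longrightarrow> \<phi> d \<in> borel_measurable borel"
begin

interpretation M: real_distribution M by (rule M)

interpretation P: prob_space "point_measure D p"
  using pv fin by (intro prob_space_point_measure) (auto simp: probability_vector_def sum_ennreal less_imp_le)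

interpretation PM: pair_prob_space "point_measure D p" M ..

lemma measurable_mixture: "(\<lambda>(d, x). \<phi> d x) \<in> borel_measurable (point_measure D p \<Otimes>\<^sub>M M)"
proof -
  have "(\<lambda>(d, x). \<phi> d x) \<in> borel_measurable (count_space D \<Otimes>\<^sub>M M)"
    using fin \<phi> by (intro measurable_pair_measure_countable1) (auto intro: countable_finite)
  then show ?thesis
    by (subst measurable_cong_sets[OF sets_pair_measure_cong[OF sets_point_measure_count_space refl] refl])
qed

lemma real_distribution_mixture: "real_distribution (mixture D p \<phi> M)"
  unfolding mixture_def real_distribution_def real_distribution_axioms_def
  using PM.P.prob_space_distr[OF measurable_mixture] by simp

lemma integral_mixture:
  assumes f: "bounded_borel f"
  shows "(LINT x|mixture D p \<phi> M. f x) = (\<Sum>d\<in>D. of_real (p d) * (LINT x|M. f (\<phi> d x)))"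
proof -
  obtain B where B: "\<And>x. cmod (f x) \<le> B" using f by (auto simp: bounded_borel_def)
  have fm: "f \<in> borel_measurable borel" using f by (simp add: bounded_borel_def)
  have int: "integrable (point_measure D p \<Otimes>\<^sub>M M) (\<lambda>z. f ((\<lambda>(d, x). \<phi> d x) z))"
    using B measurable_compose[OF measurable_mixture fm]
    by (intro PM.P.integrable_const_bound[where B = B]) (auto simp: split_def)
  have "(LINT x|mixture D p \<phi> M. f x) =
      (LINT z|(point_measure D p \<Otimes>\<^sub>M M). f ((\<lambda>(d, x). \<phi> d x) z))"
    unfolding mixture_def by (rule integral_distr[OF measurable_mixture fm])
  also have "\<dots> = (LINT d|point_measure D p. (LINT x|M. f (\<phi> d x)))"
    using PM.integral_fst'[OF int] by simp
  also have "\<dots> = (\<Sum>d\<in>D. of_real (p d) * (LINT x|M. f (\<phi> d x)))"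
    using pv fin
    by (subst lebesgue_integral_point_measure_finite)
      (auto simp: probability_vector_def scaleR_conv_of_real intro: less_imp_le)
  finally show ?thesis .
qed

end

lemma (in real_distribution) integral_indicator_complex:
  assumes "A \<in> sets borel"
  shows "(LINT x|M. indicator A x :: complex) = of_real (measure M A)"
proof -
  have "(LINT x|M. indicator A x :: complex) = (LINT x|M. of_real (indicator A x))"
    by (rule Bochner_Integration.integral_cong) (auto simp: indicator_def)
  also have "\<dots> = of_real (LINT x|M. indicator A x)"
    by (rule integral_complex_of_real)
  finally show ?thesis using assms by simp
qed

lemma measure_mixture:
  assumes "finite D" "probability_vector D p" "real_distribution M"
    and \<phi>: "\<And>d. d \<in> D \<Longrightarrow> \<phi> d \<in> borel_measurable borel" and E: "E \<in> sets borel"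
  shows "measure (mixture D p \<phi> M) E = (\<Sum>d\<in>D. p d * measure M (\<phi> d -` E))"
proof -
  interpret M: real_distribution M by fact
  interpret N: real_distribution "mixture D p \<phi> M" using assms by (intro real_distribution_mixture)
  have "of_real (measure (mixture D p \<phi> M) E) = (LINT x|mixture D p \<phi> M. indicator E x :: complex)"
    using N.integral_indicator_complex[OF E] by simp
  also have "\<dots> = (\<Sum>d\<in>D. of_real (p d) * (LINT x|M. indicator E (\<phi> d x)))"
    using assms by (intro integral_mixture bounded_borel_intros)
  also have "\<dots> = (\<Sum>d\<in>D. of_real (p d) * of_real (measure M (\<phi> d -` E)))"
  proof (rule sum.cong[OF refl])
    fix d assume d: "d \<in> D"
    have "\<phi> d -` E \<in> sets borel" using measurable_sets[OF \<phi>[OF d] E] by simp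
    moreover have "(LINT x|M. indicator E (\<phi> d x) :: complex) = (LINT x|M. indicator (\<phi> d -` E) x)"
      by (simp add: indicator_def)
    ultimately show "of_real (p d) * (LINT x|M. indicator E (\<phi> d x)) =
        complex_of_real (p d) * of_real (measure M (\<phi> d -` E))"
      using M.integral_indicator_complex by simp
  qed
  also have "\<dots> = of_real (\<Sum>d\<in>D. p d * measure M (\<phi> d -` E))" by simp
  finally show ?thesis by (simp only: of_real_eq_iff)
qed

lemma norm_mask_le_1:
  assumes "probability_vector D p"
  shows "cmod (mask_poly D p l) \<le> 1"
proof -
  have "cmod (mask_poly D p l) \<le> (\<Sum>d\<in>D. cmod (of_real (p d) * exponential l d))"
    unfolding mask_poly_def by (rule norm_sum)
  also have "\<dots> = (\<Sum>d\<in>D. p d)"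
    using assms by (intro sum.cong) (auto simp: norm_mult probability_vector_def)
  finally show ?thesis using assms by (simp add: probability_vector_def)
qed

lemma filterlim_realpow_at_top: "1 < (x :: real) \<Longrightarrow> filterlim (\<lambda>n. x ^ n) at_top sequentially"
  by real_asymp

section \<open>The invariant measure: product formula, support, leftmost piece\<close>

locale self_similar =
  fixes \<rho> :: real and D :: "real set" and p :: "real \<Rightarrow> real" and \<mu> :: "real measure"
  assumes \<rho>: "0 < \<rho>" "\<rho> < 1" and fin_D: "finite D" and D_nonneg: "D \<subseteq> {0..}" and zero_D: "0 \<in> D"
    and pv: "probability_vector D p" and ssm: "self_similar_measure \<rho> D p \<mu>"
begin

sublocale real_distribution \<mu>
  using ssm unfolding self_similar_measure_def real_distribution_def real_distribution_axioms_def
  by simp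

lemma p_pos: "d \<in> D \<Longrightarrow> 0 < p d"
  using pv by (simp add: probability_vector_def)

lemma measure_eq:
  "E \<in> sets borel \<Longrightarrow> measure \<mu> E = (\<Sum>d\<in>D. p d * measure \<mu> ((\<lambda>x. \<rho> * (x + d)) -` E))"
  using ssm unfolding self_similar_measure_def by blast

text \<open>Invariance is given for sets; as an equality of measures it passes to integrals through
  \<open>integral_mixture\<close>.\<close>

lemma mixture_eq: "mixture D p (\<lambda>d x. \<rho> * (x + d)) \<mu> = \<mu>"
proof -
  interpret N: real_distribution "mixture D p (\<lambda>d x. \<rho> * (x + d)) \<mu>"
    by (intro real_distribution_mixture fin_D pv real_distribution_axioms) simp
  show ?thesis
  proof (rule measure_eqI)
    fix E assume "E \<in> sets (mixture D p (\<lambda>d x. \<rho> * (x + d)) \<mu>)"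
    then have "E \<in> sets borel" by simp
    then have "measure (mixture D p (\<lambda>d x. \<rho> * (x + d)) \<mu>) E = measure \<mu> E"
      by (subst measure_mixture[OF fin_D pv real_distribution_axioms]) (simp_all add: measure_eq)
    then show "emeasure (mixture D p (\<lambda>d x. \<rho> * (x + d)) \<mu>) E = emeasure \<mu> E"
      by (simp add: N.emeasure_eq_measure emeasure_eq_measure)
  qed simp
qed

lemma integral_eq:
  assumes "bounded_borel f"
  shows "(LINT x|\<mu>. f x) = (\<Sum>d\<in>D. of_real (p d) * (LINT x|\<mu>. f (\<rho> * (x + d))))"
  using integral_mixture[OF fin_D pv real_distribution_axioms, of "\<lambda>d x. \<rho> * (x + d)" f] assms
  by (simp add: mixture_eq)

lemma fourier_scale: "fourier \<mu> l = mask_poly D p (\<rho> * l) * fourier \<mu> (\<rho> * l)"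
proof -
  have "fourier \<mu> l = (\<Sum>d\<in>D. of_real (p d) * (LINT x|\<mu>. exponential l (\<rho> * (x + d))))"
    unfolding fourier_def by (intro integral_eq bounded_borel_intros)
  also have "\<dots> = (\<Sum>d\<in>D. of_real (p d) * exponential (\<rho> * l) d * fourier \<mu> (\<rho> * l))"
    by (simp add: exponential_scale exponential_add fourier_def mult_ac)
  finally show ?thesis by (simp add: mask_poly_def sum_distrib_right)
qed

lemma fourier_prod: "fourier \<mu> l = (\<Prod>j=1..n. mask_poly D p (\<rho> ^ j * l)) * fourier \<mu> (\<rho> ^ n * l)"
proof (induction n)
  case (Suc n)
  have "fourier \<mu> (\<rho> ^ n * l) = mask_poly D p (\<rho> ^ Suc n * l) * fourier \<mu> (\<rho> ^ Suc n * l)"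
    using fourier_scale[of "\<rho> ^ n * l"] by (simp add: mult_ac)
  with Suc show ?case by simp
qed simp

text \<open>The last factor \<open>fourier \<mu> (\<rho> ^ n * l)\<close> of the product formula
  tends to \<open>fourier \<mu> 0 = 1\<close>, so it cannot vanish for every n.\<close>

lemma fourier_zero:
  assumes "fourier \<mu> l = 0"
  shows "\<exists>j\<ge>1. mask_poly D p (\<rho> ^ j * l) = 0"
proof (rule ccontr)
  assume no: "\<not> (\<exists>j\<ge>1. mask_poly D p (\<rho> ^ j * l) = 0)"
  have zero: "fourier \<mu> (\<rho> ^ n * l) = 0" for n
    using assms no by (subst (asm) fourier_prod[of _ n]) auto
  have "(\<lambda>n. \<rho> ^ n * l) \<longlonglongrightarrow> 0 * l"
    using \<rho> by (intro tendsto_intros LIMSEQ_realpow_zero) auto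
  then have "(\<lambda>n. fourier \<mu> (\<rho> ^ n * l)) \<longlonglongrightarrow> fourier \<mu> 0"
    using isCont_fourier by (intro isCont_tendsto_compose[of _ "fourier \<mu>"]) auto
  with zero show False by (simp add: LIMSEQ_const_iff)
qed

lemma fourier_zeroI:
  assumes "mask_poly D p (\<rho> ^ j * l) = 0" "j \<ge> 1"
  shows "fourier \<mu> l = 0"
proof -
  have "(\<Prod>i=1..j. mask_poly D p (\<rho> ^ i * l)) = 0"
    using assms by (intro prod_zero) auto
  then show ?thesis by (subst fourier_prod[of _ j]) simp
qed

text \<open>The witness is the law of the sum of \<open>\<rho> ^ j * d\<close> over j from 1 to n
  with independent digits. An actual measure is wanted because Bessel's inequality will be applied
  to it.\<close>

lemma ex_approximant:
  "\<exists>N. real_distribution N \<and> (\<forall>l. fourier N l = (\<Prod>j=1..n. mask_poly D p (\<rho> ^ j * l)))"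
proof (induction n)
  case 0
  have "real_distribution (return borel 0)"
    unfolding real_distribution_def real_distribution_axioms_def by (simp add: prob_space_return)
  moreover have "fourier (return borel 0) l = 1" for l
    unfolding fourier_def by (subst integral_return) auto
  ultimately show ?case by (intro exI[of _ "return borel 0"]) auto
next
  case (Suc n)
  then obtain N where N: "real_distribution N" "\<And>l. fourier N l = (\<Prod>j=1..n. mask_poly D p (\<rho> ^ j * l))"
    by blast
  let ?\<phi> = "\<lambda>d x. x + \<rho> ^ Suc n * d"
  have "fourier (mixture D p ?\<phi> N) l = (\<Prod>j=1..Suc n. mask_poly D p (\<rho> ^ j * l))" for l
  proof -
    have "fourier (mixture D p ?\<phi> N) l = (\<Sum>d\<in>D. of_real (p d) * (LINT x|N. exponential l (?\<phi> d x)))"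
      unfolding fourier_def by (intro integral_mixture fin_D pv N bounded_borel_intros) simp
    also have "\<dots> = (\<Sum>d\<in>D. of_real (p d) * exponential (\<rho> ^ Suc n * l) d * fourier N l)"
    proof (rule sum.cong[OF refl])
      fix d
      have "exponential l (?\<phi> d x) = exponential (\<rho> ^ Suc n * l) d * exponential l x" for x
        unfolding exponential_add exponential_scale by (simp only: mult.commute)
      then show "of_real (p d) * (LINT x|N. exponential l (?\<phi> d x)) =
          of_real (p d) * exponential (\<rho> ^ Suc n * l) d * fourier N l"
        by (simp add: fourier_def)
    qed
    finally show ?thesis by (simp add: mask_poly_def N flip: sum_distrib_right)
  qed
  moreover have "real_distribution (mixture D p ?\<phi> N)"
    by (intro real_distribution_mixture fin_D pv N) simp
  ultimately show ?case by blast
qed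

text \<open>Digits are nonnegative, so a point left of \<open>- s\<close> comes from a point left of
  \<open>- s / \<rho>\<close>. Iteration pushes the half-line to minus infinity.\<close>

lemma measure_negative: "measure \<mu> {..<0} = 0"
proof -
  have step: "measure \<mu> {..<- s} \<le> measure \<mu> {..<- s / \<rho>}" for s
  proof -
    have "measure \<mu> {..<- s} = (\<Sum>d\<in>D. p d * measure \<mu> ((\<lambda>x. \<rho> * (x + d)) -` {..<- s}))"
      by (rule measure_eq) simp
    also have "\<dots> \<le> (\<Sum>d\<in>D. p d * measure \<mu> {..<- s / \<rho>})"
    proof (intro sum_mono mult_left_mono finite_measure_mono subsetI)
      fix d x assume d: "d \<in> D" and "x \<in> (\<lambda>x. \<rho> * (x + d)) -` {..<- s}"
      then have "x + d < - s / \<rho>" using \<rho> by (simp add: field_simps)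
      moreover have "d \<ge> 0" using d D_nonneg by auto
      ultimately show "x \<in> {..<- s / \<rho>}" by simp
    qed (auto intro: less_imp_le p_pos)
    also have "\<dots> = measure \<mu> {..<- s / \<rho>}"
      using pv by (simp add: probability_vector_def flip: sum_distrib_right)
    finally show ?thesis .
  qed
  have iter: "measure \<mu> {..<- s} \<le> measure \<mu> {..<- s / \<rho> ^ n}" for s n
  proof (induction n)
    case (Suc n)
    then show ?case using step[of "s / \<rho> ^ n"] by (simp add: mult_ac)
  qed simp
  have tail: "measure \<mu> {..<- s} = 0" if s: "s > 0" for s
  proof -
    have "filterlim (\<lambda>n. - s / \<rho> ^ n) at_bot sequentially"
    proof -
      have "filterlim (\<lambda>n. s * (1 / \<rho>) ^ n) at_top sequentially"
        using s \<rho> by (intro filterlim_tendsto_pos_mult_at_top[OF tendsto_const] filterlim_realpow_at_top) auto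
      then have "filterlim (\<lambda>n. - (s * (1 / \<rho>) ^ n)) at_bot sequentially"
        by (simp add: filterlim_uminus_at_bot)
      then show ?thesis by (simp add: power_one_over field_simps)
    qed
    then have "(\<lambda>n. cdf \<mu> (- s / \<rho> ^ n)) \<longlonglongrightarrow> 0"
      by (rule filterlim_compose[OF cdf_lim_at_bot])
    moreover have "measure \<mu> {..<- s} \<le> cdf \<mu> (- s / \<rho> ^ n)" for n
      using iter[of s n] by (rule order_trans) (auto simp: cdf_def intro!: finite_measure_mono)
    ultimately have "measure \<mu> {..<- s} \<le> 0"
      by (intro LIMSEQ_le_const) auto
    then show ?thesis by (simp add: measure_le_0_iff)
  qed
  have "(\<lambda>n. measure \<mu> {..<- (1 / real (Suc n))}) \<longlonglongrightarrow> measure \<mu> (\<Union>n. {..<- (1 / real (Suc n))})"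
  proof (rule finite_Lim_measure_incseq)
    show "incseq (\<lambda>n. {..<- (1 / real (Suc n))})"
      by (auto simp: incseq_def divide_simps elim!: order_less_le_trans)
  qed auto
  moreover have "(\<Union>n. {..<- (1 / real (Suc n))}) = {..<0}"
  proof safe
    fix x :: real assume "x < 0"
    then obtain n where "inverse (real (Suc n)) < - x"
      using reals_Archimedean[of "- x"] by auto
    then show "x \<in> (\<Union>n. {..<- (1 / real (Suc n))})"
      by (intro UN_I[of n]) (auto simp: inverse_eq_divide)
  next
    fix x :: real and n assume "x < - (1 / real (Suc n))"
    moreover have "1 / real (Suc n) > 0" by simp
    ultimately show "x < 0" by linarith
  qed
  ultimately show ?thesis using tail by (simp add: LIMSEQ_const_iff del: of_nat_Suc)
qed

lemma AE_nonneg: "AE x in \<mu>. x \<ge> 0"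
  using measure_negative by (intro AE_I[of _ _ "{..<0}"]) (auto simp: emeasure_eq_measure)

text \<open>Keeping only the digit 0 in the invariance, n times over, costs the factor
  \<open>p 0 ^ n\<close> but enlarges the interval until it carries almost all mass.\<close>

lemma measure_initial_pos:
  assumes "s > 0"
  shows "measure \<mu> {0..<s} > 0"
proof -
  have step: "p 0 * measure \<mu> {..<s / \<rho>} \<le> measure \<mu> {..<s}" for s
  proof -
    have "(\<lambda>x. \<rho> * (x + 0)) -` {..<s} = {..<s / \<rho>}" using \<rho> by (auto simp: field_simps)
    moreover have "p 0 * measure \<mu> ((\<lambda>x. \<rho> * (x + 0)) -` {..<s}) \<le>
        (\<Sum>d\<in>D. p d * measure \<mu> ((\<lambda>x. \<rho> * (x + d)) -` {..<s}))"
      using zero_D fin_D p_pos by (intro member_le_sum) (auto intro!: mult_nonneg_nonneg less_imp_le[OF p_pos])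
    ultimately show ?thesis using measure_eq[of "{..<s}"] by simp
  qed
  have iter: "p 0 ^ n * measure \<mu> {..<s / \<rho> ^ n} \<le> measure \<mu> {..<s}" for n
  proof (induction n)
    case (Suc n)
    have "p 0 ^ Suc n * measure \<mu> {..<s / \<rho> ^ Suc n} \<le> p 0 ^ n * measure \<mu> {..<s / \<rho> ^ n}"
      using step[of "s / \<rho> ^ n"] p_pos[OF zero_D] by (simp add: mult_ac mult_left_mono)
    with Suc show ?case by linarith
  qed simp
  have "filterlim (\<lambda>n. s * (1 / \<rho>) ^ n) at_top sequentially"
    using assms \<rho> by (intro filterlim_tendsto_pos_mult_at_top[OF tendsto_const] filterlim_realpow_at_top) auto
  then have "filterlim (\<lambda>n. s / \<rho> ^ n) at_top sequentially"
    by (simp add: power_one_over field_simps)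
  \<comment> \<open>\<open>cdf\<close> measures closed half-lines; the shift by 1 keeps them inside
    the open half-line \<open>{..<s / \<rho> ^ n}\<close>.\<close>
  moreover have "((\<lambda>x. cdf \<mu> (x - 1)) \<longlongrightarrow> 1) at_top"
    by (rule filterlim_compose[OF cdf_lim_at_top_prob]) real_asymp
  ultimately have "(\<lambda>n. cdf \<mu> (s / \<rho> ^ n - 1)) \<longlonglongrightarrow> 1"
    by (rule filterlim_compose[rotated])
  then have "eventually (\<lambda>n. cdf \<mu> (s / \<rho> ^ n - 1) > 0) sequentially"
    by (intro order_tendstoD) auto
  then obtain n where "cdf \<mu> (s / \<rho> ^ n - 1) > 0"
    by (auto simp: eventually_sequentially)
  moreover have "cdf \<mu> (s / \<rho> ^ n - 1) \<le> measure \<mu> {..<s / \<rho> ^ n}"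
    unfolding cdf_def by (rule finite_measure_mono) auto
  ultimately have "0 < p 0 ^ n * measure \<mu> {..<s / \<rho> ^ n}"
    using p_pos[OF zero_D] by simp
  with iter[of n] have "0 < measure \<mu> {..<s}" by linarith
  also have "measure \<mu> {..<s} \<le> measure \<mu> ({..<0} \<union> {0..<s})"
    by (rule finite_measure_mono) auto
  also have "\<dots> \<le> measure \<mu> {..<0} + measure \<mu> {0..<s}"
    by (rule measure_Un_le) auto
  finally show ?thesis by (simp add: measure_negative)
qed

text \<open>Almost every point is nonnegative, so a nonzero digit moves it to
  \<open>\<delta>\<close> or beyond, where \<open>h\<close> vanishes. Hence the left end of \<mu>
  reappears at scale \<rho> without overlap, with weight \<open>p 0\<close>.\<close>

lemma integral_first_piece:
  assumes h: "bounded_borel h" and g: "bounded_borel g"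
    and \<delta>: "\<And>d. d \<in> D \<Longrightarrow> d \<noteq> 0 \<Longrightarrow> \<delta> \<le> d"
    and supp: "\<And>x. x \<ge> \<delta> \<Longrightarrow> h x = 0" "\<And>x. x < 0 \<Longrightarrow> h x = 0"
  shows "(LINT x|\<mu>. h (x / \<rho>) * g x) = of_real (p 0) * (LINT x|\<mu>. h x * g (\<rho> * x))"
proof -
  have "(LINT x|\<mu>. h (x / \<rho>) * g x) =
      (\<Sum>d\<in>D. of_real (p d) * (LINT x|\<mu>. h (\<rho> * (x + d) / \<rho>) * g (\<rho> * (x + d))))"
    using h g by (intro integral_eq bounded_borel_mult bounded_borel_comp[OF h]) simp_all
  also have "\<dots> = (\<Sum>d\<in>D. if d = 0 then of_real (p 0) * (LINT x|\<mu>. h x * g (\<rho> * x)) else 0)"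
  proof (rule sum.cong[OF refl])
    fix d assume d: "d \<in> D"
    show "of_real (p d) * (LINT x|\<mu>. h (\<rho> * (x + d) / \<rho>) * g (\<rho> * (x + d))) =
      (if d = 0 then of_real (p 0) * (LINT x|\<mu>. h x * g (\<rho> * x)) else 0)"
    proof (cases "d = 0")
      case False
      have "AE x in \<mu>. h (\<rho> * (x + d) / \<rho>) * g (\<rho> * (x + d)) = 0"
        using AE_nonneg by eventually_elim (use \<rho> \<delta>[OF d False] supp in auto)
      then have "(LINT x|\<mu>. h (\<rho> * (x + d) / \<rho>) * g (\<rho> * (x + d))) = 0"
        by (rule integral_eq_zero_AE)
      with False show ?thesis by simp
    qed (use \<rho> in simp)
  qed
  also have "\<dots> = of_real (p 0) * (LINT x|\<mu>. h x * g (\<rho> * x))"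
    using fin_D zero_D by simp
  finally show ?thesis .
qed

end

section \<open>Spectral self-similar measures\<close>

locale spectral_self_similar = self_similar +
  fixes \<Lambda> :: "real set"
  assumes parseval: "parseval \<mu> \<Lambda>"
    and orthogonal: "\<And>k l. k \<in> \<Lambda> \<Longrightarrow> l \<in> \<Lambda> \<Longrightarrow> k \<noteq> l \<Longrightarrow> fourier \<mu> (k - l) = 0"
begin

lemma parseval_has_sum:
  "bounded_borel f \<Longrightarrow> ((\<lambda>l. (cmod (LINT x|\<mu>. f x * cnj (exponential l x)))\<^sup>2) has_sum
       (LINT x|\<mu>. (cmod (f x))\<^sup>2)) \<Lambda>"
  using parseval unfolding parseval_def by blast

text \<open>The tool for comparing pieces of \<mu>: a translation changes Fourier coefficients only
  by phases, so translated pieces have coefficients of proportional modulus.\<close>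

lemma parseval_ratio:
  assumes f: "bounded_borel f" and g: "bounded_borel g"
    and ratio: "\<And>l. l \<in> \<Lambda> \<Longrightarrow> cmod (LINT x|\<mu>. f x * cnj (exponential l x)) =
      c * cmod (LINT x|\<mu>. g x * cnj (exponential l x))"
  shows "(LINT x|\<mu>. (cmod (f x))\<^sup>2) = c\<^sup>2 * (LINT x|\<mu>. (cmod (g x))\<^sup>2)"
proof (rule has_sum_unique[OF parseval_has_sum[OF f]])
  have "((\<lambda>l. c\<^sup>2 * (cmod (LINT x|\<mu>. g x * cnj (exponential l x)))\<^sup>2) has_sum
      c\<^sup>2 * (LINT x|\<mu>. (cmod (g x))\<^sup>2)) \<Lambda>"
    by (intro has_sum_cmult_right parseval_has_sum g)
  then show "((\<lambda>l. (cmod (LINT x|\<mu>. f x * cnj (exponential l x)))\<^sup>2) has_sum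
      c\<^sup>2 * (LINT x|\<mu>. (cmod (g x))\<^sup>2)) \<Lambda>"
    by (rule has_sum_cong[THEN iffD1, rotated]) (simp add: ratio power_mult_distrib)
qed

lemma fourier_has_sum: "((\<lambda>l. (cmod (fourier \<mu> (x - l)))\<^sup>2) has_sum 1) \<Lambda>"
  using parseval_has_sum[OF bounded_borel_exponential, of x] prob_space
  by (simp add: exponential_inner)

lemma integral_initial_pieces:
  assumes \<delta>: "0 < \<delta>" "\<And>d. d \<in> D \<Longrightarrow> d \<noteq> 0 \<Longrightarrow> \<delta> \<le> d" and g: "bounded_borel g"
  shows "(LINT x|\<mu>. indicator {0..<\<rho> ^ n * \<delta>} x * g x) =
    of_real (p 0 ^ n) * (LINT x|\<mu>. indicator {0..<\<delta>} x * g (\<rho> ^ n * x))"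
  using g
proof (induction n arbitrary: g)
  case (Suc n)
  have le: "\<rho> ^ n * \<delta> \<le> \<delta>"
    using \<rho> \<delta> by (intro mult_left_le_one_le) (auto intro: power_le_one)
  have "(LINT x|\<mu>. indicator {0..<\<rho> ^ Suc n * \<delta>} x * g x) =
      (LINT x|\<mu>. indicator {0..<\<rho> ^ n * \<delta>} (x / \<rho>) * g x)"
    using \<rho> by (intro Bochner_Integration.integral_cong) (auto simp: indicator_def field_simps)
  also have "\<dots> = of_real (p 0) * (LINT x|\<mu>. indicator {0..<\<rho> ^ n * \<delta>} x * g (\<rho> * x))"
    by (rule integral_first_piece[OF bounded_borel_indicator Suc.prems \<delta>(2)]) (use le in auto)
  also have "(LINT x|\<mu>. indicator {0..<\<rho> ^ n * \<delta>} x * g (\<rho> * x)) =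
      of_real (p 0 ^ n) * (LINT x|\<mu>. indicator {0..<\<delta>} x * g (\<rho> * (\<rho> ^ n * x)))"
    by (rule Suc.IH[OF bounded_borel_comp[OF Suc.prems]]) simp
  finally show ?case by (simp add: mult_ac)
qed simp

lemma ex_digit_gap: "\<exists>\<delta>>0. \<forall>d\<in>D. d \<noteq> 0 \<longrightarrow> \<delta> \<le> d"
proof (cases "D - {0} = {}")
  case False
  then have "Min (D - {0}) \<in> D - {0}"
    using fin_D by (intro Min_in) auto
  then have "0 < Min (D - {0})"
    using D_nonneg by (metis Diff_iff atLeast_iff insertCI order_le_less subsetD)
  moreover have "\<forall>d\<in>D. d \<noteq> 0 \<longrightarrow> Min (D - {0}) \<le> d"
    using fin_D by auto
  ultimately show ?thesis by blast
qed (auto intro!: exI[of _ 1])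

text \<open>
  The function \<open>1_[0, \<rho>^n \<delta>)\<close> has squared norm \<open>p 0 ^ n \<mu>[0, \<delta>)\<close>, while on each class its
  coefficients are \<open>p 0 ^ n\<close> times those of \<open>1_[0, \<delta>)\<close> for an orthonormal system.
\<close>
lemma card_classes:
  fixes col :: "real \<Rightarrow> 'c"
  assumes C: "finite C" "col ` \<Lambda> \<subseteq> C"
    and same: "\<And>k l. k \<in> \<Lambda> \<Longrightarrow> l \<in> \<Lambda> \<Longrightarrow> k \<noteq> l \<Longrightarrow> col k = col l \<Longrightarrow>
      fourier \<mu> (\<rho> ^ n * (k - l)) = 0"
  shows "1 \<le> p 0 ^ n * card C"
proof -
  obtain \<delta> where \<delta>: "\<delta> > 0" "\<And>d. d \<in> D \<Longrightarrow> d \<noteq> 0 \<Longrightarrow> \<delta> \<le> d"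
    using ex_digit_gap by blast
  define m where "m = measure \<mu> {0..<\<delta>}"
  have m: "m > 0" unfolding m_def using \<delta>(1) by (rule measure_initial_pos)
  define F where "F k = (LINT x|\<mu>. indicator {0..<\<delta>} x * cnj (exponential k x))" for k
  have norm_ind: "(LINT x|\<mu>. (cmod (indicator A x))\<^sup>2) = measure \<mu> A" if "A \<in> sets borel" for A
  proof -
    have "(LINT x|\<mu>. (cmod (indicator A x))\<^sup>2) = (LINT x|\<mu>. indicator A x)"
      by (intro Bochner_Integration.integral_cong) (auto simp: indicator_def)
    then show ?thesis using that by simp
  qed
  have "complex_of_real (measure \<mu> {0..<\<rho> ^ n * \<delta>}) = of_real (p 0 ^ n * m)"
    using integral_initial_pieces[OF \<delta> bounded_borel_const[of 1], of n]
    by (simp add: integral_indicator_complex m_def)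
  then have mn: "measure \<mu> {0..<\<rho> ^ n * \<delta>} = p 0 ^ n * m"
    by (simp only: of_real_eq_iff)
  have coeff: "(LINT x|\<mu>. indicator {0..<\<rho> ^ n * \<delta>} x * cnj (exponential l x)) =
      of_real (p 0 ^ n) * F (\<rho> ^ n * l)" for l
    unfolding F_def by (subst integral_initial_pieces[OF \<delta>]) (auto intro: bounded_borel_intros simp: exponential_scale)
  have "((\<lambda>l. (cmod (of_real (p 0 ^ n) * F (\<rho> ^ n * l)))\<^sup>2) has_sum p 0 ^ n * m) \<Lambda>"
    using parseval_has_sum[OF bounded_borel_indicator', of "{0..<\<rho> ^ n * \<delta>}"]
    by (simp add: coeff norm_ind mn)
  moreover have "(\<Sum>l\<in>S. (cmod (of_real (p 0 ^ n) * F (\<rho> ^ n * l)))\<^sup>2) \<le> (p 0 ^ n)\<^sup>2 * (card C * m)"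
    if S: "finite S" "S \<subseteq> \<Lambda>" for S
  proof -
    have "(\<Sum>l\<in>S. (cmod (of_real (p 0 ^ n) * F (\<rho> ^ n * l)))\<^sup>2) =
        (p 0 ^ n)\<^sup>2 * (\<Sum>l\<in>S. (cmod (F (\<rho> ^ n * l)))\<^sup>2)"
      using p_pos[OF zero_D] by (simp add: norm_mult power_mult_distrib sum_distrib_left norm_power)
    also have "(\<Sum>l\<in>S. (cmod (F (\<rho> ^ n * l)))\<^sup>2) =
        (\<Sum>c\<in>C. \<Sum>l\<in>{l \<in> S. col l = c}. (cmod (F (\<rho> ^ n * l)))\<^sup>2)"
      using S C by (intro sum.group[symmetric]) auto
    also have "\<dots> \<le> (\<Sum>c\<in>C. m)"
    proof (rule sum_mono)
      fix c
      let ?S = "{l \<in> S. col l = c}"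
      have "(\<Sum>l\<in>?S. (cmod (F (\<rho> ^ n * l)))\<^sup>2) = (\<Sum>l\<in>(*) (\<rho> ^ n) ` ?S. (cmod (F l))\<^sup>2)"
        using \<rho> by (subst sum.reindex) (auto simp: inj_on_def)
      also have "\<dots> \<le> (LINT x|\<mu>. (cmod (indicator {0..<\<delta>} x))\<^sup>2)"
        unfolding F_def
      proof (intro Bessel_exponential bounded_borel_intros)
        fix k l assume "k \<in> (*) (\<rho> ^ n) ` ?S" "l \<in> (*) (\<rho> ^ n) ` ?S" "k \<noteq> l"
        then obtain k' l' where "k = \<rho> ^ n * k'" "l = \<rho> ^ n * l'" "k' \<noteq> l'"
          "k' \<in> S" "l' \<in> S" "col k' = col l'" by auto
        with same[of k' l'] S show "fourier \<mu> (k - l) = 0"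
          by (auto simp: right_diff_distrib)
      qed (use S in auto)
      finally show "(\<Sum>l\<in>?S. (cmod (F (\<rho> ^ n * l)))\<^sup>2) \<le> m"
        by (simp add: norm_ind m_def)
    qed
    finally show ?thesis by (simp add: mult_left_mono)
  qed
  ultimately have "p 0 ^ n * m \<le> (p 0 ^ n)\<^sup>2 * (card C * m)"
    by (rule has_sum_le_finite_sums)
  also have "\<dots> = (p 0 ^ n * m) * (p 0 ^ n * card C)" by (simp add: power2_eq_square mult_ac)
  finally show ?thesis
    using m p_pos[OF zero_D] by (simp add: mult_le_cancel_left1)
qed

end

subsection \<open>Equal weights\<close>

text \<open>Domination makes the density at most 1 almost everywhere; a version bounded at every
  point is taken so that it can multiply test functions.\<close>

lemma (in real_distribution) Radon_Nikodym_le: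
  assumes N: "finite_measure N" "sets N = sets borel"
    and le: "\<And>A. A \<in> sets borel \<Longrightarrow> emeasure N A \<le> emeasure M A"
  obtains g where "g \<in> borel_measurable borel" "\<And>x. 0 \<le> g x" "\<And>x. g x \<le> 1"
    "\<And>f. bounded_borel f \<Longrightarrow> (LINT x|N. f x) = (LINT x|M. f x * of_real (g x))"
proof -
  have "absolutely_continuous M N"
    unfolding absolutely_continuous_def
  proof
    fix A assume "A \<in> null_sets M"
    then have "A \<in> sets borel" "emeasure M A = 0" by auto
    with le[of A] N(2) show "A \<in> null_sets N" by (auto simp: null_sets_def)
  qed
  then obtain h where h: "h \<in> borel_measurable M" "density M h = N"
    using Radon_Nikodym_finite_measure[OF N(1)] N(2) by auto
  note [measurable] = h(1)
  \<comment> \<open>On the set where the density exceeds 1, the integral of the excess is the mass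
    under N minus the mass under M, and subtraction in \<open>ennreal\<close> truncates at
    0.\<close>
  define A where "A = {x. 1 < h x}"
  have A [measurable]: "A \<in> sets M"
  proof -
    have "{x \<in> space M. 1 < h x} \<in> sets M" by measurable
    then show ?thesis by (simp add: A_def)
  qed
  have "(\<integral>\<^sup>+x. h x * indicator A x - indicator A x \<partial>M) =
      (\<integral>\<^sup>+x. h x * indicator A x \<partial>M) - (\<integral>\<^sup>+x. indicator A x \<partial>M)"
  proof (rule nn_integral_diff)
    show "(\<integral>\<^sup>+x. indicator A x \<partial>M) \<noteq> \<infinity>"
      using A by (simp add: emeasure_eq_measure)
    show "AE x in M. indicator A x \<le> h x * indicator A x"
      by (auto simp: A_def indicator_def intro: less_imp_le)
  qed auto
  also have "(\<integral>\<^sup>+x. h x * indicator A x \<partial>M) = emeasure N A"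
    using emeasure_density[OF h(1) A] by (simp only: h(2))
  also have "emeasure N A - (\<integral>\<^sup>+x. indicator A x \<partial>M) = 0"
    using le[of A] A by (auto simp: diff_eq_0_iff_ennreal emeasure_eq_measure intro: order_le_less_trans)
  finally have "AE x in M. h x * indicator A x - indicator A x = 0"
    by (subst (asm) nn_integral_0_iff_AE) auto
  then have h_le: "AE x in M. h x \<le> 1"
  proof eventually_elim
    case (elim x)
    show ?case
    proof (rule ccontr)
      assume "\<not> h x \<le> 1"
      then have "x \<in> A" "\<not> h x \<le> 1" by (auto simp: A_def)
      with elim show False by (simp add: diff_eq_0_iff_ennreal)
    qed
  qed
  define g where "g x = enn2real (min 1 (h x))" for x
  have g: "g \<in> borel_measurable borel"
    unfolding g_def using h(1) by (simp add: measurable_cong_sets[OF events_eq_borel refl])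
  have g01: "0 \<le> g x" "g x \<le> 1" for x
    unfolding g_def using enn2real_mono[of "min 1 (h x)" 1] by auto
  have "density M (\<lambda>x. ennreal (g x)) = density M h"
  proof (rule density_cong)
    show "AE x in M. ennreal (g x) = h x"
      using h_le by eventually_elim (auto simp: g_def min_def ennreal_enn2real_if top_unique)
  qed (use g in auto)
  then have N_eq: "N = density M (\<lambda>x. ennreal (g x))" using h(2) by simp
  have "(LINT x|N. f x) = (LINT x|M. f x * of_real (g x))" if "bounded_borel f" for f
    unfolding N_eq using that g g01 measurable_bounded_borel[OF that]
    by (subst integral_density) (auto simp: scaleR_conv_of_real mult.commute)
  with g g01 show ?thesis by (rule that)
qed

context spectral_self_similar
begin

text \<open>The piece of \<mu> that comes from \<open>E\<close> under the map with digit
  \<open>d\<close> is part of one summand of the invariance equation, hence dominated by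
  \<mu>.\<close>

lemma piece_density:
  assumes d: "d \<in> D" and E: "E \<in> sets borel"
  obtains g where "g \<in> borel_measurable borel" "\<And>x. 0 \<le> g x" "\<And>x. g x \<le> 1"
    "\<And>f. bounded_borel f \<Longrightarrow> (LINT x|\<mu>. f x * of_real (g x)) =
      of_real (p d) * (LINT x|\<mu>. indicator E x * f (\<rho> * (x + d)))"
proof -
  define N where "N = distr (density \<mu> (\<lambda>x. ennreal (p d * indicator E x))) borel (\<lambda>x. \<rho> * (x + d))"
  have pd: "0 < p d" by (rule p_pos[OF d])
  have int: "(LINT x|N. f x) = of_real (p d) * (LINT x|\<mu>. indicator E x * f (\<rho> * (x + d)))"
    if f: "bounded_borel f" for f
  proof -
    have "(LINT x|N. f x) = (LINT x|density \<mu> (\<lambda>x. ennreal (p d * indicator E x)). f (\<rho> * (x + d)))"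
      unfolding N_def using f by (intro integral_distr) (auto intro: bounded_borel_measurable)
    also have "\<dots> = (LINT x|\<mu>. (p d * indicator E x) *\<^sub>R f (\<rho> * (x + d)))"
    proof (rule integral_density)
      show "(\<lambda>x. f (\<rho> * (x + d))) \<in> borel_measurable \<mu>"
        by (intro measurable_bounded_borel bounded_borel_comp[OF f]) simp
    qed (use pd E in auto)
    also have "\<dots> = (LINT x|\<mu>. of_real (p d) * (indicator E x * f (\<rho> * (x + d))))"
      by (rule Bochner_Integration.integral_cong) (auto simp: scaleR_conv_of_real indicator_def)
    finally show ?thesis by simp
  qed
  have le: "emeasure N A \<le> emeasure \<mu> A" if A: "A \<in> sets borel" for A
  proof -
    let ?B = "(\<lambda>x. \<rho> * (x + d)) -` A"
    have B: "?B \<in> sets borel"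
      using measurable_sets[of "\<lambda>x. \<rho> * (x + d)" borel borel A] A by simp
    have "emeasure N A = emeasure (density \<mu> (\<lambda>x. ennreal (p d * indicator E x))) ?B"
      unfolding N_def using A by (subst emeasure_distr) (auto)
    also have "\<dots> = (\<integral>\<^sup>+x. ennreal (p d * indicator E x) * indicator ?B x \<partial>\<mu>)"
      using B E by (intro emeasure_density) auto
    also have "\<dots> \<le> (\<integral>\<^sup>+x. ennreal (p d) * indicator ?B x \<partial>\<mu>)"
      by (intro nn_integral_mono) (auto simp: indicator_def)
    also have "\<dots> = ennreal (p d * measure \<mu> ?B)"
      using B pd by (subst nn_integral_cmult_indicator) (auto simp: emeasure_eq_measure ennreal_mult)
    also have "p d * measure \<mu> ?B \<le> (\<Sum>e\<in>D. p e * measure \<mu> ((\<lambda>x. \<rho> * (x + e)) -` A))"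
      using d fin_D by (intro member_le_sum) (auto intro!: mult_nonneg_nonneg less_imp_le[OF p_pos])
    also have "\<dots> = measure \<mu> A" by (rule measure_eq[OF A, symmetric])
    finally show ?thesis by (simp add: emeasure_eq_measure ennreal_leI)
  qed
  have "finite_measure N"
    using le[of UNIV] by (intro finite_measureI) (auto simp: N_def emeasure_eq_measure top_unique)
  then obtain g where g: "g \<in> borel_measurable borel" "\<And>x. 0 \<le> g x" "\<And>x. g x \<le> 1"
    "\<And>f. bounded_borel f \<Longrightarrow> (LINT x|N. f x) = (LINT x|\<mu>. f x * of_real (g x))"
    using Radon_Nikodym_le[of N] le by (auto simp: N_def)
  show ?thesis
    using g(4) int by (intro that[OF g(1-3)]) simp
qed

text \<open>Let g be the density of the translate of the left end to the digit d. Its coefficients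
  have \<open>c = p d / p 0\<close> times the modulus of those of the left end, so Parseval's
  identity forces g to be 0 or c almost everywhere on the translate; as g is at most 1, so is c. If
  d is the second digit, only the digits 0 and d contribute where g = c, and the part of digit 0 is
  again proportional to a translate, with factor 1 - c. Its squared norm is both 1 - c and (1 - c)^2
  times the same mass.\<close>

lemma weight_le_and_second_eq:
  assumes d: "d \<in> D" "d \<noteq> 0"
  shows "p d \<le> p 0"
    and "(\<And>e. e \<in> D \<Longrightarrow> e \<noteq> 0 \<Longrightarrow> d \<le> e) \<Longrightarrow> p d = p 0"
proof -
  define R where "R = (\<lambda>x. \<rho> * (x + d))"
  have [measurable]: "R \<in> borel_measurable borel" unfolding R_def by simp
  \<comment> \<open>\<open>\<delta>\<close> is at most every nonzero digit, as
    \<open>integral_first_piece\<close> demands, and at most every gap from d to a larger digit,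
    which keeps the later pieces off Q.\<close>
  define X where "X = insert d (D - {0} \<union> (\<lambda>e. e - d) ` {e \<in> D. d < e})"
  define \<delta> where "\<delta> = Min X"
  have X: "finite X" "X \<noteq> {}" "\<And>x. x \<in> X \<Longrightarrow> 0 < x"
    using fin_D D_nonneg d unfolding X_def by auto
  have \<delta>: "\<delta> > 0" "\<And>e. e \<in> D \<Longrightarrow> e \<noteq> 0 \<Longrightarrow> \<delta> \<le> e" "\<And>e. e \<in> D \<Longrightarrow> d < e \<Longrightarrow> \<delta> \<le> e - d"
    unfolding \<delta>_def using X by (auto intro!: Min_le simp: X_def)
  define E where "E = {0..<\<delta>}"
  have E [measurable]: "E \<in> sets borel" by (simp add: E_def)
  have mE: "measure \<mu> E > 0" unfolding E_def by (rule measure_initial_pos[OF \<delta>(1)])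
  define c where "c = p d / p 0"
  have p0: "p 0 > 0" and pd: "p d > 0" using p_pos zero_D d by auto
  then have c: "c > 0" by (simp add: c_def)
  obtain g where g: "g \<in> borel_measurable borel" "\<And>x. 0 \<le> g x" "\<And>x. g x \<le> 1"
    and g_int: "\<And>f. bounded_borel f \<Longrightarrow> (LINT x|\<mu>. f x * of_real (g x)) =
      of_real (p d) * (LINT x|\<mu>. indicator E x * f (R x))"
    using piece_density[OF d(1) E] unfolding R_def by blast
  note [measurable] = g(1)
  define Q where "Q = {y. y / \<rho> - d \<in> E}"
  have Q [measurable]: "Q \<in> sets borel"
  proof -
    have "Q = (\<lambda>y. y / \<rho> - d) -` E \<inter> space borel" by (auto simp: Q_def)
    also have "\<dots> \<in> sets borel" by (rule measurable_sets[OF _ E]) simp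
    finally show ?thesis .
  qed
  have R_Q: "R x \<in> Q \<longleftrightarrow> x \<in> E" for x
    using \<rho> by (simp add: Q_def R_def)
  have vim: "R -` A \<in> sets borel" if "A \<in> sets borel" for A
    using measurable_sets[of R borel borel A] that by simp
  have [simp]: "A \<in> sets \<mu> \<longleftrightarrow> A \<in> sets borel" for A by simp
  have real_g: "(LINT x|\<mu>. indicator A x * g x) = p d * measure \<mu> (E \<inter> R -` A)"
    if A [measurable]: "A \<in> sets borel" for A
  proof -
    have "complex_of_real (LINT x|\<mu>. indicator A x * g x) = (LINT x|\<mu>. of_real (indicator A x * g x))"
      by (rule integral_complex_of_real[symmetric])
    also have "\<dots> = (LINT x|\<mu>. indicator A x * of_real (g x))"
      by (rule Bochner_Integration.integral_cong) (auto simp: indicator_def)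
    also have "\<dots> = of_real (p d) * (LINT x|\<mu>. indicator E x * indicator A (R x))"
      by (intro g_int bounded_borel_intros A)
    also have "(LINT x|\<mu>. indicator E x * indicator A (R x) :: complex) =
        (LINT x|\<mu>. indicator (E \<inter> R -` A) x)"
      by (rule Bochner_Integration.integral_cong) (auto simp: indicator_def)
    also have "\<dots> = of_real (measure \<mu> (E \<inter> R -` A))"
      using vim[OF A] E by (intro integral_indicator_complex) auto
    finally show ?thesis by (simp only: of_real_eq_iff flip: of_real_mult)
  qed
  \<comment> \<open>Since A is an arbitrary Borel set, this will say that \<open>g * (g - c)\<close>
    vanishes almost everywhere on Q.\<close>
  have square: "(LINT x|\<mu>. indicator (A \<inter> Q) x * (g x)\<^sup>2) = c * (LINT x|\<mu>. indicator (A \<inter> Q) x * g x)"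
    if A [measurable]: "A \<in> sets borel" for A
  proof -
    define B where "B = E \<inter> R -` A"
    have B [measurable]: "B \<in> sets borel" using vim[OF A] E by (auto simp: B_def)
    let ?f = "\<lambda>x. indicator (A \<inter> Q) x * complex_of_real (g x)"
    let ?h = "\<lambda>x. indicator B (x / \<rho>) :: complex"
    have f: "bounded_borel ?f" by (intro bounded_borel_intros bounded_borel_of_real g) simp
    have h: "bounded_borel ?h" by (rule bounded_borel_comp[OF bounded_borel_indicator[OF B]]) simp
    have first: "(LINT x|\<mu>. ?h x * k x) = of_real (p 0) * (LINT x|\<mu>. indicator B x * k (\<rho> * x))"
      if k: "bounded_borel k" for k
    proof (rule integral_first_piece[OF bounded_borel_indicator[OF B] k \<delta>(2)])
      show "indicator B x = (0 :: complex)" if "x \<ge> \<delta>" for x using that by (simp add: B_def E_def)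
      show "indicator B x = (0 :: complex)" if "x < 0" for x using that by (simp add: B_def E_def)
    qed
    have "(LINT x|\<mu>. (cmod (?f x))\<^sup>2) = c\<^sup>2 * (LINT x|\<mu>. (cmod (?h x))\<^sup>2)"
    proof (rule parseval_ratio[OF f h])
      fix l
      have "(LINT x|\<mu>. ?f x * cnj (exponential l x)) =
          (LINT x|\<mu>. (indicator (A \<inter> Q) x * cnj (exponential l x)) * of_real (g x))"
        by (simp add: mult_ac)
      also have "\<dots> = of_real (p d) *
          (LINT x|\<mu>. indicator E x * (indicator (A \<inter> Q) (R x) * cnj (exponential l (R x))))"
        by (intro g_int bounded_borel_intros) simp
      also have "(LINT x|\<mu>. indicator E x * (indicator (A \<inter> Q) (R x) * cnj (exponential l (R x)))) =
          (LINT x|\<mu>. cnj (exponential (\<rho> * l) d) * (indicator B x * cnj (exponential l (\<rho> * x))))"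
      proof (rule Bochner_Integration.integral_cong[OF refl])
        fix x
        have "exponential l (R x) = exponential (\<rho> * l) d * exponential l (\<rho> * x)"
          by (simp add: R_def exponential_scale exponential_add)
        then show "indicator E x * (indicator (A \<inter> Q) (R x) * cnj (exponential l (R x))) =
            cnj (exponential (\<rho> * l) d) * (indicator B x * cnj (exponential l (\<rho> * x)))"
          using R_Q[of x] by (auto simp: B_def indicator_def)
      qed
      also have "\<dots> = cnj (exponential (\<rho> * l) d) * (LINT x|\<mu>. indicator B x * cnj (exponential l (\<rho> * x)))"
        by simp
      finally have "cmod (LINT x|\<mu>. ?f x * cnj (exponential l x)) =
          p d * cmod (LINT x|\<mu>. indicator B x * cnj (exponential l (\<rho> * x)))"
        using pd by (simp add: norm_mult)
      moreover have "cmod (LINT x|\<mu>. ?h x * cnj (exponential l x)) =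
          p 0 * cmod (LINT x|\<mu>. indicator B x * cnj (exponential l (\<rho> * x)))"
        using p0 by (subst first) (auto simp: norm_mult intro: bounded_borel_intros)
      ultimately show "cmod (LINT x|\<mu>. ?f x * cnj (exponential l x)) =
          c * cmod (LINT x|\<mu>. ?h x * cnj (exponential l x))"
        using p0 by (simp add: c_def)
    qed
    moreover have "(LINT x|\<mu>. (cmod (?f x))\<^sup>2) = (LINT x|\<mu>. indicator (A \<inter> Q) x * (g x)\<^sup>2)"
      by (rule Bochner_Integration.integral_cong) (auto simp: indicator_def)
    moreover have "(LINT x|\<mu>. (cmod (?h x))\<^sup>2) = p 0 * measure \<mu> B"
    proof -
      have "complex_of_real (LINT x|\<mu>. (cmod (?h x))\<^sup>2) = (LINT x|\<mu>. of_real ((cmod (?h x))\<^sup>2))"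
        by (rule integral_complex_of_real[symmetric])
      also have "\<dots> = (LINT x|\<mu>. ?h x * 1)"
        by (rule Bochner_Integration.integral_cong) (auto simp: indicator_def)
      also have "\<dots> = of_real (p 0) * (LINT x|\<mu>. indicator B x * 1)"
        by (intro first bounded_borel_intros)
      also have "\<dots> = of_real (p 0 * measure \<mu> B)"
        by (simp add: integral_indicator_complex)
      finally show ?thesis by (simp only: of_real_eq_iff)
    qed
    moreover have "E \<inter> R -` (A \<inter> Q) = B" using R_Q by (auto simp: B_def)
    ultimately show ?thesis
      using p0 real_g[of "A \<inter> Q"] by (simp add: c_def power2_eq_square)
  qed
  have full: "E \<inter> R -` Q = E" using R_Q by auto
  have int_g: "(LINT x|\<mu>. indicator Q x * g x) = p d * measure \<mu> E"
    using real_g[OF Q] full by simp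
  have ibl: "integrable \<mu> (\<lambda>x. indicator A x * k x)"
    if "k \<in> borel_measurable borel" "\<And>x. \<bar>k x\<bar> \<le> K" "A \<in> sets borel" for A K and k :: "real \<Rightarrow> real"
  proof (rule integrable_const_bound[where B = "\<bar>K\<bar>"])
    show "AE x in \<mu>. norm (indicator A x * k x) \<le> \<bar>K\<bar>"
      using order_trans[OF that(2) abs_ge_self] by (intro AE_I2) (auto simp: indicator_def)
  qed (use that in measurable)
  have g_abs: "\<bar>g x\<bar> \<le> 1" "\<bar>(g x)\<^sup>2\<bar> \<le> 1" for x
    using g(2,3)[of x] by (auto simp: power_le_one)
  have sq_le: "(LINT x|\<mu>. indicator Q x * (g x)\<^sup>2) \<le> (LINT x|\<mu>. indicator Q x * g x)"
    using g by (intro integral_mono ibl[of _ 1] g_abs)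
      (auto simp: indicator_def power2_eq_square intro!: mult_left_le)
  have "c * (p d * measure \<mu> E) \<le> p d * measure \<mu> E"
    using square[of UNIV] sq_le int_g by simp
  then have c_le: "c \<le> 1" using mE pd by simp
  then show "p d \<le> p 0" using p0 by (simp add: c_def)

  assume second: "\<And>e. e \<in> D \<Longrightarrow> e \<noteq> 0 \<Longrightarrow> d \<le> e"
  define k where "k x = g x * (g x - c)" for x
  have [measurable]: "k \<in> borel_measurable borel" unfolding k_def by measurable
  have k_abs: "\<bar>k x\<bar> \<le> 1 + c" for x
  proof -
    have "\<bar>k x\<bar> = g x * \<bar>g x - c\<bar>" using g(2)[of x] by (simp add: k_def abs_mult)
    also have "\<dots> \<le> 1 * (1 + c)"
      using g(2,3)[of x] c by (intro mult_mono) auto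
    finally show ?thesis by simp
  qed
  have k0: "(LINT x|\<mu>. indicator (A \<inter> Q) x * k x) = 0" if A: "A \<in> sets borel" for A
  proof -
    have AQ: "A \<inter> Q \<in> sets borel" using A Q by auto
    have "(LINT x|\<mu>. indicator (A \<inter> Q) x * k x) =
        (LINT x|\<mu>. indicator (A \<inter> Q) x * (g x)\<^sup>2 - c * (indicator (A \<inter> Q) x * g x))"
      by (rule Bochner_Integration.integral_cong) (auto simp: k_def power2_eq_square algebra_simps)
    also have "\<dots> = (LINT x|\<mu>. indicator (A \<inter> Q) x * (g x)\<^sup>2) - (LINT x|\<mu>. c * (indicator (A \<inter> Q) x * g x))"
      by (intro Bochner_Integration.integral_diff integrable_mult_right ibl[of _ 1] g_abs AQ) measurable
    also have "\<dots> = 0" using square[OF A] by simp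
    finally show ?thesis .
  qed
  have AE_k: "AE x in \<mu>. x \<in> Q \<longrightarrow> k x = 0"
  proof -
    have sets: "{x. 0 < k x} \<in> sets borel" "{x. k x < 0} \<in> sets borel"
      by measurable
    have int_k: "integrable \<mu> (\<lambda>x. indicator (A \<inter> Q) x * k x)" if "A \<in> sets borel" for A
      using that Q by (intro ibl[OF _ k_abs]) auto
    have pos: "AE x in \<mu>. indicator ({x. 0 < k x} \<inter> Q) x * k x = 0"
      using k0[OF sets(1)]
      by (subst integral_nonneg_eq_0_iff_AE[OF int_k[OF sets(1)], symmetric]) (auto simp: indicator_def)
    have neg: "AE x in \<mu>. - (indicator ({x. k x < 0} \<inter> Q) x * k x) = 0"
      using k0[OF sets(2)]
      by (subst integral_nonneg_eq_0_iff_AE[OF Bochner_Integration.integrable_minus[OF int_k[OF sets(2)]], symmetric])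
        (auto simp: indicator_def)
    from pos neg show ?thesis
      by eventually_elim (auto simp: indicator_def split: if_splits)
  qed
  define G where "G = {y \<in> Q. g y = c}"
  have G [measurable]: "G \<in> sets borel"
  proof -
    have "{y \<in> space borel. y \<in> Q \<and> g y = c} \<in> sets borel" by measurable
    then show ?thesis by (simp add: G_def)
  qed
  define B where "B = E \<inter> R -` G"
  have B [measurable]: "B \<in> sets borel" using vim[OF G] E by (auto simp: B_def)
  have R_G: "R x \<in> G \<longleftrightarrow> x \<in> B" for x using R_Q by (auto simp: B_def G_def)
  have mB: "measure \<mu> B = measure \<mu> E"
  proof -
    have "(LINT x|\<mu>. indicator G x * g x) = (LINT x|\<mu>. indicator Q x * g x)"
    proof (rule integral_cong_AE)
      show "AE x in \<mu>. indicator G x * g x = indicator Q x * g x"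
        using AE_k by eventually_elim (auto simp: G_def k_def indicator_def)
    qed measurable
    then have "p d * measure \<mu> B = p d * measure \<mu> E"
      using real_g[OF G] int_g by (simp add: B_def)
    then show ?thesis using pd by simp
  qed
  \<comment> \<open>On G the density is the constant c; dividing by it expresses \<mu> on G through
    the piece of digit d alone.\<close>
  have G1: "(LINT x|\<mu>. indicator G x * h x) = of_real (p 0) * (LINT x|\<mu>. indicator B x * h (R x))"
    if h: "bounded_borel h" for h
  proof -
    have "of_real c * (LINT x|\<mu>. indicator G x * h x) = (LINT x|\<mu>. of_real c * (indicator G x * h x))"
      by simp
    also have "\<dots> = (LINT x|\<mu>. (indicator G x * h x) * of_real (g x))"
      by (rule Bochner_Integration.integral_cong) (auto simp: indicator_def G_def)
    also have "\<dots> = of_real (p d) * (LINT x|\<mu>. indicator E x * (indicator G (R x) * h (R x)))"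
      by (intro g_int bounded_borel_intros h G)
    also have "(LINT x|\<mu>. indicator E x * (indicator G (R x) * h (R x))) = (LINT x|\<mu>. indicator B x * h (R x))"
      by (rule Bochner_Integration.integral_cong) (auto simp: indicator_def B_def)
    finally have "of_real (p d) * (LINT x|\<mu>. indicator G x * h x) =
        of_real (p d) * (of_real (p 0) * (LINT x|\<mu>. indicator B x * h (R x)))"
      using p0 by (simp add: c_def field_simps)
    then show ?thesis using pd by simp
  qed
  \<comment> \<open>The invariance equation on G; pieces of digits above d begin to the right of
    Q.\<close>
  have G2: "(LINT x|\<mu>. indicator G x * h x) = of_real (p 0) * (LINT x|\<mu>. indicator G (\<rho> * x) * h (\<rho> * x))
      + of_real (p d) * (LINT x|\<mu>. indicator B x * h (R x))" if h: "bounded_borel h" for h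
  proof -
    have "(LINT x|\<mu>. indicator G x * h x) =
        (\<Sum>e\<in>D. of_real (p e) * (LINT x|\<mu>. indicator G (\<rho> * (x + e)) * h (\<rho> * (x + e))))"
      by (intro integral_eq bounded_borel_intros h G)
    also have "\<dots> = (\<Sum>e\<in>{0, d}. of_real (p e) * (LINT x|\<mu>. indicator G (\<rho> * (x + e)) * h (\<rho> * (x + e))))"
    proof (rule sum.mono_neutral_right[OF fin_D])
      show "\<forall>e\<in>D - {0, d}. of_real (p e) * (LINT x|\<mu>. indicator G (\<rho> * (x + e)) * h (\<rho> * (x + e))) = 0"
      proof
        fix e assume e: "e \<in> D - {0, d}"
        then have "d < e" using second[of e] by auto
        have "AE x in \<mu>. indicator G (\<rho> * (x + e)) * h (\<rho> * (x + e)) = 0"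
          using AE_nonneg
        proof eventually_elim
          case (elim x)
          have "\<rho> * (x + e) \<notin> Q"
            using \<rho> \<delta>(3)[of e] \<open>d < e\<close> e elim by (auto simp: Q_def E_def)
          then show ?case by (auto simp: G_def indicator_def)
        qed
        then show "of_real (p e) * (LINT x|\<mu>. indicator G (\<rho> * (x + e)) * h (\<rho> * (x + e))) = 0"
          by (simp add: integral_eq_zero_AE)
      qed
    qed (use d zero_D in auto)
    also have "\<dots> = of_real (p 0) * (LINT x|\<mu>. indicator G (\<rho> * x) * h (\<rho> * x))
        + of_real (p d) * (LINT x|\<mu>. indicator G (R x) * h (R x))"
      using d by (simp add: R_def)
    also have "(LINT x|\<mu>. indicator G (R x) * h (R x)) = (LINT x|\<mu>. indicator B x * h (R x))"
      using R_G by (simp add: indicator_def)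
    finally show ?thesis .
  qed
  \<comment> \<open>Equating the two expressions for \<mu> on G leaves the contribution of the digit
    0 as \<kappa> times a translate of \<mu> on B.\<close>
  define \<kappa> where "\<kappa> = 1 - c"
  have \<kappa>: "0 \<le> \<kappa>" "\<kappa> < 1" using c c_le by (auto simp: \<kappa>_def)
  have G3: "(LINT x|\<mu>. indicator G (\<rho> * x) * h (\<rho> * x)) = of_real \<kappa> * (LINT x|\<mu>. indicator B x * h (R x))"
    if h: "bounded_borel h" for h
  proof -
    have "of_real (p 0) * (LINT x|\<mu>. indicator G (\<rho> * x) * h (\<rho> * x)) =
        of_real (p 0 - p d) * (LINT x|\<mu>. indicator B x * h (R x))"
      using G1[OF h] G2[OF h] by (simp add: algebra_simps)
    then show ?thesis using p0 by (simp add: \<kappa>_def c_def field_simps)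
  qed
  define f where "f x = (indicator G (\<rho> * x) :: complex)" for x
  have f: "bounded_borel f" unfolding f_def by (rule bounded_borel_comp[OF bounded_borel_indicator[OF G]]) simp
  have f_sq: "(LINT x|\<mu>. (cmod (f x))\<^sup>2) = \<kappa> * measure \<mu> B"
  proof -
    have "complex_of_real (LINT x|\<mu>. (cmod (f x))\<^sup>2) = (LINT x|\<mu>. of_real ((cmod (f x))\<^sup>2))"
      by (rule integral_complex_of_real[symmetric])
    also have "\<dots> = (LINT x|\<mu>. indicator G (\<rho> * x) * 1)"
      by (rule Bochner_Integration.integral_cong) (auto simp: indicator_def f_def)
    also have "\<dots> = of_real \<kappa> * (LINT x|\<mu>. indicator B x * 1)"
      by (rule G3) (rule bounded_borel_intros)
    also have "\<dots> = of_real (\<kappa> * measure \<mu> B)"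
      by (simp add: integral_indicator_complex)
    finally show ?thesis by (simp only: of_real_eq_iff)
  qed
  have "(LINT x|\<mu>. (cmod (f x))\<^sup>2) = \<kappa>\<^sup>2 * (LINT x|\<mu>. (cmod (indicator B x))\<^sup>2)"
  proof (rule parseval_ratio[OF f])
    fix l
    have scale: "exponential (l / \<rho>) (\<rho> * x) = exponential l x" for x
      using \<rho> by (simp add: exponential_scale)
    have R: "exponential (l / \<rho>) (R x) = exponential l x * exponential l d" for x
      unfolding R_def scale exponential_add ..
    have "(LINT x|\<mu>. f x * cnj (exponential l x)) =
        (LINT x|\<mu>. indicator G (\<rho> * x) * cnj (exponential (l / \<rho>) (\<rho> * x)))"
      by (simp add: f_def scale)
    also have "\<dots> = of_real \<kappa> * (LINT x|\<mu>. indicator B x * cnj (exponential (l / \<rho>) (R x)))"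
      by (rule G3) (intro bounded_borel_intros)
    also have "(LINT x|\<mu>. indicator B x * cnj (exponential (l / \<rho>) (R x))) =
        (LINT x|\<mu>. cnj (exponential l d) * (indicator B x * cnj (exponential l x)))"
      by (simp add: R mult_ac)
    finally show "cmod (LINT x|\<mu>. f x * cnj (exponential l x)) =
        \<kappa> * cmod (LINT x|\<mu>. indicator B x * cnj (exponential l x))"
      using \<kappa> by (simp add: norm_mult)
  qed (intro bounded_borel_intros B)
  moreover have "(LINT x|\<mu>. (cmod (indicator B x))\<^sup>2) = measure \<mu> B"
  proof -
    have "(LINT x|\<mu>. (cmod (indicator B x))\<^sup>2) = (LINT x|\<mu>. indicator B x)"
      by (intro Bochner_Integration.integral_cong) (auto simp: indicator_def)
    then show ?thesis by simp
  qed
  \<comment> \<open>An indicator has its integral as squared norm, which gives \<kappa>; Parseval's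
    identity gives the square. The solution 1 is excluded by c > 0.\<close>
  ultimately have "\<kappa> = \<kappa>\<^sup>2" using mB mE f_sq by simp
  then have "\<kappa> = 0" using \<kappa> by (auto simp: power2_eq_square)
  then show "p d = p 0" using p0 by (simp add: \<kappa>_def c_def)
qed

end

text \<open>The number \<open>\<rho> * b / (1 - \<rho>)\<close> is the fixed point of the map with
  the largest digit, the right end of the support, so the reflection exchanges the two ends.
  Conjugating test functions turns coefficients into their conjugates up to a phase, so the same
  \<Lambda> serves.\<close>

lemma spectral_self_similar_reflect:
  assumes "spectral_self_similar \<rho> D p \<mu> \<Lambda>"
  defines "b \<equiv> Max D"
  shows "spectral_self_similar \<rho> ((\<lambda>d. b - d) ` D) (\<lambda>d. p (b - d))
    (distr \<mu> borel (\<lambda>x. \<rho> * b / (1 - \<rho>) - x)) \<Lambda>"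
proof -
  interpret spectral_self_similar \<rho> D p \<mu> \<Lambda> by fact
  define s where "s = \<rho> * b / (1 - \<rho>)"
  have s: "s = \<rho> * s + \<rho> * b" using \<rho> by (simp add: s_def field_simps)
  have b: "b \<in> D" "\<And>d. d \<in> D \<Longrightarrow> d \<le> b"
    using fin_D zero_D by (auto simp: b_def intro!: Max_in)
  have inj: "inj_on (\<lambda>d. b - d) D" by (simp add: inj_on_def)
  let ?N = "distr \<mu> borel (\<lambda>x. s - x)"
  have N: "real_distribution ?N"
    unfolding real_distribution_def real_distribution_axioms_def
    by (simp add: prob_space_distr)
  interpret N: real_distribution ?N by (rule N)
  have int_N: "(LINT x|?N. f x) = (LINT x|\<mu>. f (s - x))"
    if "f \<in> borel_measurable borel" for f :: "real \<Rightarrow> 'x :: {banach, second_countable_topology}"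
    by (rule integral_distr) (use that in auto)
  have meas_N: "measure ?N A = measure \<mu> ((\<lambda>x. s - x) -` A)" if "A \<in> sets borel" for A
    using that by (subst measure_distr) auto
  have parseval_N: "parseval ?N \<Lambda>"
    unfolding parseval_def
  proof (intro allI impI)
    fix f assume f: "bounded_borel f"
    let ?g = "\<lambda>x. cnj (f (s - x))"
    have fm: "f \<in> borel_measurable borel" by (rule bounded_borel_measurable[OF f])
    have g: "bounded_borel ?g" by (intro bounded_borel_cnj bounded_borel_comp[OF f]) simp
    have "cmod (LINT x|?N. f x * cnj (exponential l x)) = cmod (LINT x|\<mu>. ?g x * cnj (exponential l x))" for l
    proof -
      have "(\<lambda>x. f x * cnj (exponential l x)) \<in> borel_measurable borel"
        by (intro bounded_borel_measurable bounded_borel_mult bounded_borel_cnj f bounded_borel_intros)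
      then have "(LINT x|?N. f x * cnj (exponential l x)) = (LINT x|\<mu>. f (s - x) * cnj (exponential l (s - x)))"
        by (rule int_N)
      also have "\<dots> = (LINT x|\<mu>. cnj (exponential l s) * cnj (?g x * cnj (exponential l x)))"
      proof (rule Bochner_Integration.integral_cong[OF refl])
        fix x
        have "exponential l (s - x) = exponential l s * cnj (exponential l x)"
          by (simp add: exponential_cis cis_cnj cis_mult algebra_simps)
        then show "f (s - x) * cnj (exponential l (s - x)) =
            cnj (exponential l s) * cnj (?g x * cnj (exponential l x))" by simp
      qed
      also have "\<dots> = cnj (exponential l s) * cnj (LINT x|\<mu>. ?g x * cnj (exponential l x))"
        by (simp only: Bochner_Integration.integral_cnj Bochner_Integration.integral_mult_right_zero)
      finally show ?thesis by (simp only: norm_mult complex_mod_cnj norm_exponential mult_1)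
    qed
    moreover have "(LINT x|?N. (cmod (f x))\<^sup>2) = (LINT x|\<mu>. (cmod (?g x))\<^sup>2)"
      using fm by (subst int_N) auto
    ultimately show "((\<lambda>l. (cmod (LINT x|?N. f x * cnj (exponential l x)))\<^sup>2) has_sum
        (LINT x|?N. (cmod (f x))\<^sup>2)) \<Lambda>"
      using parseval_has_sum[OF g] by simp
  qed
  have orth_N: "fourier ?N (k - l) = 0" if "k \<in> \<Lambda>" "l \<in> \<Lambda>" "k \<noteq> l" for k l
  proof -
    have "fourier ?N (k - l) = (LINT x|\<mu>. exponential (k - l) (s - x))"
      unfolding fourier_def by (rule int_N) simp
    also have "\<dots> = (LINT x|\<mu>. exponential (k - l) s * exponential (l - k) x)"
      by (rule Bochner_Integration.integral_cong) (auto simp: exponential_cis cis_mult algebra_simps)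
    also have "\<dots> = exponential (k - l) s * fourier \<mu> (l - k)" by (simp add: fourier_def)
    also have "\<dots> = 0" using orthogonal[of l k] that by simp
    finally show ?thesis .
  qed
  have "self_similar_measure \<rho> ((\<lambda>d. b - d) ` D) (\<lambda>d. p (b - d)) ?N"
    unfolding self_similar_measure_def
  proof (intro conjI ballI)
    fix E :: "real set" assume E: "E \<in> sets borel"
    have pre: "(\<lambda>x. s - x) -` E \<in> sets borel"
      using measurable_sets[of "\<lambda>x. s - x" borel borel E] E by simp
    have pre': "(\<lambda>x. \<rho> * (x + d)) -` E \<in> sets borel" for d
      using measurable_sets[of "\<lambda>x. \<rho> * (x + d)" borel borel E] E by simp
    have flip: "s - \<rho> * (x + d) = \<rho> * ((s - x) + (b - d))" for x d
      using s by (simp add: algebra_simps)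
    have "measure ?N E = measure \<mu> ((\<lambda>x. s - x) -` E)" by (rule meas_N[OF E])
    also have "\<dots> = (\<Sum>d\<in>D. p d * measure \<mu> ((\<lambda>x. \<rho> * (x + d)) -` ((\<lambda>x. s - x) -` E)))"
      by (rule measure_eq[OF pre])
    also have "\<dots> = (\<Sum>d\<in>D. p d * measure ?N ((\<lambda>x. \<rho> * (x + (b - d))) -` E))"
    proof (rule sum.cong[OF refl])
      fix d
      show "p d * measure \<mu> ((\<lambda>x. \<rho> * (x + d)) -` ((\<lambda>x. s - x) -` E)) =
          p d * measure ?N ((\<lambda>x. \<rho> * (x + (b - d))) -` E)"
        by (subst meas_N[OF pre']) (simp only: vimage_def mem_Collect_eq flip)
    qed
    also have "\<dots> = (\<Sum>d\<in>(\<lambda>d. b - d) ` D. p (b - d) * measure ?N ((\<lambda>x. \<rho> * (x + d)) -` E))"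
      by (subst sum.reindex[OF inj]) simp
    finally show "measure ?N E = (\<Sum>d\<in>(\<lambda>d. b - d) ` D. p (b - d) * measure ?N ((\<lambda>x. \<rho> * (x + d)) -` E))" .
  qed (use N.prob_space_axioms in auto)
  moreover have "probability_vector ((\<lambda>d. b - d) ` D) (\<lambda>d. p (b - d))"
    using pv by (simp add: probability_vector_def sum.reindex[OF inj])
  ultimately show ?thesis
    unfolding s_def[symmetric] using \<rho> fin_D b
    by unfold_locales (auto intro: parseval_N orth_N)
qed

lemma card_4_digits:
  assumes "finite D" "D \<subseteq> {0..}" "(0 :: real) \<in> D" "card D = 4"
  obtains x y z where "D = {0, x, y, z}" "0 < x" "x < y" "y < z"
proof -
  define ds where "ds = sorted_list_of_set D"
  have "length ds = 4" using assms by (simp add: ds_def)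
  then obtain w x y z where "ds = [w, x, y, z]"
    by (auto simp: numeral_eq_Suc length_Suc_conv)
  then have l: "sorted_list_of_set D = [w, x, y, z]" by (simp add: ds_def)
  then have D: "D = {w, x, y, z}" using assms by (metis set_sorted_list_of_set list.set(1) list.set(2))
  have "sorted [w, x, y, z]" "distinct [w, x, y, z]"
    unfolding l[symmetric] by simp_all
  then have o: "w < x" "x < y" "y < z" by auto
  have "w = 0" using assms(2,3) o unfolding D by auto
  with D o that show ?thesis by auto
qed

text \<open>Each of the four digits is an end or next to an end. At either side the neighbour has
  the weight of its end, and the two ends bound each other, once directly and once after
  reflection.\<close>

theorem spectral_equal_weights:
  assumes "spectral_self_similar \<rho> D p \<mu> \<Lambda>" and D4: "card D = 4" and d: "d \<in> D"
  shows "p d = 1 / 4"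
proof -
  interpret spectral_self_similar \<rho> D p \<mu> \<Lambda> by fact
  obtain x y z where D: "D = {0, x, y, z}" and o: "0 < x" "x < y" "y < z"
    using card_4_digits[OF fin_D D_nonneg zero_D D4] .
  have Max: "Max D = z" using o unfolding D by (intro Max_eqI) auto
  interpret R: spectral_self_similar \<rho> "(\<lambda>d. z - d) ` D" "\<lambda>d. p (z - d)"
    "distr \<mu> borel (\<lambda>x. \<rho> * z / (1 - \<rho>) - x)" \<Lambda>
    using spectral_self_similar_reflect[OF assms(1)] unfolding Max .
  have "p x = p 0" using o by (intro weight_le_and_second_eq(2)) (auto simp: D)
  moreover have "p z \<le> p 0" using o by (intro weight_le_and_second_eq(1)) (auto simp: D)
  moreover have "p (z - (z - y)) = p (z - 0)"
    using o by (intro R.weight_le_and_second_eq(2)) (auto simp: D)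
  moreover have "p (z - z) \<le> p (z - 0)"
    using o by (intro R.weight_le_and_second_eq(1)) (auto simp: D)
  moreover have "p 0 + p x + p y + p z = 1"
    using pv o by (simp add: probability_vector_def D add.assoc)
  ultimately show ?thesis using d unfolding D by auto
qed

section \<open>Zeros of the mask polynomial and colourings of the spectrum\<close>

text \<open>The conjugate relation multiplied by a b c says that ab + bc + ca + abc vanishes. Added
  to the relation itself it is the product of 1 + a, 1 + b and 1 + c.\<close>

lemma four_unit_vectors:
  fixes a b c :: complex
  assumes "cmod a = 1" "cmod b = 1" "cmod c = 1" and sum: "1 + a + b + c = 0"
  shows "a = -1 \<and> c = - b \<or> b = -1 \<and> c = - a \<or> c = -1 \<and> b = - a"
proof -
  have inv: "a * cnj a = 1" "b * cnj b = 1" "c * cnj c = 1"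
    using assms by (simp_all add: complex_norm_square[symmetric])
  have "cnj (1 + a + b + c) = 0" unfolding sum by simp
  then have "1 + cnj a + cnj b + cnj c = 0" by simp
  then have "0 = (1 + cnj a + cnj b + cnj c) * (a * b * c)" by simp
  also have "\<dots> = a * b * c + (a * cnj a) * (b * c) + (b * cnj b) * (a * c) + (c * cnj c) * (a * b)"
    by (simp add: algebra_simps)
  finally have "a * b * c + b * c + a * c + a * b = 0" by (simp add: inv)
  with sum have "(1 + a) * (1 + b) * (1 + c) = 0" by (simp add: algebra_simps)
  then have "a = -1 \<or> b = -1 \<or> c = -1"
    by (auto simp: add_eq_0_iff)
  then show ?thesis using sum by (auto simp: add_eq_0_iff)
qed

lemma exponential_eq_minus_one:
  assumes "exponential l x = -1"
  shows "\<exists>k::int. odd k \<and> 2 * l * x = of_int k"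
proof -
  have "Re (exponential l x) = -1" using assms by simp
  then have "cos (2 * pi * l * x - pi) = 1" by (simp add: exponential_cis cos_diff)
  then obtain n :: int where "2 * pi * l * x - pi = of_int n * 2 * pi"
    using cos_one_2pi_int[THEN iffD1] by blast
  then have "pi * (2 * l * x) = pi * (of_int (2 * n + 1))" by (simp add: algebra_simps)
  then have "2 * l * x = of_int (2 * n + 1)" by (simp only: mult_cancel_left pi_neq_zero simp_thms)
  then show ?thesis by (intro exI[of _ "2 * n + 1"]) auto
qed

text \<open>The exponentials of frequency l at u and at v are both -1. With u and v the differences
  inside two pairs of digits, this is one way for the four terms of the mask polynomial to cancel in
  antipodal pairs.\<close>

definition opp :: "real \<Rightarrow> real \<Rightarrow> real \<Rightarrow> bool" where
  "opp u v l \<longleftrightarrow> (\<exists>k k' :: int. odd k \<and> odd k' \<and> 2 * l * u = of_int k \<and> 2 * l * v = of_int k')"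

lemma opp_diff_commute: "opp u (v - w) l \<longleftrightarrow> opp u (w - v) l"
proof -
  have "opp u (w - v) l" if "opp u (v - w) l" for v w
  proof -
    from that obtain k k' :: int where "odd k" "odd k'" "2 * l * u = of_int k" "2 * l * (v - w) = of_int k'"
      by (auto simp: opp_def)
    then show ?thesis unfolding opp_def by (intro exI[of _ k] exI[of _ "- k'"]) (auto simp: algebra_simps)
  qed
  then show ?thesis by blast
qed

lemma mask_zero_opp:
  assumes D: "D = {0, x, y, z}" and dist: "distinct [0, x, y, z]"
    and p: "\<And>d. d \<in> D \<Longrightarrow> p d = 1 / 4" and zero: "mask_poly D p l = 0"
  shows "opp x (z - y) l \<or> opp y (z - x) l \<or> opp z (y - x) l"
proof -
  have "mask_poly D p l = (1 + exponential l x + exponential l y + exponential l z) / 4"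
  proof -
    have "mask_poly D p l = (\<Sum>d\<in>{0, x, y, z}. exponential l d / 4)"
      unfolding mask_poly_def D by (intro sum.cong refl) (use p D in \<open>simp only: of_real_divide of_real_1 of_real_numeral; simp\<close>)
    then show ?thesis using dist by (simp add: field_simps)
  qed
  then have "1 + exponential l x + exponential l y + exponential l z = 0"
    using zero by simp
  moreover have "opp u (w - v) l" if "exponential l u = -1" "exponential l w = - exponential l v" for u v w
  proof -
    have "exponential l (w - v) = exponential l w * cnj (exponential l v)"
      by (simp add: exponential_cis cis_cnj cis_mult algebra_simps)
    also have "\<dots> = - (exponential l v * cnj (exponential l v))" by (simp add: that)
    also have "\<dots> = -1" by (simp add: complex_norm_square[symmetric])
    finally have "exponential l (w - v) = -1" .
    with that(1) show ?thesis
      unfolding opp_def by (meson exponential_eq_minus_one)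
  qed
  ultimately show ?thesis
    using four_unit_vectors[of "exponential l x" "exponential l y" "exponential l z"] by auto
qed

text \<open>A two-colouring of the line that separates all points whose difference is an odd
  multiple of g.\<close>

lemma floor_parity_shift:
  fixes g x :: real
  assumes "g \<noteq> 0" "odd k"
  shows "even \<lfloor>(x + of_int k * g) / g\<rfloor> \<longleftrightarrow> odd \<lfloor>x / g\<rfloor>"
proof -
  have "(x + of_int k * g) / g = x / g + of_int k" using assms(1) by (simp add: field_simps)
  then have "\<lfloor>(x + of_int k * g) / g\<rfloor> = \<lfloor>x / g\<rfloor> + k" by simp
  with assms(2) show ?thesis by simp
qed

text \<open>
  Along two incommensurable directions the colours \<open>c i\<close> and \<open>c j\<close> can be added, so a second
  direction does not increase the number of colours.
\<close>
lemma ex_coset_colouring: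
  fixes g h :: real and c :: "int \<Rightarrow> int"
  assumes indep: "\<And>i j :: int. of_int i * g + of_int j * h = 0 \<Longrightarrow> i = 0 \<and> j = 0"
    and c: "\<And>i. 0 \<le> c i" "\<And>i. c i < M"
  shows "\<exists>col :: real \<Rightarrow> int. range col \<subseteq> {0..<M} \<and>
    (\<forall>x i. (\<forall>k. c (k + i) \<noteq> c k) \<longrightarrow>
      col (x + of_int i * g) \<noteq> col x \<and> col (x + of_int i * h) \<noteq> col x)"
proof -
  \<comment> \<open>Coordinates on the cosets of Z g + Z h: one representative per coset is chosen,
    and independence makes \<open>I\<close> and \<open>J\<close> additive under shifts.\<close>
  define P where "P x r \<longleftrightarrow> (\<exists>i j :: int. x = r + of_int i * g + of_int j * h)" for x r
  define rep where "rep x = (SOME r. P x r)" for x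
  have "P x x" for x unfolding P_def by (intro exI[of _ 0]) simp
  then have rep: "P x (rep x)" for x unfolding rep_def by (rule someI)
  have P_shift: "P (x + of_int i * g + of_int j * h) = P x" for x i j
  proof (rule ext, rule iffI)
    fix r assume "P (x + of_int i * g + of_int j * h) r"
    then obtain i' j' :: int where "x + of_int i * g + of_int j * h = r + of_int i' * g + of_int j' * h"
      by (auto simp: P_def)
    then show "P x r" unfolding P_def
      by (intro exI[of _ "i' - i"] exI[of _ "j' - j"]) (simp add: algebra_simps)
  next
    fix r assume "P x r"
    then obtain i' j' :: int where "x = r + of_int i' * g + of_int j' * h"
      by (auto simp: P_def)
    then show "P (x + of_int i * g + of_int j * h) r" unfolding P_def
      by (intro exI[of _ "i' + i"] exI[of _ "j' + j"]) (simp add: algebra_simps)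
  qed
  have rep_shift: "rep (x + of_int i * g + of_int j * h) = rep x" for x i j
    unfolding rep_def P_shift ..
  from rep obtain I J where IJ: "\<And>x. x = rep x + of_int (I x) * g + of_int (J x) * h"
    unfolding P_def by metis
  have IJ_shift: "I (x + of_int i * g + of_int j * h) = I x + i \<and> J (x + of_int i * g + of_int j * h) = J x + j"
    for x i j
  proof -
    let ?y = "x + of_int i * g + of_int j * h"
    have "?y = rep x + of_int (I ?y) * g + of_int (J ?y) * h"
      using IJ[of ?y] rep_shift[of x i j] by simp
    with IJ[of x] have "of_int (I ?y - I x - i) * g + of_int (J ?y - J x - j) * h = 0"
      by (simp add: algebra_simps)
    from indep[OF this] show ?thesis by simp
  qed
  have M: "M > 0" using c[of 0] by linarith
  define col where "col x = (c (I x) + c (J x)) mod M" for x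
  have neq: "(a + b) mod M \<noteq> (a' + b) mod M" if "a \<noteq> a'" "0 \<le> a" "a < M" "0 \<le> a'" "a' < M" for a a' b :: int
  proof
    assume "(a + b) mod M = (a' + b) mod M"
    then have "a mod M = a' mod M" by (metis add_diff_cancel_right' mod_diff_left_eq)
    with that show False by simp
  qed
  show ?thesis
  proof (intro exI[of _ col] conjI allI impI)
    show "range col \<subseteq> {0..<M}" using M by (auto simp: col_def)
  next
    fix x i assume "\<forall>k. c (k + i) \<noteq> c k"
    then have i: "\<And>k. c (k + i) \<noteq> c k" by blast
    show "col (x + of_int i * g) \<noteq> col x" "col (x + of_int i * h) \<noteq> col x"
      using IJ_shift[of x i 0] IJ_shift[of x 0 i] neq[OF i[of "I x"] c c, of "c (J x)"]
        neq[OF i[of "J x"] c c, of "c (I x)"]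
      by (simp_all add: col_def add.commute)
  qed
qed

section \<open>Lower bounds for the number of colours\<close>

locale spectral_four = spectral_self_similar +
  assumes card_D: "card D = 4" and weights: "\<And>d. d \<in> D \<Longrightarrow> p d = 1 / 4"
begin

text \<open>Different frequencies of equal colour differ by a zero of a level above n, which remains
  a zero after multiplication by \<open>\<rho> ^ n\<close>. So \<open>card_classes\<close> applies,
  with \<open>p 0 = 1 / 4\<close>.\<close>

lemma card_level_classes:
  fixes col :: "real \<Rightarrow> 'c"
  assumes C: "finite C" "col ` \<Lambda> \<subseteq> C"
    and proper: "\<And>j k l. 1 \<le> j \<Longrightarrow> j \<le> n \<Longrightarrow> k \<in> \<Lambda> \<Longrightarrow> l \<in> \<Lambda> \<Longrightarrow>
      mask_poly D p (\<rho> ^ j * (k - l)) = 0 \<Longrightarrow> col k \<noteq> col l"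
  shows "4 ^ n \<le> card C"
proof -
  have "1 \<le> p 0 ^ n * card C"
  proof (rule card_classes[OF C])
    fix k l assume kl: "k \<in> \<Lambda>" "l \<in> \<Lambda>" "k \<noteq> l" "col k = col l"
    from fourier_zero[OF orthogonal[OF kl(1-3)]]
    obtain j where j: "j \<ge> 1" "mask_poly D p (\<rho> ^ j * (k - l)) = 0" by blast
    with proper[of j k l] kl have "j > n" by force
    then have "\<rho> ^ (j - n) * (\<rho> ^ n * (k - l)) = \<rho> ^ j * (k - l)"
      by (simp flip: power_add mult.assoc)
    with j(2) have "mask_poly D p (\<rho> ^ (j - n) * (\<rho> ^ n * (k - l))) = 0" by (simp only:)
    then show "fourier \<mu> (\<rho> ^ n * (k - l)) = 0"
      using \<open>j > n\<close> by (intro fourier_zeroI[of "j - n"]) auto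
  qed
  then have "4 ^ n \<le> real (card C)"
    using weights[OF zero_D] by (simp add: power_one_over field_simps)
  then show ?thesis by (metis of_nat_le_iff of_nat_numeral of_nat_power)
qed

text \<open>The colour of a point is its tuple of parities, one for each generator, which makes
  \<open>2 ^ card I\<close> colours. A contradiction arises whenever n levels are covered by fewer
  than 2 n generators.\<close>

lemma card_level_generators:
  fixes g :: "'i \<Rightarrow> real"
  assumes I: "finite I" "\<And>i. i \<in> I \<Longrightarrow> g i \<noteq> 0"
    and gen: "\<And>j k l. 1 \<le> j \<Longrightarrow> j \<le> n \<Longrightarrow> k \<in> \<Lambda> \<Longrightarrow> l \<in> \<Lambda> \<Longrightarrow>
      mask_poly D p (\<rho> ^ j * (k - l)) = 0 \<Longrightarrow>
      \<exists>i\<in>I. \<exists>m::int. odd m \<and> k - l = of_int m * g i"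
  shows "2 * n \<le> card I"
proof -
  have "4 ^ n \<le> card (Pow I)"
  proof (rule card_level_classes[where col = "\<lambda>x. {i \<in> I. even \<lfloor>x / g i\<rfloor>}"])
    fix j k l assume "1 \<le> j" "j \<le> n" "k \<in> \<Lambda>" "l \<in> \<Lambda>" "mask_poly D p (\<rho> ^ j * (k - l)) = 0"
    from gen[OF this] obtain i m where i: "i \<in> I" "odd m" "k = l + of_int m * g i"
      by (auto simp: algebra_simps)
    then have "even \<lfloor>k / g i\<rfloor> \<longleftrightarrow> odd \<lfloor>l / g i\<rfloor>"
      using floor_parity_shift I by simp
    then show "{i \<in> I. even \<lfloor>k / g i\<rfloor>} \<noteq> {i \<in> I. even \<lfloor>l / g i\<rfloor>}"
      using i(1) by blast
  qed (use I in auto)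
  then have "(2::nat) ^ (2 * n) \<le> 2 ^ card I"
    using I(1) by (simp add: card_Pow power_mult)
  then show ?thesis by (subst (asm) power_increasing_iff) auto
qed

text \<open>For zeros along two incommensurable directions, M colours are enough if the same
  colouring \<open>c\<close> of the integers separates them along each direction.\<close>

lemma card_level_directions:
  fixes g h :: real and c :: "int \<Rightarrow> int"
  assumes indep: "\<And>i j :: int. of_int i * g + of_int j * h = 0 \<Longrightarrow> i = 0 \<and> j = 0"
    and c: "\<And>i. 0 \<le> c i" "\<And>i. c i < M"
    and gen: "\<And>j x. 1 \<le> j \<Longrightarrow> j \<le> n \<Longrightarrow> mask_poly D p (\<rho> ^ j * x) = 0 \<Longrightarrow>
      \<exists>k::int. (\<forall>i. c (i + k) \<noteq> c i) \<and> (x = of_int k * g \<or> x = of_int k * h)"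
  shows "4 ^ n \<le> M"
proof -
  have "\<exists>col :: real \<Rightarrow> int. range col \<subseteq> {0..<M} \<and>
    (\<forall>x i. (\<forall>k. c (k + i) \<noteq> c k) \<longrightarrow>
      col (x + of_int i * g) \<noteq> col x \<and> col (x + of_int i * h) \<noteq> col x)"
    by (rule ex_coset_colouring[OF _ c]) (rule indep)
  then obtain col :: "real \<Rightarrow> int" where col: "range col \<subseteq> {0..<M}"
    "\<And>x i. \<forall>k. c (k + i) \<noteq> c k \<Longrightarrow>
      col (x + of_int i * g) \<noteq> col x \<and> col (x + of_int i * h) \<noteq> col x"
    by (elim exE conjE) simp
  have "4 ^ n \<le> card {0..<M}"
  proof (rule card_level_classes)
    fix j k l assume "1 \<le> j" "j \<le> n" and "mask_poly D p (\<rho> ^ j * (k - l)) = 0"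
    from gen[OF this] obtain i where i: "\<forall>m. c (m + i) \<noteq> c m"
      "k - l = of_int i * g \<or> k - l = of_int i * h" by blast
    then have "k = l + of_int i * g \<or> k = l + of_int i * h" by linarith
    then show "col k \<noteq> col l" using col(2)[of i l] i(1) by auto
  qed (use col in auto)
  moreover have "M > 0" using c[of 0] by linarith
  ultimately have "int (4 ^ n) \<le> M" by simp
  then show ?thesis by simp
qed

end

section \<open>The digits\<close>

lemma pow2_odd_decomposition:
  fixes n :: int
  assumes "n \<noteq> 0"
  shows "\<exists>t a. odd a \<and> n = 2 ^ t * a"
  using assms
proof (induction "nat \<bar>n\<bar>" arbitrary: n rule: less_induct)
  case (less n)
  show ?case
  proof (cases "odd n")
    case True
    then show ?thesis by (intro exI[of _ 0] exI[of _ n]) simp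
  next
    case False
    then obtain m where m: "n = 2 * m" by blast
    with less.prems have "nat \<bar>m\<bar> < nat \<bar>n\<bar>" "m \<noteq> 0" by auto
    from less.hyps[OF this] obtain t a where "odd a" "m = 2 ^ t * a" by blast
    with m show ?thesis by (intro exI[of _ "Suc t"] exI[of _ a]) simp
  qed
qed

lemma pow2_odd_unique:
  fixes a b :: int
  assumes "2 ^ s * a = 2 ^ t * b" "odd a" "odd b"
  shows "s = t"
proof (rule ccontr)
  have *: False if "s < t" "2 ^ s * a = 2 ^ t * b" "odd a" for s t :: nat and a b :: int
  proof -
    have "2 ^ t = (2::int) ^ s * 2 ^ (t - s)" using that by (simp flip: power_add)
    with that have "a = 2 ^ (t - s) * b" by simp
    with that show False by simp
  qed
  assume "s \<noteq> t"
  then show False using *[of s t a b] *[of t s b a] assms by (metis linorder_neqE_nat)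
qed

lemma odd_ratio_pow2:
  fixes u v a b :: int
  assumes "u * (2 ^ s * a) = v * (2 ^ t * b)" "odd u" "odd v" "odd a" "odd b"
  shows "s = t"
  using pow2_odd_unique[of s "u * a" t "v * b"] assms by (simp add: mult_ac)

lemma opp_ratio:
  assumes "opp u v l"
  obtains k k' :: int where "odd k" "odd k'" "of_int k' * u = of_int k * v"
proof -
  from assms obtain k k' :: int where k: "odd k" "odd k'" "2 * l * u = of_int k" "2 * l * v = of_int k'"
    by (auto simp: opp_def)
  have "of_int k' * u = of_int k * v"
    unfolding k(3,4)[symmetric] by simp
  with k that show ?thesis by blast
qed

lemma oppE1:
  assumes "opp u v (r * w)" "u \<noteq> 0" "r \<noteq> 0"
  obtains k :: int where "odd k" "w = of_int k * (1 / (2 * u * r))"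
proof -
  from assms obtain k :: int where "odd k" "2 * (r * w) * u = of_int k" by (auto simp: opp_def)
  with assms that[of k] show ?thesis by (simp add: field_simps)
qed

text \<open>Only common factors 2 are divided out, because only powers of 2 will be
  compared.\<close>

lemma primitive_integer_triple:
  assumes "y = x * r" "z = x * s" "r \<in> \<rat>" "s \<in> \<rat>" "0 < x"
  obtains \<sigma> :: real and X Y Z :: int where "\<sigma> > 0" "x = \<sigma> * of_int X" "y = \<sigma> * of_int Y"
    "z = \<sigma> * of_int Z" "\<not> (even X \<and> even Y \<and> even Z)"
proof -
  have reduce: "\<exists>\<sigma>>0. \<exists>X Y Z :: int. x = \<sigma> * of_int X \<and> y = \<sigma> * of_int Y \<and> z = \<sigma> * of_int Z \<and>
      \<not> (even X \<and> even Y \<and> even Z)"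
    if "\<sigma> > 0" "x = \<sigma> * of_int X" "y = \<sigma> * of_int Y" "z = \<sigma> * of_int Z"
    for \<sigma> and X Y Z :: int
    using that
  proof (induction "nat X" arbitrary: X Y Z \<sigma> rule: less_induct)
    case less
    have X: "X > 0" using less.prems assms(5) by (simp add: zero_less_mult_iff)
    show ?case
    proof (cases "even X \<and> even Y \<and> even Z")
      case True
      then obtain X' Y' Z' where e: "X = 2 * X'" "Y = 2 * Y'" "Z = 2 * Z'" by (auto elim!: evenE)
      show ?thesis
        by (rule less.hyps[of X' "2 * \<sigma>" Y' Z']) (use e X less.prems in auto)
    next
      case False
      with less.prems show ?thesis by blast
    qed
  qed
  from assms obtain a and b :: nat where r: "r = of_int a / of_nat b" "b \<noteq> 0"
    by (auto simp: Rats_eq_int_div_nat)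
  from assms obtain c and d :: nat where s: "s = of_int c / of_nat d" "d \<noteq> 0"
    by (auto simp: Rats_eq_int_div_nat)
  have "0 < x / of_nat (b * d)" using assms r s by simp
  moreover have "x = x / of_nat (b * d) * of_int (int (b * d))" using r s by simp
  moreover have "y = x / of_nat (b * d) * of_int (a * int d)" using r s assms by simp
  moreover have "z = x / of_nat (b * d) * of_int (c * int b)" using r s assms by simp
  ultimately show ?thesis using reduce that by blast
qed

text \<open>Up to scale there are two even and two odd digits, and the 2-adic distance inside both
  pairs is governed by the same exponent t.\<close>

definition digit_form :: "real set \<Rightarrow> real \<Rightarrow> int \<Rightarrow> int \<Rightarrow> int \<Rightarrow> nat \<Rightarrow> bool" where
  "digit_form D c a b b' t \<longleftrightarrow> c > 0 \<and> odd a \<and> odd b \<and> odd b' \<and> t \<ge> 1 \<and>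
     (\<lambda>d. c * d) ` D = real_of_int ` {0, a, 2 ^ t * b, a + 2 ^ t * b'}"

context spectral_four
begin

text \<open>Each pairing that occurs gives two differences an odd ratio. Once the digits are
  commensurable, this fixes their parities and, except when the first two are both odd, the equality
  of the two valuations; there a colouring decides.\<close>

lemma digit_form_if_two_pairings:
  assumes D: "D = {0, x, y, z}" and pos: "0 < x" "0 < y" "0 < z" and dist: "x \<noteq> y" "y \<noteq> z" "x \<noteq> z"
    and opp: "opp x (z - y) l" "opp y (z - x) l'"
  shows "\<exists>c a b b' t. digit_form D c a b b' t"
proof -
  have \<rho>0: "\<rho> \<noteq> 0" using \<rho> by simp
  have zero: "opp x (z - y) w \<or> opp y (z - x) w \<or> opp z (y - x) w" if "mask_poly D p w = 0" for w
    using pos dist by (intro mask_zero_opp[OF D _ weights that]) auto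
  obtain u v where uv: "odd u" "odd v" "of_int v * x = of_int u * (z - y)"
    using opp_ratio[OF opp(1)] .
  obtain u' v' where uv': "odd u'" "odd v'" "of_int v' * y = of_int u' * (z - x)"
    using opp_ratio[OF opp(2)] .
  have u0: "u \<noteq> 0" "u' \<noteq> 0" using uv uv' by auto
  have rat: "y / x \<in> \<rat>"
  proof (rule ccontr)
    assume irr: "y / x \<notin> \<rat>"
    have not_rat: "n = 0 \<and> m = 0" if "of_int m * y = of_int n * x" for m n :: int
    proof -
      have "m = 0"
      proof (rule ccontr)
        assume "m \<noteq> 0"
        then have "y / x = of_int n / of_int m" using that pos by (simp add: field_simps)
        with irr show False by (metis Rats_divide Rats_of_int)
      qed
      with that pos show ?thesis by simp
    qed
    have "of_int (u * (u' - v')) * y = of_int (u' * (u - v)) * x"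
    proof -
      have "of_int u * (of_int v' * y) = of_int u * (of_int u' * (z - x))" using uv' by simp
      moreover have "of_int u' * (of_int v * x) = of_int u' * (of_int u * (z - y))" using uv by simp
      ultimately show ?thesis by (simp add: algebra_simps)
    qed
    from not_rat[OF this] u0 have "v = u" by auto
    with uv u0 have z: "z = x + y" by simp
    \<comment> \<open>With z = x + y the mask polynomial factors, and the third pairing would make y
      / x rational. The zeros then lie along two incommensurable directions, each separated by
      parity: two colours where four are needed.\<close>
    have "(4::int) ^ 1 \<le> 2"
    proof (rule card_level_directions[where g = "1 / (2 * x * \<rho>)" and h = "1 / (2 * y * \<rho>)" and
          c = "\<lambda>i. i mod 2"])
      fix i j :: int assume "of_int i * (1 / (2 * x * \<rho>)) + of_int j * (1 / (2 * y * \<rho>)) = 0"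
      then have "of_int i * y = of_int (- j) * x" using pos \<rho>0 by (simp add: field_simps)
      from not_rat[OF this] show "i = 0 \<and> j = 0" by simp
    next
      fix j w assume "1 \<le> j" "j \<le> (1::nat)" "mask_poly D p (\<rho> ^ j * w) = 0"
      then have "mask_poly D p (\<rho> * w) = 0" by (cases "j = 1") auto
      from zero[OF this] have "opp x (z - y) (\<rho> * w) \<or> opp y (z - x) (\<rho> * w)"
      proof (elim disjE)
        assume "opp z (y - x) (\<rho> * w)"
        then obtain k k' :: int where k: "odd k" "2 * (\<rho> * w) * z = of_int k"
          "2 * (\<rho> * w) * (y - x) = of_int k'" by (auto simp: opp_def)
        have "of_int (k - k') * y = of_int (k + k') * x"
          unfolding of_int_diff of_int_add k(2,3)[symmetric] z by (simp add: algebra_simps)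
        from not_rat[OF this] have "k = 0" by simp
        with k show ?thesis by simp
      qed auto
      then obtain k :: int where "odd k" "w = of_int k * (1 / (2 * x * \<rho>)) \<or> w = of_int k * (1 / (2 * y * \<rho>))"
        using oppE1 pos \<rho>0 by (metis less_irrefl)
      moreover have "(i + k) mod 2 \<noteq> i mod 2" if "odd k" for i k :: int
        using that by presburger
      ultimately show "\<exists>k::int. (\<forall>i. (i + k) mod 2 \<noteq> i mod 2) \<and>
          (w = of_int k * (1 / (2 * x * \<rho>)) \<or> w = of_int k * (1 / (2 * y * \<rho>)))" by blast
    qed auto
    then show False by simp
  qed
  have "z / x = y / x + of_int v / of_int u" using uv pos u0 by (simp add: field_simps)
  then have rat': "z / x \<in> \<rat>" using rat by simp
  obtain \<sigma> and X Y Z :: int where \<sigma>: "\<sigma> > 0" and XYZ: "x = \<sigma> * of_int X" "y = \<sigma> * of_int Y"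
    "z = \<sigma> * of_int Z" and prim: "\<not> (even X \<and> even Y \<and> even Z)"
    by (rule primitive_integer_triple[OF _ _ rat rat' pos(1), of y z]) (use pos in auto)
  have "\<sigma> * of_int (v * X) = \<sigma> * of_int (u * (Z - Y))" using uv(3) by (simp add: XYZ algebra_simps)
  then have eq: "v * X = u * (Z - Y)" using \<sigma> by (simp only: mult_cancel_left of_int_eq_iff) simp
  have "\<sigma> * of_int (v' * Y) = \<sigma> * of_int (u' * (Z - X))" using uv'(3) by (simp add: XYZ algebra_simps)
  then have eq': "v' * Y = u' * (Z - X)" using \<sigma> by (simp only: mult_cancel_left of_int_eq_iff) simp
  \<comment> \<open>Both equivalences say that X + Y + Z is even; as not all three are even, exactly
    two are odd.\<close>
  have par: "even X \<longleftrightarrow> even (Z - Y)" "even Y \<longleftrightarrow> even (Z - X)"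
    using uv uv' eq eq' by (metis even_mult_iff)+
  have ne: "X \<noteq> Y" "Z \<noteq> Y" "Z \<noteq> X" "X \<noteq> 0" "Y \<noteq> 0" "Z \<noteq> 0" using dist pos \<sigma> by (auto simp: XYZ)
  have image: "(\<lambda>d. 1 / \<sigma> * d) ` D = real_of_int ` {0, X, Y, Z}"
  proof -
    have "1 / \<sigma> * x = of_int X" "1 / \<sigma> * y = of_int Y" "1 / \<sigma> * z = of_int Z"
      using \<sigma> unfolding XYZ by simp_all
    then show ?thesis by (simp only: D image_insert image_empty mult_zero_right of_int_0)
  qed
  show ?thesis
  proof (cases "odd X \<and> odd Y")
    case True
    then have "even Z" using par by presburger
    obtain t b where b: "odd b" "Z = 2 ^ t * b" using pow2_odd_decomposition ne by metis
    obtain s b' where b': "odd b'" "Y - X = 2 ^ s * b'" using pow2_odd_decomposition[of "Y - X"] ne by (metis right_minus_eq)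
    have "t \<noteq> 0" using b \<open>even Z\<close> by (intro notI) simp
    \<comment> \<open>Different valuations rule out the third pairing. Since X and Y are odd, the
      other two pairings yield odd multiples of one number with denominator X Y: one generator where
      two are needed.\<close>
    have "s = t"
    proof (rule ccontr)
      assume "s \<noteq> t"
      have "2 * 1 \<le> card {()}"
      proof (rule card_level_generators[where g = "\<lambda>_. 1 / (2 * \<sigma> * of_int (X * Y) * \<rho>)"])
        fix j k m assume "1 \<le> j" "j \<le> (1::nat)" "mask_poly D p (\<rho> ^ j * (k - m)) = 0"
        then have "mask_poly D p (\<rho> * (k - m)) = 0" by (cases "j = 1") auto
        from zero[OF this] show "\<exists>i\<in>{()}. \<exists>n::int. odd n \<and> k - m = of_int n * (1 / (2 * \<sigma> * of_int (X * Y) * \<rho>))"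
        proof (elim disjE)
          assume "opp x (z - y) (\<rho> * (k - m))"
          then obtain n :: int where n: "odd n" "k - m = of_int n * (1 / (2 * x * \<rho>))"
            using oppE1 pos \<rho>0 by (metis less_irrefl)
          then have "k - m = of_int (n * Y) * (1 / (2 * \<sigma> * of_int (X * Y) * \<rho>))"
            using ne by (simp add: XYZ)
          with n True show ?thesis by (metis even_mult_iff singletonI)
        next
          assume "opp y (z - x) (\<rho> * (k - m))"
          then obtain n :: int where n: "odd n" "k - m = of_int n * (1 / (2 * y * \<rho>))"
            using oppE1 pos \<rho>0 by (metis less_irrefl)
          then have "k - m = of_int (n * X) * (1 / (2 * \<sigma> * of_int (X * Y) * \<rho>))"
            using ne by (simp add: XYZ)
          with n True show ?thesis by (metis even_mult_iff singletonI)
        next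
          assume "opp z (y - x) (\<rho> * (k - m))"
          then obtain n n' :: int where n: "odd n" "odd n'" "of_int n' * z = of_int n * (y - x)"
            by (rule opp_ratio)
          then have "\<sigma> * of_int (n' * Z) = \<sigma> * of_int (n * (Y - X))"
            by (simp add: XYZ algebra_simps)
          then have "n' * Z = n * (Y - X)" using \<sigma> by (simp only: mult_cancel_left of_int_eq_iff) simp
          then have "s = t" using odd_ratio_pow2[of n s b' n' t b] n b b' by simp
          with \<open>s \<noteq> t\<close> show ?thesis by simp
        qed
      qed (use \<sigma> \<rho>0 ne in auto)
      then show False by simp
    qed
    with b b' have "Y = X + 2 ^ t * b'" by simp
    then have "digit_form D (1 / \<sigma>) X b b' t"
      unfolding digit_form_def image using \<sigma> True b b' \<open>t \<noteq> 0\<close> by auto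
    then show ?thesis by blast
  next
    case False
    have form: "digit_form D (1 / \<sigma>) A b b' t"
      if "{0, X, Y, Z} = {0, A, B, Z}" "odd A" "even B" "B = 2 ^ t * b" "odd b"
        "Z - A = 2 ^ t * b'" "odd b'" for A B b b' and t :: nat
    proof -
      have "t \<noteq> 0" using that by (intro notI) simp
      moreover have Z: "Z = A + 2 ^ t * b'" using that by simp
      have "{0, X, Y, Z} = {0, A, 2 ^ t * b, A + 2 ^ t * b'}"
        unfolding that(1) by (simp only: Z that(4))
      ultimately show ?thesis
        unfolding digit_form_def image using \<sigma> that(2,5,7) by simp
    qed
    show ?thesis
    proof (cases "odd X")
      case True
      with False have Y: "even Y" by simp
      obtain t b where b: "odd b" "Y = 2 ^ t * b" using pow2_odd_decomposition ne by metis
      obtain s b' where b': "odd b'" "Z - X = 2 ^ s * b'" using pow2_odd_decomposition[of "Z - X"] ne by (metis right_minus_eq)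
      have "s = t" using odd_ratio_pow2[of u' s b' v' t b] uv' b b' eq' by simp
      with form[of X Y t b b'] True Y b b' show ?thesis by blast
    next
      case X: False
      then have "odd Y" using par prim by presburger
      obtain t b where b: "odd b" "X = 2 ^ t * b" using pow2_odd_decomposition ne by metis
      obtain s b' where b': "odd b'" "Z - Y = 2 ^ s * b'" using pow2_odd_decomposition[of "Z - Y"] ne by (metis right_minus_eq)
      have "s = t" using odd_ratio_pow2[of u s b' v t b] uv b b' eq by simp
      moreover have "{0, X, Y, Z} = {0, Y, X, Z}" by blast
      ultimately have "digit_form D (1 / \<sigma>) Y b b' t"
        using form[of Y X t b b'] X \<open>odd Y\<close> b b' by simp
      then show ?thesis by blast
    qed
  qed
qed

text \<open>A single pairing would leave one generator on the first level, where two are needed. So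
  two of the three pairings occur, and relabelling the digits makes them the first two.\<close>

theorem ex_digit_form: "\<exists>c a b b' t. digit_form D c a b b' t"
proof -
  obtain x y z where D: "D = {0, x, y, z}" and o: "0 < x" "x < y" "y < z"
    using card_4_digits[OF fin_D D_nonneg zero_D card_D] .
  have zero: "opp x (z - y) w \<or> opp y (z - x) w \<or> opp z (y - x) w" if "mask_poly D p w = 0" for w
    using o by (intro mask_zero_opp[OF D _ weights that]) auto
  have one_pairing: False
    if u: "u > 0" "\<And>w. mask_poly D p w = 0 \<Longrightarrow> opp u v w" for u v
  proof -
    have "2 * 1 \<le> card {()}"
    proof (rule card_level_generators[where g = "\<lambda>_. 1 / (2 * u * \<rho>)"])
      fix j k m assume "1 \<le> j" "j \<le> (1::nat)" "mask_poly D p (\<rho> ^ j * (k - m)) = 0"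
      then have "mask_poly D p (\<rho> * (k - m)) = 0" by (cases "j = 1") auto
      from u(2)[OF this] show "\<exists>i\<in>{()}. \<exists>n::int. odd n \<and> k - m = of_int n * (1 / (2 * u * \<rho>))"
        using oppE1 u(1) \<rho> by (metis less_irrefl singletonI)
    qed (use u \<rho> in auto)
    then show False by simp
  qed
  consider l l' where "opp x (z - y) l" "opp y (z - x) l'" | l l' where "opp x (z - y) l" "opp z (y - x) l'"
    | l l' where "opp y (z - x) l" "opp z (y - x) l'"
    using one_pairing[of x "z - y"] one_pairing[of y "z - x"] one_pairing[of z "y - x"] zero o
    by (metis less_trans)
  then show ?thesis
  proof cases
    case 1
    then show ?thesis using o by (intro digit_form_if_two_pairings[OF D]) auto
  next
    case 2
    then have "opp x (y - z) l" by (simp add: opp_diff_commute)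
    with 2 show ?thesis using o
      by (intro digit_form_if_two_pairings[of x z y]) (auto simp: D)
  next
    case 3
    then have "opp y (x - z) l" "opp z (x - y) l'" using opp_diff_commute by blast+
    then show ?thesis using o
      by (intro digit_form_if_two_pairings[of y z x]) (auto simp: D)
  qed
qed

end

text \<open>The 2-adic valuation of s is 0 or t.\<close>

definition two_level :: "nat \<Rightarrow> int \<Rightarrow> bool" where
  "two_level t s \<longleftrightarrow> odd s \<or> (\<exists>k. odd k \<and> s = 2 ^ t * k)"

lemma two_level_not_dvd: "two_level t s \<Longrightarrow> \<not> 2 ^ Suc t dvd s"
proof
  assume s: "two_level t s" and dvd: "2 ^ Suc t dvd s"
  from dvd have "even s" by (metis dvd_power dvd_trans zero_less_Suc)
  with s obtain k where k: "odd k" "s = 2 ^ t * k" by (auto simp: two_level_def)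
  with dvd have "2 ^ t * 2 dvd 2 ^ t * k" by (simp add: mult.commute)
  then have "even k" by (subst (asm) dvd_mult_cancel_left) simp
  with k show False by simp
qed

section \<open>Zeros of the mask polynomial, size of the spectrum\<close>

context spectral_four
begin

text \<open>Pairings through one of the odd digits give valuation t, the pairing through
  \<open>2 ^ t * b\<close> gives valuation 0. The unit \<open>\<kappa>\<close> has the common
  denominator of the three kinds of zeros.\<close>

lemma mask_zero_two_level:
  assumes form: "digit_form D c a b b' t"
  obtains \<kappa> where "\<kappa> \<noteq> 0"
    "\<And>w. mask_poly D p w = 0 \<Longrightarrow> \<exists>s. two_level t s \<and> w = \<kappa> * of_int s"
proof -
  have c: "c > 0" and odd: "odd a" "odd b" "odd b'" and t: "t \<ge> 1"
    and cD: "(\<lambda>d. c * d) ` D = real_of_int ` {0, a, 2 ^ t * b, a + 2 ^ t * b'}"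
    using form by (auto simp: digit_form_def)
  define e where "e = a + 2 ^ t * b'"
  have e: "odd e" using odd t by (simp add: e_def)
  have "D = (\<lambda>d. d / c) ` (\<lambda>d. c * d) ` D" using c by (simp add: image_image)
  then have D: "D = {0, a / c, (2 ^ t * b) / c, e / c}"
    unfolding cD by (simp add: e_def)
  have distinct: "distinct [0, a / c, (2 ^ t * b) / c, e / c]"
    using card_D card_distinct[of "[0, a / c, (2 ^ t * b) / c, e / c]"] unfolding D by simp
  define \<kappa> where "\<kappa> = c / (2 ^ Suc t * of_int (a * b * e))"
  have ne: "a \<noteq> 0" "b \<noteq> 0" "e \<noteq> 0" using odd e by auto
  show ?thesis
  proof
    show "\<kappa> \<noteq> 0" using c ne by (simp add: \<kappa>_def)
  next
    fix w assume "mask_poly D p w = 0"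
    from mask_zero_opp[OF D distinct weights this]
    consider k :: int where "odd k" "2 * w * (a / c) = of_int k"
      | k :: int where "odd k" "2 * w * ((2 ^ t * b) / c) = of_int k"
      | k :: int where "odd k" "2 * w * (e / c) = of_int k"
      by (auto simp: opp_def)
    then show "\<exists>s. two_level t s \<and> w = \<kappa> * of_int s"
    proof cases
      case 1
      then have "w = \<kappa> * of_int (2 ^ t * (k * b * e))"
        using c ne by (simp add: \<kappa>_def field_simps)
      moreover have "two_level t (2 ^ t * (k * b * e))"
        using 1 odd e unfolding two_level_def by (intro disjI2 exI[of _ "k * b * e"]) simp
      ultimately show ?thesis by blast
    next
      case 2
      then have "w = \<kappa> * of_int (k * a * e)"
        using c ne by (simp add: \<kappa>_def field_simps)
      moreover have "two_level t (k * a * e)" using 2 odd e by (simp add: two_level_def)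
      ultimately show ?thesis by blast
    next
      case 3
      then have "w = \<kappa> * of_int (2 ^ t * (k * a * b))"
        using c ne by (simp add: \<kappa>_def field_simps)
      moreover have "two_level t (2 ^ t * (k * a * b))"
        using 3 odd unfolding two_level_def by (intro disjI2 exI[of _ "k * a * b"]) simp
      ultimately show ?thesis by blast
    qed
  qed
qed

text \<open>The mask polynomial is 1 at 0, so giving every frequency its own colour is admissible
  for all levels; a finite spectrum would have at least \<open>4 ^ n\<close> elements for every
  n.\<close>

lemma infinite_spectrum: "infinite \<Lambda>"
proof
  assume fin: "finite \<Lambda>"
  have "mask_poly D p 0 = 1"
    using pv by (simp add: mask_poly_def probability_vector_def flip: of_real_sum)
  then have "4 ^ n \<le> card \<Lambda>" for n
    by (intro card_level_classes[where col = id]) (use fin in auto)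
  then have "4 ^ card \<Lambda> \<le> card \<Lambda>" .
  moreover have "card \<Lambda> < 2 ^ card \<Lambda>" by (rule less_exp)
  moreover have "(2::nat) ^ card \<Lambda> \<le> 4 ^ card \<Lambda>" by (rule power_mono) auto
  ultimately show False by linarith
qed

end

section \<open>The contraction ratio is rational with even denominator\<close>

locale spectral_four_levels = spectral_four +
  fixes t :: nat and \<kappa> :: real
  assumes t: "t \<ge> 1" and \<kappa>: "\<kappa> \<noteq> 0"
    and mask_zero: "\<And>w. mask_poly D p w = 0 \<Longrightarrow> \<exists>s. two_level t s \<and> w = \<kappa> * of_int s"
begin

text \<open>For irrational \<rho> the levels 1 and 2 are incommensurable and one colouring of the
  integers serves both: four colours where sixteen are needed.\<close>

lemma ratio_rational: "\<rho> \<in> \<rat>"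
proof (rule ccontr)
  assume irr: "\<rho> \<notin> \<rat>"
  \<comment> \<open>The first bit detects odd shifts, the second one shifts by odd multiples of
    \<open>2 ^ t\<close>.\<close>
  define c where "c i = i mod 2 + 2 * (i div 2 ^ t mod 2)" for i :: int
  have enc: "x mod 2 = x' mod 2 \<and> y mod 2 = y' mod 2"
    if "x mod 2 + 2 * (y mod 2) = x' mod 2 + 2 * (y' mod 2)" for x y x' y' :: int
    using that by presburger
  have par: "(x + k) mod 2 \<noteq> x mod 2" if "odd k" for x k :: int
    using that by presburger
  have c_shift: "c (i + s) \<noteq> c i" if s: "two_level t s" for s i
  proof (cases "odd s")
    case True
    then have "(i + s) mod 2 \<noteq> i mod 2" by presburger
    then show ?thesis unfolding c_def using enc by blast
  next
    case False
    with s obtain k where k: "odd k" "s = 2 ^ t * k" by (auto simp: two_level_def)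
    then have "(i + s) div 2 ^ t = i div 2 ^ t + k" by simp
    then have "(i + s) div 2 ^ t mod 2 \<noteq> i div 2 ^ t mod 2" using par[OF k(1)] by simp
    then show ?thesis unfolding c_def using enc by blast
  qed
  have "(4::int) ^ 2 \<le> 4"
  proof (rule card_level_directions[where g = "\<kappa> / \<rho>" and h = "\<kappa> / \<rho> ^ 2" and c = c])
    fix i j :: int assume "of_int i * (\<kappa> / \<rho>) + of_int j * (\<kappa> / \<rho> ^ 2) = 0"
    then have "\<kappa> * (of_int i * \<rho> + of_int j) = 0" using \<rho> by (simp add: field_simps power2_eq_square)
    then have eq: "of_int i * \<rho> = of_int (- j)" using \<kappa> by simp
    have "i = 0"
    proof (rule ccontr)
      assume "i \<noteq> 0"
      then have "\<rho> = of_int (- j) / of_int i" using eq by (simp add: field_simps)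
      with irr show False by (metis Rats_divide Rats_of_int)
    qed
    with eq show "i = 0 \<and> j = 0" by simp
  next
    have "0 \<le> x mod 2 + 2 * (y mod 2) \<and> x mod 2 + 2 * (y mod 2) < 4" for x y :: int by presburger
    then show "0 \<le> c i" "c i < 4" for i unfolding c_def by blast+
  next
    fix j w assume j: "1 \<le> j" "j \<le> (2::nat)" and "mask_poly D p (\<rho> ^ j * w) = 0"
    from mask_zero[OF this(3)] obtain s where s: "two_level t s" "\<rho> ^ j * w = \<kappa> * of_int s" by blast
    then have "w = of_int s * (\<kappa> / \<rho> ^ j)" using \<rho> by (simp add: field_simps)
    moreover have "j = 1 \<or> j = 2" using j by auto
    ultimately show "\<exists>k::int. (\<forall>i. c (i + k) \<noteq> c i) \<and> (w = of_int k * (\<kappa> / \<rho>) \<or> w = of_int k * (\<kappa> / \<rho> ^ 2))"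
      using c_shift[OF s(1)] by (intro exI[of _ s]) auto
  qed
  then show False by simp
qed

end

locale spectral_four_rational = spectral_four_levels +
  fixes P Q :: nat
  assumes P0: "P > 0" and PQ: "P < Q" and coprime: "coprime P Q" and \<rho>_eq: "\<rho> = real P / real Q"
begin

lemma Q0: "Q > 0" using PQ by simp

lemma level_zero:
  assumes "mask_poly D p (\<rho> ^ j * w) = 0"
  obtains s where "two_level t s" "w * real P ^ j = \<kappa> * real Q ^ j * of_int s"
proof -
  from mask_zero[OF assms] obtain s where "two_level t s" "\<rho> ^ j * w = \<kappa> * of_int s" by blast
  with that[of s] Q0 show ?thesis by (simp add: \<rho>_eq power_divide field_simps)
qed

lemma spectrum_level:
  assumes "k \<in> \<Lambda>" "l \<in> \<Lambda>" "k \<noteq> l"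
  obtains j s where "1 \<le> j" "mask_poly D p (\<rho> ^ j * (k - l)) = 0" "two_level t s"
    "(k - l) * real P ^ j = \<kappa> * real Q ^ j * of_int s"
  using fourier_zero[OF orthogonal[OF assms]] level_zero by metis

text \<open>The quotient of consecutive levels is a quotient of odd numbers, so levels 1 and 2 share
  two generators, one for each valuation.\<close>

lemma not_both_odd: "\<not> (odd P \<and> odd Q)"
proof
  assume odd: "odd P \<and> odd Q"
  have "2 * 2 \<le> card {0, t}"
  proof (rule card_level_generators[where g = "\<lambda>e. \<kappa> * 2 ^ e / real P ^ 2"])
    fix j k l assume j: "1 \<le> j" "j \<le> (2::nat)" and zero: "mask_poly D p (\<rho> ^ j * (k - l)) = 0"
    from level_zero[OF zero] obtain s where s: "two_level t s"
      "(k - l) * real P ^ j = \<kappa> * real Q ^ j * of_int s" .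
    have "real P ^ 2 = real P ^ j * real P ^ (2 - j)" using j by (simp flip: power_add)
    then have eq: "k - l = \<kappa> * of_int (int Q ^ j * int P ^ (2 - j) * s) / real P ^ 2"
      using s(2) P0 by (simp add: field_simps)
    show "\<exists>e\<in>{0, t}. \<exists>m::int. odd m \<and> k - l = of_int m * (\<kappa> * 2 ^ e / real P ^ 2)"
    proof (cases "odd s")
      case True
      with odd eq show ?thesis
        by (intro bexI[of _ 0] exI[of _ "int Q ^ j * int P ^ (2 - j) * s"]) auto
    next
      case False
      with s(1) obtain w where "odd w" "s = 2 ^ t * w" by (auto simp: two_level_def)
      with odd eq show ?thesis
        by (intro bexI[of _ t] exI[of _ "int Q ^ j * int P ^ (2 - j) * w"]) auto
    qed
  qed (use \<kappa> P0 in auto)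
  moreover have "card {0, t} \<le> 2" by (simp add: card_insert_if)
  ultimately show False by simp
qed

text \<open>For even P and odd Q a high level means a very negative 2-adic valuation. Comparing the
  three differences of \<open>l0\<close>, \<open>l1\<close> and a further frequency bounds all
  levels in the spectrum, and finitely many generators cannot serve arbitrarily many levels.\<close>

lemma numerator_odd: "odd P"
proof
  assume P: "even P"
  have Q: "odd Q" using coprime_common_divisor[OF coprime P] by auto
  obtain l0 l1 where l01: "l0 \<in> \<Lambda>" "l1 \<in> \<Lambda>" "l0 \<noteq> l1"
  proof -
    obtain l0 where "l0 \<in> \<Lambda>" using infinite_imp_nonempty[OF infinite_spectrum] by blast
    moreover have "infinite (\<Lambda> - {l0})" using infinite_spectrum by simp
    then obtain l1 where "l1 \<in> \<Lambda> - {l0}" using infinite_imp_nonempty by blast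
    ultimately show ?thesis using that[of l0 l1] by auto
  qed
  define R where "R j w s \<longleftrightarrow> w * real P ^ j = \<kappa> * real Q ^ j * of_int s" for j and w :: real and s :: int
  have R_two_pow: False
    if "two_level t s" "2 ^ Suc t dvd (int Q ^ j * s)" for j s
  proof -
    have "coprime (2 ^ Suc t) (int Q ^ j)" using Q by (simp add: coprime_power_left_iff coprime_power_right_iff)
    with that two_level_not_dvd show False by (simp add: coprime_dvd_mult_right_iff)
  qed
  have P_pow: "2 ^ Suc t dvd (int P ^ n * i)" if "n \<ge> Suc t" for n i
  proof -
    have "(2::int) ^ Suc t dvd int P ^ Suc t" using P by (intro dvd_power_same) simp
    also have "\<dots> dvd int P ^ n" using that by (rule le_imp_power_dvd)
    finally show ?thesis by (rule dvd_mult2)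
  qed
  obtain j s where base: "two_level t s" "R j (l0 - l1) s"
    using spectrum_level[OF l01] unfolding R_def by blast
  have s0: "s \<noteq> 0" using base two_level_not_dvd[of t 0] by auto
  \<comment> \<open>The summand \<open>nat \<bar>s\<bar>\<close> is there because
    \<open>Q ^ n\<close> exceeds the absolute value of s for larger n and then cannot divide s; t is
    the tolerance of the 2-adic comparison.\<close>
  define B where "B = j + nat \<bar>s\<bar> + t"
  have real_int: "i = i'" if "\<kappa> * of_int i = \<kappa> * of_int i'" for i i' :: int
    using that \<kappa> by simp
  have bound: "k \<le> B" if lam: "two_level t u" "R k (l - l0) u" "two_level t u'" "R k' (l - l1) u'"
    for k k' u u' l
  proof -
    have "\<kappa> * of_int (int Q ^ k' * u' * int P ^ (k + j)) =
        \<kappa> * of_int (int Q ^ k * u * int P ^ (k' + j) + int Q ^ j * s * int P ^ (k + k'))"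
    proof -
      have "\<kappa> * of_int (int Q ^ k' * u' * int P ^ (k + j)) = ((l - l1) * real P ^ k') * real P ^ (k + j)"
        using lam(4) by (simp add: R_def)
      also have "\<dots> = ((l - l0) * real P ^ k) * real P ^ (k' + j) + ((l0 - l1) * real P ^ j) * real P ^ (k + k')"
        by (simp add: power_add algebra_simps)
      also have "\<dots> = \<kappa> * of_int (int Q ^ k * u * int P ^ (k' + j) + int Q ^ j * s * int P ^ (k + k'))"
        using lam(2) base(2) by (simp add: R_def algebra_simps)
      finally show ?thesis .
    qed
    then have eq: "int Q ^ k' * u' * int P ^ (k + j) =
        int Q ^ k * u * int P ^ (k' + j) + int Q ^ j * s * int P ^ (k + k')"
      by (rule real_int)
    \<comment> \<open>Otherwise \<open>l - l0\<close> would be the only one of lowest 2-adic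
      valuation among three numbers in a linear relation.\<close>
    have A: "k \<le> k' + t \<or> k \<le> j + t"
    proof (rule ccontr)
      assume "\<not> (k \<le> k' + t \<or> k \<le> j + t)"
      then have k: "k - k' \<ge> Suc t" "k - j \<ge> Suc t" "k \<ge> k'" "k \<ge> j" by auto
      then have pw: "int P ^ (k + j) = int P ^ (k' + j) * int P ^ (k - k')"
        "int P ^ (k + k') = int P ^ (k' + j) * int P ^ (k - j)"
        by (simp_all add: add.commute flip: power_add)
      have "int P ^ (k' + j) * (int Q ^ k * u) =
          int P ^ (k' + j) * (int P ^ (k - k') * (int Q ^ k' * u') - int P ^ (k - j) * (int Q ^ j * s))"
        using eq unfolding pw by (simp add: algebra_simps)
      then have "int Q ^ k * u = int P ^ (k - k') * (int Q ^ k' * u') - int P ^ (k - j) * (int Q ^ j * s)"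
        using P0 by simp
      then have "2 ^ Suc t dvd int Q ^ k * u"
        using P_pow[OF k(1)] P_pow[OF k(2)] by (metis dvd_diff)
      with R_two_pow lam(1) show False by blast
    qed
    \<comment> \<open>If both levels were high, the relation would make a high power of Q divide
      s.\<close>
    have Bm: "min k k' \<le> j + nat \<bar>s\<bar>"
    proof (rule ccontr)
      define n where "n = min k k' - j"
      assume "\<not> min k k' \<le> j + nat \<bar>s\<bar>"
      then have n: "n > nat \<bar>s\<bar>" "k = (j + n) + (k - (j + n))" "k' = (j + n) + (k' - (j + n))"
        by (auto simp: n_def)
      have "int Q ^ j * (int Q ^ n * (int Q ^ (k' - (j + n)) * u' * int P ^ (k + j)
          - int Q ^ (k - (j + n)) * u * int P ^ (k' + j))) = int Q ^ j * (s * int P ^ (k + k'))"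
      proof -
        have "int Q ^ k' = int Q ^ j * int Q ^ n * int Q ^ (k' - (j + n))"
          "int Q ^ k = int Q ^ j * int Q ^ n * int Q ^ (k - (j + n))"
          using n(2,3) by (metis power_add)+
        with eq show ?thesis by (simp add: algebra_simps)
      qed
      then have "int Q ^ n dvd s * int P ^ (k + k')"
        using Q0 by (metis dvd_triv_left mult_cancel_left of_nat_0_less_iff order_less_irrefl zero_less_power)
      moreover have "coprime (int Q ^ n) (int P ^ (k + k'))"
        using coprime by (simp add: coprime_power_left_iff coprime_power_right_iff coprime_commute)
      ultimately have "int Q ^ n dvd s" by (simp add: coprime_dvd_mult_left_iff)
      then have "int Q ^ n \<le> \<bar>s\<bar>" using dvd_imp_le_int[OF s0] by fastforce
      moreover have "int n < 2 ^ n" using less_exp[of n] by (metis of_nat_less_iff of_nat_numeral of_nat_power)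
      moreover have "2 ^ n \<le> int Q ^ n" using P0 PQ by (intro power_mono) auto
      ultimately show False using n(1) by linarith
    qed
    show ?thesis using A Bm by (auto simp: B_def min_def split: if_splits)
  qed
  have rep: "\<exists>k u. k \<le> B \<and> R k (l - l0) u" if l: "l \<in> \<Lambda>" for l
  proof -
    consider "l = l0" | "l = l1" | "l \<noteq> l0" "l \<noteq> l1" by blast
    then show ?thesis
    proof cases
      case 1
      then show ?thesis by (intro exI[of _ 0]) (simp add: R_def)
    next
      case 2
      then show ?thesis using base(2)
        by (intro exI[of _ j] exI[of _ "- s"]) (simp add: R_def B_def algebra_simps)
    next
      case 3
      obtain k u where u: "two_level t u" "R k (l - l0) u"
        using spectrum_level[OF l l01(1) 3(1)] unfolding R_def by blast
      obtain k' u' where u': "two_level t u'" "R k' (l - l1) u'"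
        using spectrum_level[OF l l01(2) 3(2)] unfolding R_def by blast
      from bound[OF u u'] u show ?thesis by blast
    qed
  qed
  \<comment> \<open>Relative to \<open>l0\<close> all denominators divide \<open>P ^ B\<close>, so
    no difference can have the 2-adic valuation of a level above B + t.\<close>
  have level_le: "n \<le> B + t" if kl: "k \<in> \<Lambda>" "l \<in> \<Lambda>" and u: "two_level t u" "R n (k - l) u" for k l n u
  proof (rule ccontr)
    assume "\<not> n \<le> B + t"
    then have n: "n \<ge> B + Suc t" by simp
    obtain i v where iv: "i \<le> B" "R i (k - l0) v" using rep[OF kl(1)] by blast
    obtain i' v' where iv': "i' \<le> B" "R i' (l - l0) v'" using rep[OF kl(2)] by blast
    have pw: "real P ^ n = real P ^ i * real P ^ (n - i)" "real P ^ n = real P ^ i' * real P ^ (n - i')"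
      using iv iv' n by (simp_all flip: power_add)
    have "\<kappa> * of_int (int Q ^ n * u) = (k - l) * real P ^ n" using u(2) by (simp add: R_def)
    also have "\<dots> = (k - l0) * real P ^ n - (l - l0) * real P ^ n" by (simp add: algebra_simps)
    also have "(k - l0) * real P ^ n = ((k - l0) * real P ^ i) * real P ^ (n - i)" by (simp add: pw(1))
    also have "(l - l0) * real P ^ n = ((l - l0) * real P ^ i') * real P ^ (n - i')" by (simp add: pw(2))
    also have "((k - l0) * real P ^ i) * real P ^ (n - i) - ((l - l0) * real P ^ i') * real P ^ (n - i') =
        \<kappa> * of_int (int P ^ (n - i) * (int Q ^ i * v) - int P ^ (n - i') * (int Q ^ i' * v'))"
      using iv iv' by (simp add: R_def algebra_simps)
    finally have "int Q ^ n * u = int P ^ (n - i) * (int Q ^ i * v) - int P ^ (n - i') * (int Q ^ i' * v')"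
      by (rule real_int)
    moreover have "n - i \<ge> Suc t" "n - i' \<ge> Suc t" using n iv iv' by auto
    ultimately have "2 ^ Suc t dvd int Q ^ n * u"
      using P_pow by (metis dvd_diff)
    with R_two_pow u(1) show False by blast
  qed
  have "2 * (B + t + 1) \<le> card ({1..B + t} \<times> {0, t})"
  proof (rule card_level_generators[where g = "\<lambda>(i, e). \<kappa> * (real Q / real P) ^ i * 2 ^ e"])
    fix i k l assume i: "1 \<le> i" and kl: "k \<in> \<Lambda>" "l \<in> \<Lambda>" and zero: "mask_poly D p (\<rho> ^ i * (k - l)) = 0"
    from level_zero[OF zero] obtain u where u: "two_level t u" "R i (k - l) u" unfolding R_def .
    have "i \<le> B + t" by (rule level_le[OF kl u])
    have eq: "k - l = \<kappa> * (real Q / real P) ^ i * of_int u"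
      using u(2) P0 by (simp add: R_def power_divide field_simps)
    show "\<exists>ie\<in>{1..B + t} \<times> {0, t}. \<exists>m::int. odd m \<and>
        k - l = of_int m * (case ie of (i, e) \<Rightarrow> \<kappa> * (real Q / real P) ^ i * 2 ^ e)"
    proof (cases "odd u")
      case True
      then show ?thesis using eq i \<open>i \<le> B + t\<close>
        by (intro bexI[of _ "(i, 0)"] exI[of _ u]) auto
    next
      case False
      with u(1) obtain w where "odd w" "u = 2 ^ t * w" by (auto simp: two_level_def)
      then show ?thesis using eq i \<open>i \<le> B + t\<close>
        by (intro bexI[of _ "(i, t)"] exI[of _ w]) auto
    qed
  qed (use \<kappa> P0 Q0 in auto)
  also have "card ({1..B + t} \<times> {0, t}) \<le> (B + t) * 2"
    by (simp add: card_cartesian_product card_insert_if)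
  finally show False by simp
qed

lemma denominator_even: "even Q"
  using not_both_odd numerator_odd by blast

text \<open>Levels 1 to n have the valuations \<open>\<beta> * j\<close> and
  \<open>\<beta> * j + t\<close>. For \<open>t = \<beta> * r\<close> these are at most n + r values,
  and n = r + 1 is the least n for which this is below 2 n.\<close>

lemma exponent_not_dvd:
  assumes Q: "Q = 2 ^ \<beta> * m" "odd m"
  shows "\<not> \<beta> dvd t"
proof
  assume "\<beta> dvd t"
  then obtain r where r: "t = \<beta> * r" by blast
  define n where "n = r + 1"
  have "2 * n \<le> card {1..n + r}"
  proof (rule card_level_generators[where g = "\<lambda>i. \<kappa> * 2 ^ (\<beta> * i) / real P ^ n"])
    fix j k l assume j: "1 \<le> j" "j \<le> n" and zero: "mask_poly D p (\<rho> ^ j * (k - l)) = 0"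
    from level_zero[OF zero] obtain s where s: "two_level t s"
      "(k - l) * real P ^ j = \<kappa> * real Q ^ j * of_int s" .
    have "real P ^ n = real P ^ j * real P ^ (n - j)" using j by (simp flip: power_add)
    moreover have "real Q ^ j = 2 ^ (\<beta> * j) * real m ^ j" by (simp add: Q power_mult_distrib power_mult)
    ultimately have eq: "k - l = of_int (int m ^ j * int P ^ (n - j) * s) * (\<kappa> * 2 ^ (\<beta> * j) / real P ^ n)"
      using s(2) P0 by (simp add: field_simps)
    show "\<exists>i\<in>{1..n + r}. \<exists>i'::int. odd i' \<and> k - l = of_int i' * (\<kappa> * 2 ^ (\<beta> * i) / real P ^ n)"
    proof (cases "odd s")
      case True
      with Q numerator_odd eq j show ?thesis
        by (intro bexI[of _ j] exI[of _ "int m ^ j * int P ^ (n - j) * s"]) auto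
    next
      case False
      with s(1) obtain w where w: "odd w" "s = 2 ^ (\<beta> * r) * w" by (auto simp: two_level_def r)
      then have "k - l = of_int (int m ^ j * int P ^ (n - j) * w) * (\<kappa> * 2 ^ (\<beta> * (j + r)) / real P ^ n)"
        unfolding eq by (simp add: power_add distrib_left)
      with Q numerator_odd w j show ?thesis
        by (intro bexI[of _ "j + r"] exI[of _ "int m ^ j * int P ^ (n - j) * w"]) auto
    qed
  qed (use \<kappa> P0 in auto)
  then show False by (simp add: n_def)
qed

end

section \<open>The contraction ratio is the reciprocal of an integer\<close>

subsection \<open>Gaps of the spectrum\<close>

context spectral_four_rational
begin

definition level :: "real \<Rightarrow> nat \<Rightarrow> bool" where
  "level x j \<longleftrightarrow> (\<exists>s. two_level t s \<and> x * real P ^ j = \<kappa> * real Q ^ j * of_int s)"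

text \<open>The 2-adic valuation of x / \<kappa>, as a relation. Natural numbers suffice because Q
  is even and P is odd, so differences of the spectrum have nonnegative valuation.\<close>

definition val :: "nat \<Rightarrow> real \<Rightarrow> bool" where
  "val w x \<longleftrightarrow> (\<exists>a b :: int. odd a \<and> odd b \<and> x * of_int b = \<kappa> * 2 ^ w * of_int a)"

lemma val_unique:
  assumes "val w x" "val w' x"
  shows "w = w'"
proof -
  from assms obtain a b a' b' :: int where o: "odd a" "odd b" "odd a'" "odd b'"
    and e: "x * of_int b = \<kappa> * 2 ^ w * of_int a" "x * of_int b' = \<kappa> * 2 ^ w' * of_int a'"
    unfolding val_def by blast
  have "\<kappa> * of_int (2 ^ w * (a * b')) = (x * of_int b) * of_int b'" by (simp add: e)
  also have "\<dots> = (x * of_int b') * of_int b" by simp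
  also have "\<dots> = \<kappa> * of_int (2 ^ w' * (a' * b))" by (simp only: e) simp
  finally have "2 ^ w * (a * b') = 2 ^ w' * (a' * b)"
    using \<kappa> by (simp only: mult_cancel_left of_int_eq_iff) simp
  then show ?thesis by (rule pow2_odd_unique) (use o in auto)
qed

lemma val_minus: "val w x \<Longrightarrow> val w (- x)"
  unfolding val_def by (metis even_minus minus_mult_left minus_mult_right of_int_minus)

lemma val_add_less:
  assumes "val w x" "val w' y" "w < w'"
  shows "val w (x + y)"
proof -
  from assms obtain a b a' b' :: int where o: "odd a" "odd b" "odd a'" "odd b'"
    and e: "x * of_int b = \<kappa> * 2 ^ w * of_int a" "y * of_int b' = \<kappa> * 2 ^ w' * of_int a'"
    unfolding val_def by blast
  have pw: "(2::real) ^ w' = 2 ^ w * 2 ^ (w' - w)" using assms(3) by (simp flip: power_add)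
  have "(x + y) * of_int (b * b') = (x * of_int b) * of_int b' + (y * of_int b') * of_int b"
    by (simp add: algebra_simps)
  also have "\<dots> = \<kappa> * 2 ^ w * of_int (a * b' + 2 ^ (w' - w) * (a' * b))"
    unfolding e pw by (simp add: algebra_simps)
  finally have "(x + y) * of_int (b * b') = \<kappa> * 2 ^ w * of_int (a * b' + 2 ^ (w' - w) * (a' * b))" .
  moreover have "odd (a * b' + 2 ^ (w' - w) * (a' * b))" using o assms(3) by simp
  moreover have "odd (b * b')" using o by simp
  ultimately show ?thesis unfolding val_def by blast
qed

lemma val_nonzero: "val w x \<Longrightarrow> x \<noteq> 0"
  using \<kappa> by (auto simp: val_def)

lemma spectrum_level':
  assumes "k \<in> \<Lambda>" "l \<in> \<Lambda>" "k \<noteq> l"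
  obtains j where "1 \<le> j" "level (k - l) j" "mask_poly D p (\<rho> ^ j * (k - l)) = 0"
  using spectrum_level[OF assms] unfolding level_def by metis

lemma level_val:
  assumes "level x j" and Q: "Q = 2 ^ \<beta> * m" "odd m"
  shows "\<exists>e\<in>{0, t}. val (\<beta> * j + e) x"
proof -
  from assms(1) obtain s where s: "two_level t s" "x * real P ^ j = \<kappa> * real Q ^ j * of_int s"
    by (auto simp: level_def)
  have Qj: "real Q ^ j = 2 ^ (\<beta> * j) * real m ^ j" by (simp add: Q power_mult_distrib power_mult)
  have P: "x * of_int (int P ^ j) = x * real P ^ j" by simp
  show ?thesis
  proof (cases "odd s")
    case True
    have "x * of_int (int P ^ j) = \<kappa> * 2 ^ (\<beta> * j + 0) * of_int (int m ^ j * s)"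
      unfolding P s(2) Qj by simp
    then have "val (\<beta> * j + 0) x"
      unfolding val_def using True Q numerator_odd by (metis even_mult_iff even_of_nat even_power)
    then show ?thesis by blast
  next
    case False
    with s(1) obtain w where w: "odd w" "s = 2 ^ t * w" by (auto simp: two_level_def)
    have "x * of_int (int P ^ j) = \<kappa> * 2 ^ (\<beta> * j + t) * of_int (int m ^ j * w)"
      unfolding P s(2) Qj w(2) by (simp add: power_add)
    then have "val (\<beta> * j + t) x"
      unfolding val_def using w Q numerator_odd by (metis even_mult_iff even_of_nat even_power)
    then show ?thesis by blast
  qed
qed

text \<open>As \<open>\<beta>\<close> does not divide t, the valuations \<open>\<beta> * j\<close>
  and \<open>\<beta> * j + t\<close> of different levels never coincide.\<close>

lemma level_unique:
  assumes "level x j" "level y j'" "val w x" "val w y" and Q: "Q = 2 ^ \<beta> * m" "odd m"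
  shows "j = j'"
proof -
  obtain e e' where e: "e \<in> {0, t}" "e' \<in> {0, t}" "\<beta> * j + e = w" "\<beta> * j' + e' = w"
    using level_val[OF assms(1) Q] level_val[OF assms(2) Q] val_unique assms(3,4) by metis
  have "\<beta> * j = \<beta> * j'"
  proof (rule ccontr)
    assume ne: "\<beta> * j \<noteq> \<beta> * j'"
    then have "\<beta> * j = \<beta> * j' + t \<or> \<beta> * j' = \<beta> * j + t" using e by auto
    then have "\<beta> dvd t" by (metis dvd_add_right_iff dvd_triv_left)
    with exponent_not_dvd[OF Q] show False by simp
  qed
  moreover have "\<beta> \<noteq> 0" using denominator_even Q by (metis mult_1 power_0)
  ultimately show ?thesis by simp
qed

text \<open>
  Differences of the smallest 2-adic valuation all have the same level \<open>j0\<close>, and every other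
  difference is a difference of two of these, so its denominator divides \<open>P ^ j0\<close>.
\<close>
lemma spectrum_gap:
  "\<exists>\<gamma>>0. \<forall>k\<in>\<Lambda>. \<forall>l\<in>\<Lambda>. \<forall>j. k \<noteq> l \<longrightarrow> level (k - l) j \<longrightarrow> \<gamma> * real Q ^ j \<le> \<bar>k - l\<bar>"
proof -
  obtain \<beta> m where Q: "Q = 2 ^ \<beta> * m" "odd m"
  proof -
    obtain \<beta> and a :: int where a: "odd a" "int Q = 2 ^ \<beta> * a"
      using pow2_odd_decomposition[of "int Q"] Q0 by auto
    have "a > 0" using a Q0 by (metis of_nat_0_less_iff zero_less_mult_pos zero_less_numeral zero_less_power)
    then have "int Q = int (2 ^ \<beta> * nat a)" using a by simp
    then have "Q = 2 ^ \<beta> * nat a" by (simp only: of_nat_eq_iff)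
    moreover have "odd (nat a)" using a(1) \<open>a > 0\<close> by (simp add: even_nat_iff)
    ultimately show ?thesis using that by blast
  qed
  define V where "V w \<longleftrightarrow> (\<exists>k\<in>\<Lambda>. \<exists>l\<in>\<Lambda>. k \<noteq> l \<and> val w (k - l))" for w
  define w0 where "w0 = (LEAST w. V w)"
  obtain k0 where "k0 \<in> \<Lambda>" using infinite_imp_nonempty[OF infinite_spectrum] by blast
  moreover have "infinite (\<Lambda> - {k0})" using infinite_spectrum by simp
  then obtain l0 where "l0 \<in> \<Lambda> - {k0}" using infinite_imp_nonempty by blast
  ultimately have kl0: "k0 \<in> \<Lambda>" "l0 \<in> \<Lambda>" "k0 \<noteq> l0" by auto
  have val_ex: "\<exists>w. val w (k - l)" if "k \<in> \<Lambda>" "l \<in> \<Lambda>" "k \<noteq> l" for k l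
    using spectrum_level'[OF that] level_val[OF _ Q] by metis
  then have "\<exists>w. V w" using kl0 unfolding V_def by blast
  then have "V w0" unfolding w0_def by (rule LeastI_ex)
  then obtain ka la where kla: "ka \<in> \<Lambda>" "la \<in> \<Lambda>" "ka \<noteq> la" "val w0 (ka - la)" unfolding V_def by blast
  have w0_le: "w0 \<le> w" if "k \<in> \<Lambda>" "l \<in> \<Lambda>" "val w (k - l)" for k l w
  proof -
    have "k \<noteq> l" using val_nonzero[OF that(3)] by auto
    then show ?thesis unfolding w0_def by (intro Least_le) (use that in \<open>auto simp: V_def\<close>)
  qed
  obtain j0 where j0: "level (ka - la) j0" using spectrum_level'[OF kla(1-3)] by blast
  have level_w0: "level (k - l) j0" if kl: "k \<in> \<Lambda>" "l \<in> \<Lambda>" and v: "val w0 (k - l)" for k l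
  proof -
    have "k \<noteq> l" using val_nonzero[OF v] by auto
    then obtain j where "level (k - l) j" using spectrum_level'[OF kl] by blast
    moreover from level_unique[OF this j0 v kla(4) Q] have "j = j0" .
    ultimately show ?thesis by simp
  qed
  have denom: "\<exists>z::int. (k - l) * real P ^ j0 = \<kappa> * real Q ^ j * of_int z"
    if kl: "k \<in> \<Lambda>" "l \<in> \<Lambda>" "k \<noteq> l" and j: "level (k - l) j" for k l j
  proof -
    obtain s where s: "(k - l) * real P ^ j = \<kappa> * real Q ^ j * of_int s"
      using j by (auto simp: level_def)
    show ?thesis
    proof (cases "j \<le> j0")
      case True
      then have "real P ^ j0 = real P ^ j * real P ^ (j0 - j)" by (simp flip: power_add)
      then have "(k - l) * real P ^ j0 = \<kappa> * real Q ^ j * of_int (s * int P ^ (j0 - j))"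
        using s by simp
      then show ?thesis by blast
    next
      case False
      obtain w where w: "val w (k - l)" using val_ex[OF kl] by blast
      have "w \<noteq> w0" using level_unique[OF j j0 w _ Q] kla(4) False by auto
      with w0_le[OF kl(1,2) w] have w_less: "w0 < w" by simp
      obtain x where x: "x \<in> \<Lambda>" "val w0 (k - x)"
      proof (cases "k = ka")
        case True
        with kla that show ?thesis by blast
      next
        case k: False
        obtain w1 where w1: "val w1 (k - ka)" using val_ex[OF kl(1) kla(1) k] by blast
        show ?thesis
        proof (cases "w1 = w0")
          case True
          with w1 kla that show ?thesis by blast
        next
          case False
          with w0_le[OF kl(1) kla(1) w1] have "w0 < w1" by simp
          from val_add_less[OF kla(4) w1 this] have "val w0 (k - la)" by simp
          with kla that show ?thesis by blast
        qed
      qed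
      have "val w0 (l - x)"
        using val_add_less[OF x(2) val_minus[OF w] w_less] by simp
      then have "level (l - x) j0" "level (k - x) j0" using level_w0 kl x by auto
      then obtain s1 s2 :: int where s12: "(l - x) * real P ^ j0 = \<kappa> * real Q ^ j0 * of_int s1"
        "(k - x) * real P ^ j0 = \<kappa> * real Q ^ j0 * of_int s2"
        by (auto simp: level_def)
      then have diff: "(k - l) * real P ^ j0 = \<kappa> * real Q ^ j0 * of_int (s2 - s1)"
        by (simp add: algebra_simps)
      have pw: "real P ^ j = real P ^ j0 * real P ^ (j - j0)" "real Q ^ j = real Q ^ j0 * real Q ^ (j - j0)"
        using False by (simp_all flip: power_add)
      \<comment> \<open>Two expressions of k - l are compared. By coprimality
        \<open>Q ^ (j - j0)\<close> divides \<open>s2 - s1\<close>, which restores the full power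
        \<open>Q ^ j\<close> over the small denominator.\<close>
      have "\<kappa> * real Q ^ j0 * of_int ((s2 - s1) * int P ^ (j - j0)) =
          ((k - l) * real P ^ j0) * real P ^ (j - j0)" by (simp add: diff)
      also have "\<dots> = \<kappa> * real Q ^ j0 * of_int (int Q ^ (j - j0) * s)"
        using s by (simp add: pw)
      finally have "(s2 - s1) * int P ^ (j - j0) = int Q ^ (j - j0) * s"
        using \<kappa> Q0 by (simp only: mult_cancel_left of_int_eq_iff) simp
      then have "int Q ^ (j - j0) dvd (s2 - s1) * int P ^ (j - j0)" by simp
      moreover have "coprime (int Q ^ (j - j0)) (int P ^ (j - j0))"
        using coprime by (simp add: coprime_power_left_iff coprime_power_right_iff coprime_commute)
      ultimately obtain z where "s2 - s1 = int Q ^ (j - j0) * z"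
        by (auto simp: coprime_dvd_mult_left_iff elim!: dvdE)
      then have "(k - l) * real P ^ j0 = \<kappa> * real Q ^ j * of_int z"
        using diff by (simp add: pw)
      then show ?thesis by blast
    qed
  qed
  show ?thesis
  proof (intro exI[of _ "\<bar>\<kappa>\<bar> / real P ^ j0"] conjI ballI allI impI)
    show "0 < \<bar>\<kappa>\<bar> / real P ^ j0" using \<kappa> P0 by simp
  next
    fix k l j assume kl: "k \<in> \<Lambda>" "l \<in> \<Lambda>" "k \<noteq> l" "level (k - l) j"
    obtain z :: int where z: "(k - l) * real P ^ j0 = \<kappa> * real Q ^ j * of_int z"
      using denom[OF kl] by blast
    have "z \<noteq> 0" using z kl P0 by auto
    then have "1 \<le> \<bar>real_of_int z\<bar>" by linarith
    then have "\<bar>\<kappa>\<bar> * real Q ^ j * 1 \<le> \<bar>\<kappa>\<bar> * real Q ^ j * \<bar>of_int z\<bar>"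
      by (intro mult_left_mono) auto
    also have "\<dots> = \<bar>(k - l) * real P ^ j0\<bar>" unfolding z by (simp add: abs_mult)
    also have "\<dots> = \<bar>k - l\<bar> * real P ^ j0" by (simp add: abs_mult)
    finally show "\<bar>\<kappa>\<bar> / real P ^ j0 * real Q ^ j \<le> \<bar>k - l\<bar>"
      using P0 by (simp add: field_simps)
  qed
qed

end

subsection \<open>Decay of the Fourier transform\<close>

lemma norm_one_plus_exponential: "(cmod (1 + exponential l x))\<^sup>2 = 2 + 2 * cos (2 * pi * l * x)"
proof -
  have "(cmod (1 + exponential l x))\<^sup>2 = (1 + cos (2 * pi * l * x))\<^sup>2 + (sin (2 * pi * l * x))\<^sup>2"
    by (simp add: cmod_power2 exponential_cis)
  also have "\<dots> = 1 + 2 * cos (2 * pi * l * x) + ((sin (2 * pi * l * x))\<^sup>2 + (cos (2 * pi * l * x))\<^sup>2)"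
    by (simp add: power2_eq_square algebra_simps)
  finally show ?thesis by simp
qed

lemma cos_le_if_far_from_int:
  assumes "0 \<le> \<eta>" and far: "\<And>k::int. \<eta> \<le> \<bar>y - of_int k\<bar>"
  shows "cos (2 * pi * y) \<le> cos (2 * pi * \<eta>)"
proof -
  define e where "e = \<bar>y - of_int (round y)\<bar>"
  have e: "\<eta> \<le> e" "e \<le> 1 / 2" unfolding e_def using far of_int_round_abs_le[of y]
    by (auto simp: abs_minus_commute)
  have "cos (2 * pi * y) = cos (2 * pi * (y - of_int (round y)) + 2 * pi * of_int (round y))"
    by (simp add: algebra_simps)
  also have "\<dots> = cos (2 * pi * (y - of_int (round y)))"
    by (simp add: cos_add sin_int_2pin cos_int_2pin)
  also have "\<dots> = cos (\<bar>2 * pi * (y - of_int (round y))\<bar>)" by (simp only: cos_abs_real)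
  also have "\<dots> = cos (2 * pi * e)" by (simp add: e_def abs_mult)
  also have "\<dots> \<le> cos (2 * pi * \<eta>)"
    using e assms(1) by (intro cos_monotone_0_pi_le) auto
  finally show ?thesis .
qed

lemma (in self_similar) norm_fourier_le_factor:
  assumes "1 \<le> L"
  shows "cmod (fourier \<mu> x) \<le> cmod (mask_poly D p (\<rho> ^ L * x)) * cmod (fourier \<mu> (\<rho> ^ L * x))"
proof -
  have "cmod (\<Prod>j=1..L - 1. mask_poly D p (\<rho> ^ j * x)) \<le> 1"
    unfolding prod_norm[symmetric] by (intro prod_le_1) (auto intro: norm_mask_le_1 pv)
  moreover have "(\<Prod>j=1..L. mask_poly D p (\<rho> ^ j * x)) =
      (\<Prod>j=1..L - 1. mask_poly D p (\<rho> ^ j * x)) * mask_poly D p (\<rho> ^ L * x)"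
    using assms by (cases L) simp_all
  ultimately show ?thesis
    by (subst fourier_prod[of _ L]) (simp add: norm_mult mult_right_mono mult_left_le_one_le)
qed

text \<open>
  If \<open>y_j = (P/Q)^j y\<close> stays close to integers \<open>k_j\<close>, then \<open>Q k_{j+1} = P k_j\<close>, so that a high
  power of \<open>Q\<close> divides \<open>k_1\<close>; such a run is short compared to \<open>log y\<close>.
\<close>
lemma ex_far_iterate:
  fixes P Q :: nat and y Z :: real
  defines "\<rho> \<equiv> real P / real Q" and "C \<equiv> 2 * real Q ^ 2" and "\<eta> \<equiv> 1 / (2 * (real P + real Q))"
  assumes PQ: "2 \<le> P" "P < Q" "coprime P Q"
    and Z: "C \<le> Z" and y: "Z * (C * Z) ^ Q \<le> \<bar>y\<bar>"
  obtains L where "1 \<le> L" "\<And>k::int. \<eta> \<le> \<bar>\<rho> ^ L * y - of_int k\<bar>" "Z \<le> \<rho> ^ L * \<bar>y\<bar>"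
proof -
  have C: "C \<ge> 2" "C \<ge> Q"
  proof -
    have "1 * real Q \<le> 2 * real Q * real Q" using PQ by (intro mult_right_mono) auto
    then show "C \<ge> Q" by (simp add: C_def power2_eq_square)
    then show "C \<ge> 2" using PQ by simp
  qed
  have Z1: "Z \<ge> 1" "Z > 0" using C Z by auto
  have y_ge: "\<bar>y\<bar> \<ge> C"
  proof -
    have "1 \<le> (C * Z) ^ Q"
      using C Z1 mult_mono[of 1 C 1 Z] by (intro one_le_power) auto
    then have "Z * 1 \<le> Z * (C * Z) ^ Q" using Z1 by (intro mult_left_mono) auto
    with y Z show ?thesis by simp
  qed
  define near where "near j \<longleftrightarrow> (\<exists>k::int. \<bar>\<rho> ^ j * y - of_int k\<bar> < \<eta>)" for j
  \<comment> \<open>Errors below \<open>\<eta>\<close> in two successive iterates change P k_j - Q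
    k_{j+1} by less than 1, so this integer is 0.\<close>
  have \<eta>: "\<eta> > 0" "\<eta> * (real P + real Q) < 1" "\<eta> < 1" using PQ by (auto simp: \<eta>_def divide_simps)
  have \<rho>: "0 < \<rho>" "\<rho> < 1" using PQ by (auto simp: \<rho>_def)
  have run: "real Q ^ n \<le> 2 * \<bar>y\<bar>" if nr: "\<And>j. 1 \<le> j \<Longrightarrow> j \<le> Suc n \<Longrightarrow> near j" for n
  proof -
    obtain k where k: "\<And>j. 1 \<le> j \<Longrightarrow> j \<le> Suc n \<Longrightarrow> \<bar>\<rho> ^ j * y - of_int (k j)\<bar> < \<eta>"
      using nr unfolding near_def by metis
    have step: "int Q * k (Suc j) = int P * k j" if j: "1 \<le> j" "j \<le> n" for j
    proof -
      define a where "a = \<rho> ^ j * y - of_int (k j)"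
      define b where "b = \<rho> ^ Suc j * y - of_int (k (Suc j))"
      have ab: "\<bar>a\<bar> < \<eta>" "\<bar>b\<bar> < \<eta>" unfolding a_def b_def using k[of j] k[of "Suc j"] j by auto
      have Q\<rho>: "real Q * \<rho> = real P" using PQ by (simp add: \<rho>_def)
      have "real Q * (\<rho> ^ Suc j * y) = (real Q * \<rho>) * (\<rho> ^ j * y)" by (simp only: power_Suc mult.assoc)
      also have "\<dots> = real P * (\<rho> ^ j * y)" by (simp only: Q\<rho>)
      finally have "real Q * (\<rho> ^ Suc j * y) = real P * (\<rho> ^ j * y)" .
      then have "real_of_int (int Q * k (Suc j) - int P * k j) = real P * a - real Q * b"
        unfolding a_def b_def right_diff_distrib of_int_diff of_int_mult of_int_of_nat_eq by linarith
      moreover have "\<bar>real P * a - real Q * b\<bar> \<le> real P * \<bar>a\<bar> + real Q * \<bar>b\<bar>"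
        by (metis abs_mult abs_of_nat abs_triangle_ineq4)
      moreover have "\<dots> \<le> real P * \<eta> + real Q * \<eta>"
        using ab by (intro add_mono mult_left_mono) auto
      ultimately have "\<bar>real_of_int (int Q * k (Suc j) - int P * k j)\<bar> < 1"
        using \<eta>(2) by (simp add: algebra_simps)
      then show ?thesis by linarith
    qed
    have chain: "int Q ^ i * k (Suc i) = int P ^ i * k 1" if "i \<le> n" for i
      using that
    proof (induction i)
      case (Suc i)
      have "int Q ^ Suc i * k (Suc (Suc i)) = int Q ^ i * (int Q * k (Suc (Suc i)))" by simp
      also have "\<dots> = int P * (int Q ^ i * k (Suc i))" using step[of "Suc i"] Suc.prems by simp
      finally show ?case using Suc by simp
    qed simp
    then have "int Q ^ n dvd int P ^ n * k 1" by (metis dvd_triv_left order_refl)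
    moreover have "Rings.coprime (int Q ^ n) (int P ^ n)"
      using PQ(3) by (simp add: coprime_power_left_iff coprime_power_right_iff coprime_commute)
    ultimately have dvd: "int Q ^ n dvd k 1" by (simp add: coprime_dvd_mult_right_iff)
    have k1: "\<bar>\<rho> * y - of_int (k 1)\<bar> < 1" using k[of 1] \<eta> by simp
    have "\<rho> * \<bar>y\<bar> \<ge> 1"
    proof -
      have "\<rho> * real Q \<ge> 1" using PQ by (simp add: \<rho>_def)
      also have "\<rho> * real Q \<le> \<rho> * \<bar>y\<bar>" using y_ge C \<rho> by (intro mult_left_mono) auto
      finally show ?thesis by simp
    qed
    then have "k 1 \<noteq> 0" using k1 \<rho> by (auto simp: abs_mult)
    from dvd_imp_le_int[OF this dvd] have "int Q ^ n \<le> \<bar>k 1\<bar>" by simp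
    then have "real_of_int (int Q ^ n) \<le> real_of_int \<bar>k 1\<bar>" by (simp only: of_int_le_iff)
    then have "real Q ^ n \<le> \<bar>real_of_int (k 1)\<bar>" by simp
    also have "\<dots> \<le> \<rho> * \<bar>y\<bar> + 1" using k1 \<rho> abs_mult[of \<rho> y] by linarith
    also have "\<dots> \<le> 2 * \<bar>y\<bar>"
      using \<rho> y_ge C mult_right_mono[of \<rho> 1 "\<bar>y\<bar>"] by simp
    finally show ?thesis .
  qed
  have ex: "\<exists>L. 1 \<le> L \<and> \<not> near L"
  proof (rule ccontr)
    assume "\<not> (\<exists>L. 1 \<le> L \<and> \<not> near L)"
    then have "real Q ^ n \<le> 2 * \<bar>y\<bar>" for n by (intro run) auto
    moreover obtain n where "2 * \<bar>y\<bar> < real Q ^ n"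
      using real_arch_pow[of "real Q" "2 * \<bar>y\<bar>"] PQ by auto
    ultimately show False by (metis not_le)
  qed
  define L where "L = (LEAST L. 1 \<le> L \<and> \<not> near L)"
  have L: "1 \<le> L" "\<not> near L" unfolding L_def using LeastI_ex[OF ex] by auto
  have below: "near j" if "1 \<le> j" "j < L" for j
    using not_less_Least[of j "\<lambda>L. 1 \<le> L \<and> \<not> near L"] that by (auto simp: L_def)
  \<comment> \<open>L is the first index that is not near, so L - 1 indices form the run and
    \<open>run\<close> applies with n = L - 2. The two missing factors Q are absorbed by C.\<close>
  have QL: "real Q ^ L \<le> C * \<bar>y\<bar>"
  proof (cases "L = 1")
    case True
    have "real Q * 1 \<le> C * \<bar>y\<bar>" using C y_ge by (intro mult_mono) auto
    with True show ?thesis by simp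
  next
    case False
    then have "real Q ^ (L - 2) \<le> 2 * \<bar>y\<bar>" using L by (intro run below) auto
    then have "real Q ^ 2 * real Q ^ (L - 2) \<le> real Q ^ 2 * (2 * \<bar>y\<bar>)"
      by (intro mult_left_mono) auto
    moreover have "real Q ^ 2 * real Q ^ (L - 2) = real Q ^ L"
    proof -
      have "2 + (L - 2) = L" using False L by simp
      then show ?thesis by (simp only: power_add[symmetric])
    qed
    ultimately show ?thesis by (simp add: C_def)
  qed
  define z where "z = \<rho> ^ L * \<bar>y\<bar>"
  have z: "z = real P ^ L * \<bar>y\<bar> / real Q ^ L" by (simp add: z_def \<rho>_def power_divide)
  \<comment> \<open>If z were small, so would be \<open>P ^ L\<close>, then \<open>Q ^ L\<close>
    because Q is at most \<open>P ^ Q\<close>, and finally y. This is the origin of the exponent Q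
    in the hypothesis on y.\<close>
  have "z \<ge> Z"
  proof (rule ccontr)
    assume "\<not> z \<ge> Z"
    then have less: "z < Z" by simp
    have z0: "z > 0" using \<rho> y_ge C by (simp add: z_def)
    have PL: "real P ^ L \<le> C * z"
    proof -
      have "real P ^ L * real Q ^ L \<le> real P ^ L * (C * \<bar>y\<bar>)" using QL by (intro mult_left_mono) auto
      then show ?thesis using PQ by (simp add: z field_simps)
    qed
    have "real Q \<le> real P ^ Q"
    proof -
      have "Q < 2 ^ Q" by (rule less_exp)
      also have "(2::nat) ^ Q \<le> P ^ Q" using PQ by (intro power_mono) auto
      finally show ?thesis by (metis less_imp_le of_nat_le_iff of_nat_power)
    qed
    then have "real Q ^ L \<le> (real P ^ Q) ^ L" by (intro power_mono) auto
    also have "\<dots> = (real P ^ L) ^ Q" by (simp flip: power_mult add: mult.commute)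
    also have "\<dots> \<le> (C * z) ^ Q" using PL by (intro power_mono) auto
    finally have Qz: "real Q ^ L \<le> (C * z) ^ Q" .
    have "\<bar>y\<bar> \<le> z * real Q ^ L"
    proof -
      have "1 \<le> real P ^ L" using PQ by (intro one_le_power) auto
      then have "1 * \<bar>y\<bar> \<le> real P ^ L * \<bar>y\<bar>" by (intro mult_right_mono) auto
      also have "\<dots> = z * real Q ^ L" using PQ by (simp add: z)
      finally show ?thesis by simp
    qed
    also have "\<dots> \<le> z * (C * z) ^ Q" using Qz z0 by (intro mult_left_mono) auto
    also have "\<dots> < Z * (C * Z) ^ Q"
    proof (rule mult_strict_mono)
      show "z < Z" "0 < Z" by (fact less, fact Z1(2))
      have "C * z < C * Z" using less C by simp
      then show "(C * z) ^ Q < (C * Z) ^ Q" using z0 C PQ by (intro power_strict_mono) auto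
      show "0 \<le> (C * z) ^ Q" using z0 C by simp
    qed
    finally show False using y by simp
  qed
  then show ?thesis
    using that[of L] L by (auto simp: near_def z_def not_less)
qed

context spectral_four_rational
begin

text \<open>Each use of \<open>ex_far_iterate\<close> gains a factor \<theta> and passes from a
  frequency of size at least \<open>Z ^ W\<close> to one of size at least Z. So i factors cost a
  size doubly exponential in i, which amounts to decay by a power of the logarithm.\<close>

lemma fourier_decay:
  assumes P2: "2 \<le> P"
  obtains a C \<theta> :: real and W :: nat where "0 < a" "1 \<le> C" "0 < \<theta>" "\<theta> < 1" "2 \<le> W"
    "\<And>i x. C ^ (W ^ i) \<le> a * \<bar>x\<bar> \<Longrightarrow> cmod (fourier \<mu> x) \<le> \<theta> ^ i"
proof -
  obtain a y z where D: "D = {0, a, y, z}" and o: "0 < a" "a < y" "y < z"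
    using card_4_digits[OF fin_D D_nonneg zero_D card_D] .
  define C where "C = 2 * real Q ^ 2"
  define \<eta> where "\<eta> = 1 / (2 * (real P + real Q))"
  \<comment> \<open>The square root bounds the modulus of \<open>1 + exponential w a\<close> when
    \<open>a * w\<close> has distance at least \<open>\<eta>\<close> from the integers; the two
    other terms are estimated by 1 each.\<close>
  define \<theta> where "\<theta> = (2 + sqrt (2 + 2 * cos (2 * pi * \<eta>))) / 4"
  \<comment> \<open>The exponent of Z in \<open>Z * (Z * Z) ^ Q\<close>.\<close>
  define W where "W = 2 * Q + 1"
  have Q: "Q \<ge> 3" using P2 PQ by simp
  have C: "1 \<le> C"
  proof -
    have "1 * 1 \<le> 2 * real Q ^ 2" using Q by (intro mult_mono one_le_power) auto
    then show ?thesis by (simp add: C_def)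
  qed
  have \<eta>: "0 < \<eta>" "\<eta> < 1 / 2" using P2 Q by (auto simp: \<eta>_def divide_simps)
  have "cos (2 * pi * \<eta>) < cos 0"
    using \<eta> by (intro cos_monotone_0_pi) auto
  then have "sqrt (2 + 2 * cos (2 * pi * \<eta>)) < sqrt 4" by (intro real_sqrt_less_mono) simp
  then have \<theta>1: "\<theta> < 1" by (simp add: \<theta>_def)
  have "-1 \<le> cos (2 * pi * \<eta>)" by simp
  then have "0 \<le> sqrt (2 + 2 * cos (2 * pi * \<eta>))" by (intro real_sqrt_ge_zero) linarith
  then have \<theta>0: "0 < \<theta>" unfolding \<theta>_def by (simp add: add_pos_nonneg)
  have mask_far: "cmod (mask_poly D p w) \<le> \<theta>" if far: "\<And>k::int. \<eta> \<le> \<bar>a * w - of_int k\<bar>" for w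
  proof -
    have "mask_poly D p w = (\<Sum>d\<in>{0, a, y, z}. exponential w d / 4)"
      unfolding mask_poly_def D
      by (intro sum.cong refl) (use weights D in \<open>simp only: of_real_divide of_real_1 of_real_numeral; simp\<close>)
    also have "\<dots> = (1 + exponential w a) / 4 + exponential w y / 4 + exponential w z / 4"
      using o by (simp add: field_simps)
    finally have "cmod (mask_poly D p w) \<le> cmod ((1 + exponential w a) / 4) + cmod (exponential w y / 4)
        + cmod (exponential w z / 4)"
      by (metis norm_triangle_ineq order_trans add_right_mono)
    also have "\<dots> = (2 + cmod (1 + exponential w a)) / 4"
      by (simp add: norm_divide field_simps)
    also have "cmod (1 + exponential w a) \<le> sqrt (2 + 2 * cos (2 * pi * \<eta>))"
    proof (rule real_le_rsqrt)
      have "cos (2 * pi * (a * w)) \<le> cos (2 * pi * \<eta>)"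
        using \<eta> by (intro cos_le_if_far_from_int far) auto
      then show "(cmod (1 + exponential w a))\<^sup>2 \<le> 2 + 2 * cos (2 * pi * \<eta>)"
        by (simp add: norm_one_plus_exponential mult_ac)
    qed
    finally show ?thesis by (simp add: \<theta>_def divide_right_mono)
  qed
  have "cmod (fourier \<mu> x) \<le> \<theta> ^ i" if "C ^ (W ^ i) \<le> a * \<bar>x\<bar>" for i x
    using that
  proof (induction i arbitrary: x)
    case 0
    then show ?case by (simp add: norm_fourier_le_1)
  next
    case (Suc i)
    define Z where "Z = C ^ (W ^ i)"
    have "C ^ 1 \<le> C ^ (W ^ i)" using C by (intro power_increasing) (auto simp: W_def)
    then have CZ: "C \<le> Z" by (simp add: Z_def)
    then have Z1: "1 \<le> Z" using C by simp
    have "Z * (C * Z) ^ Q \<le> Z * (Z * Z) ^ Q"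
      using CZ C Z1 by (intro mult_left_mono power_mono mult_right_mono) auto
    also have "\<dots> = Z ^ W" by (simp add: W_def power_mult power2_eq_square)
    also have "\<dots> = C ^ (W ^ Suc i)" by (simp add: Z_def power_mult[symmetric] mult.commute)
    also have "\<dots> \<le> \<bar>a * x\<bar>" using Suc.prems o by (simp add: abs_mult)
    finally have y: "Z * (C * Z) ^ Q \<le> \<bar>a * x\<bar>" .
    obtain L where L: "1 \<le> L" "\<And>k::int. \<eta> \<le> \<bar>\<rho> ^ L * (a * x) - of_int k\<bar>" "Z \<le> \<rho> ^ L * \<bar>a * x\<bar>"
      using ex_far_iterate[OF P2 PQ coprime CZ[unfolded C_def] y[unfolded C_def]]
      unfolding \<rho>_eq \<eta>_def by blast
    have "cmod (fourier \<mu> x) \<le> cmod (mask_poly D p (\<rho> ^ L * x)) * cmod (fourier \<mu> (\<rho> ^ L * x))"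
      by (rule norm_fourier_le_factor[OF L(1)])
    also have "\<dots> \<le> \<theta> * \<theta> ^ i"
    proof (intro mult_mono mask_far Suc.IH)
      show "\<eta> \<le> \<bar>a * (\<rho> ^ L * x) - of_int k\<bar>" for k :: int using L(2)[of k] by (simp add: mult_ac)
      show "C ^ (W ^ i) \<le> a * \<bar>\<rho> ^ L * x\<bar>" using L(3) \<rho> o by (simp add: Z_def abs_mult mult_ac)
    qed (use \<theta>0 in auto)
    finally show ?case by simp
  qed
  with o(1) C \<theta>0 \<theta>1 show ?thesis by (intro that[of a C \<theta> W]) (use Q in \<open>auto simp: W_def\<close>)
qed

end

subsection \<open>Incompleteness\<close>

context spectral_four_rational
begin

text \<open>Zeros of the transform and differences of the spectrum are rational multiples of
  \<kappa>, so a shift of one frequency by an irrational multiple of \<kappa> avoids all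
  zeros.\<close>

lemma ex_generic_frequency: "\<exists>\<xi>. \<forall>l\<in>\<Lambda>. fourier \<mu> (\<xi> - l) \<noteq> 0"
proof -
  obtain l0 where l0: "l0 \<in> \<Lambda>" using infinite_imp_nonempty[OF infinite_spectrum] by blast
  obtain r :: real where r: "r \<notin> \<rat>"
    by (metis UNIV_eq_I countable_rat uncountable_UNIV_real)
  have rat: "\<exists>q\<in>\<rat>. x = \<kappa> * q" if "x * real P ^ j = \<kappa> * real Q ^ j * of_int s" for x j s
  proof (intro bexI[of _ "real Q ^ j * of_int s / real P ^ j"])
    show "x = \<kappa> * (real Q ^ j * of_int s / real P ^ j)" using that P0 by (simp add: field_simps)
  qed auto
  have "fourier \<mu> (l0 + \<kappa> * r - l) \<noteq> 0" if l: "l \<in> \<Lambda>" for l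
  proof
    assume "fourier \<mu> (l0 + \<kappa> * r - l) = 0"
    from fourier_zero[OF this] level_zero obtain j s
      where "(l0 + \<kappa> * r - l) * real P ^ j = \<kappa> * real Q ^ j * of_int s" by metis
    with rat obtain q where q: "q \<in> \<rat>" "l0 + \<kappa> * r - l = \<kappa> * q" by blast
    have "\<exists>q'\<in>\<rat>. l0 - l = \<kappa> * q'"
    proof (cases "l0 = l")
      case False
      from spectrum_level[OF l0 l False] rat show ?thesis by metis
    qed (auto intro: bexI[of _ 0])
    then obtain q' where q': "q' \<in> \<rat>" "l0 - l = \<kappa> * q'" by blast
    have "\<kappa> * r = \<kappa> * (q - q')" using q q' by (simp add: algebra_simps)
    then have "r = q - q'" using \<kappa> by simp
    with q q' r show False by simp
  qed
  then show ?thesis by blast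
qed

text \<open>
  Let \<open>L n\<close> be the part of the spectrum in the window \<open>|l| < \<gamma> Q^n / 2\<close>. It is orthogonal for
  the discrete approximation of order \<open>n\<close>. Enlarging the window from \<open>n\<close> to \<open>n'\<close> multiplies the
  defect in Parseval's identity by at least \<open>1 - e\<close> if \<open>e\<close> bounds the Fourier transform of the
  remaining factor; these factors have a positive product because of the decay.
\<close>
theorem numerator_eq_one: "P = 1"
proof (rule ccontr)
  assume "P \<noteq> 1"
  then have P2: "2 \<le> P" using P0 by simp
  obtain \<gamma> where \<gamma>: "\<gamma> > 0"
    "\<And>k l j. k \<in> \<Lambda> \<Longrightarrow> l \<in> \<Lambda> \<Longrightarrow> k \<noteq> l \<Longrightarrow> level (k - l) j \<Longrightarrow> \<gamma> * real Q ^ j \<le> \<bar>k - l\<bar>"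
    using spectrum_gap by blast
  obtain a C \<theta> :: real and W :: nat where a: "0 < a" and C: "1 \<le> C" and \<theta>: "0 < \<theta>" "\<theta> < 1" and W: "2 \<le> W"
    and decay: "\<And>i x. C ^ (W ^ i) \<le> a * \<bar>x\<bar> \<Longrightarrow> cmod (fourier \<mu> x) \<le> \<theta> ^ i"
    using fourier_decay[OF P2] by metis
  obtain \<xi> where \<xi>: "\<And>l. l \<in> \<Lambda> \<Longrightarrow> fourier \<mu> (\<xi> - l) \<noteq> 0"
    using ex_generic_frequency by blast
  have QP: "Q \<ge> 3" "real Q \<ge> 1" "real P \<ge> 1" using P2 PQ by auto
  define A where "A l = (cmod (fourier \<mu> (\<xi> - l)))\<^sup>2" for l
  have A_pos: "0 < A l" if "l \<in> \<Lambda>" for l using \<xi>[OF that] by (simp add: A_def)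
  have A_sum: "(A has_sum 1) \<Lambda>" unfolding A_def by (rule fourier_has_sum)
  define L where "L n = {l \<in> \<Lambda>. \<bar>l\<bar> < \<gamma> * real Q ^ n / 2}" for n

  have gap1: "\<gamma> \<le> \<bar>k - l\<bar>" if kl: "k \<in> \<Lambda>" "l \<in> \<Lambda>" "k \<noteq> l" for k l
  proof -
    obtain j where j: "level (k - l) j" using spectrum_level'[OF kl] by blast
    have "\<gamma> * 1 \<le> \<gamma> * real Q ^ j" using \<gamma> QP by (intro mult_left_mono one_le_power) auto
    with \<gamma>(2)[OF kl j] show ?thesis by simp
  qed
  have fin_L: "finite (L n)" for n
  proof -
    define N where "N = \<lceil>real Q ^ n\<rceil> + 1"
    have "inj_on (\<lambda>l. \<lfloor>l / \<gamma>\<rfloor>) (L n)"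
    proof (rule inj_onI, rule ccontr)
      fix k l assume kl: "k \<in> L n" "l \<in> L n" "\<lfloor>k / \<gamma>\<rfloor> = \<lfloor>l / \<gamma>\<rfloor>" "k \<noteq> l"
      then have "\<bar>k / \<gamma> - l / \<gamma>\<bar> < 1" by linarith
      moreover have "\<bar>k / \<gamma> - l / \<gamma>\<bar> = \<bar>k - l\<bar> / \<gamma>"
        using \<gamma>(1) by (simp add: abs_divide flip: diff_divide_distrib)
      ultimately have "\<bar>k - l\<bar> < \<gamma>" using \<gamma>(1) by simp
      moreover have "\<gamma> \<le> \<bar>k - l\<bar>" using kl by (intro gap1) (auto simp: L_def)
      ultimately show False by simp
    qed
    moreover have "(\<lambda>l. \<lfloor>l / \<gamma>\<rfloor>) ` L n \<subseteq> {- N..N}"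
    proof safe
      fix l assume "l \<in> L n"
      then have "\<bar>l\<bar> < \<gamma> * real Q ^ n / 2" by (simp add: L_def)
      moreover have "\<gamma> * real Q ^ n / 2 \<le> \<gamma> * real Q ^ n" using \<gamma>(1) by simp
      ultimately have "\<bar>l\<bar> < \<gamma> * real Q ^ n" by linarith
      then have "\<bar>l / \<gamma>\<bar> < real Q ^ n" using \<gamma>(1) by (simp add: abs_divide field_simps)
      then have "\<bar>l / \<gamma>\<bar> < of_int N - 1" unfolding N_def by linarith
      then have "- of_int N \<le> l / \<gamma>" "l / \<gamma> < of_int N + 1" by linarith+
      then show "\<lfloor>l / \<gamma>\<rfloor> \<in> {- N..N}"
        by (simp only: atLeastAtMost_iff le_floor_iff floor_le_iff of_int_minus simp_thms)
    qed
    ultimately show ?thesis by (meson finite_atLeastAtMost_int finite_imageD finite_subset)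
  qed

  have step: "sum A S \<le> 1 - (1 - e) * \<eta>"
    if e: "0 \<le> e" "e \<le> 1"
      and far: "\<And>l. l \<in> \<Lambda> \<Longrightarrow> \<gamma> * real Q ^ n / 2 \<le> \<bar>l\<bar> \<Longrightarrow> (cmod (fourier \<mu> (\<rho> ^ n' * (\<xi> - l))))\<^sup>2 \<le> e"
      and ind: "\<And>T. T \<subseteq> L n \<Longrightarrow> finite T \<Longrightarrow> sum A T \<le> 1 - \<eta>"
      and S: "S \<subseteq> L n'" "finite S" for e \<eta> n n' S
  proof -
    obtain N where N: "real_distribution N"
      "\<And>l. fourier N l = (\<Prod>j=1..n'. mask_poly D p (\<rho> ^ j * l))" using ex_approximant by blast
    interpret N: real_distribution N by (rule N)
    define B where "B l = (cmod (fourier N (\<xi> - l)))\<^sup>2" for l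
    have AB: "A l = B l * (cmod (fourier \<mu> (\<rho> ^ n' * (\<xi> - l))))\<^sup>2" for l
      unfolding A_def B_def N(2) by (subst fourier_prod[of _ n']) (simp add: norm_mult power_mult_distrib)
    have AB_le: "A l \<le> B l" for l
    proof -
      have "(cmod (fourier \<mu> (\<rho> ^ n' * (\<xi> - l))))\<^sup>2 \<le> 1" by (simp add: power_le_one norm_fourier_le_1)
      then show ?thesis unfolding AB B_def by (intro mult_left_le) auto
    qed
    have "(\<Sum>l\<in>S. (cmod (LINT x|N. exponential \<xi> x * cnj (exponential l x)))\<^sup>2)
        \<le> (LINT x|N. (cmod (exponential \<xi> x))\<^sup>2)"
    proof (intro N.Bessel_exponential bounded_borel_intros S)
      fix k l assume kl: "k \<in> S" "l \<in> S" "k \<noteq> l"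
      then have \<Lambda>: "k \<in> \<Lambda>" "l \<in> \<Lambda>" and b: "\<bar>k\<bar> < \<gamma> * real Q ^ n' / 2" "\<bar>l\<bar> < \<gamma> * real Q ^ n' / 2"
        using S by (auto simp: L_def)
      obtain j where j: "1 \<le> j" "level (k - l) j" "mask_poly D p (\<rho> ^ j * (k - l)) = 0"
        using spectrum_level'[OF \<Lambda> kl(3)] .
      \<comment> \<open>Two points of the window are closer than \<open>\<gamma> * Q ^ n'\<close>,
        so the gap estimate limits the level of their difference, which is therefore a zero of the
        finite product already.\<close>
      have "\<gamma> * real Q ^ j < \<gamma> * real Q ^ n'"
        using \<gamma>(2)[OF \<Lambda> kl(3) j(2)] b by linarith
      then have "real Q ^ j < real Q ^ n'" using \<gamma>(1) by simp
      then have "j \<le> n'" using QP by (metis not_le_imp_less not_less power_increasing order_less_imp_le)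
      with j show "fourier N (k - l) = 0" unfolding N(2) by (intro prod_zero) auto
    qed
    then have B_sum: "sum B S \<le> 1"
      using N.prob_space by (simp add: N.exponential_inner B_def)
    \<comment> \<open>Old frequencies keep their contribution; the new ones contribute at most e
      times what Bessel's inequality for the approximant leaves over.\<close>
    define S1 where "S1 = S \<inter> L n"
    define S2 where "S2 = S - L n"
    have split: "sum f S = sum f S1 + sum f S2" for f :: "real \<Rightarrow> real"
      unfolding S1_def S2_def using S(2) by (rule sum.Int_Diff)
    have "sum A S2 \<le> (\<Sum>l\<in>S2. B l * e)"
    proof (rule sum_mono)
      fix l assume "l \<in> S2"
      then have "l \<in> \<Lambda>" "\<gamma> * real Q ^ n / 2 \<le> \<bar>l\<bar>" using S by (auto simp: S2_def L_def)
      from far[OF this] show "A l \<le> B l * e" unfolding AB by (intro mult_left_mono) (auto simp: B_def)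
    qed
    also have "\<dots> = e * sum B S2" by (simp add: sum_distrib_left mult.commute)
    also have "\<dots> \<le> e * (1 - sum A S1)"
    proof (rule mult_left_mono)
      have "sum A S1 \<le> sum B S1" by (intro sum_mono AB_le)
      with B_sum split[of B] show "sum B S2 \<le> 1 - sum A S1" by simp
    qed (use e in simp)
    finally have "sum A S \<le> sum A S1 + e * (1 - sum A S1)" using split[of A] by simp
    also have "\<dots> = 1 - (1 - e) * (1 - sum A S1)" by (simp add: algebra_simps)
    also have "\<dots> \<le> 1 - (1 - e) * \<eta>"
    proof -
      have "sum A S1 \<le> 1 - \<eta>" using S by (intro ind) (auto simp: S1_def)
      then have "(1 - e) * \<eta> \<le> (1 - e) * (1 - sum A S1)" using e by (intro mult_left_mono) auto
      then show ?thesis by simp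
    qed
    finally show ?thesis .
  qed

  \<comment> \<open>All constants are absorbed into powers of P; \<open>Q \<le> b\<close> makes the
    first window index at least 2 Q.\<close>
  obtain b where b: "C \<le> real P ^ b" "4 / (a * \<gamma>) \<le> real P ^ b" "4 * \<bar>\<xi>\<bar> / \<gamma> \<le> real P ^ b" "Q \<le> b"
  proof -
    have "1 < real P" using P2 by simp
    from real_arch_pow[OF this] obtain b
      where b: "max C (max (4 / (a * \<gamma>)) (4 * \<bar>\<xi>\<bar> / \<gamma>)) < real P ^ b" by blast
    have "real P ^ b \<le> real P ^ (b + Q)" using QP by (intro power_increasing) auto
    with b that[of "b + Q"] show ?thesis by simp
  qed
  \<comment> \<open>For l outside the window, \<open>\<rho> ^ n' * l\<close> has size at least a
    constant times \<open>P ^ n' / Q ^ (n div (2 * Q))\<close>. As Q is at most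
    \<open>P ^ Q\<close>, the divisor is at most \<open>P ^ (n div 2)\<close>, and the remaining
    power of P suffices for i factors of decay.\<close>
  have far: "(cmod (fourier \<mu> (\<rho> ^ n' * (\<xi> - l))))\<^sup>2 \<le> (\<theta>\<^sup>2) ^ i"
    if n: "4 * b * W ^ i \<le> n" "n' = n + n div (2 * Q)" and l: "\<gamma> * real Q ^ n / 2 \<le> \<bar>l\<bar>" for n n' i l
  proof -
    have Wi: "1 \<le> W ^ i" using W by simp
    have bW: "b \<le> b * W ^ i" using Wi by simp
    then have bn: "b \<le> n" using n(1) by linarith
    have "real P ^ b \<le> real P ^ n" using QP bn by (intro power_increasing) auto
    also have "\<dots> \<le> real Q ^ n" using PQ by (intro power_mono) auto
    finally have "4 * \<bar>\<xi>\<bar> / \<gamma> \<le> real Q ^ n" using b(3) by linarith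
    then have "\<bar>\<xi>\<bar> \<le> \<gamma> * real Q ^ n / 4" using \<gamma>(1) by (simp add: field_simps)
    then have low: "\<gamma> * real Q ^ n / 4 \<le> \<bar>\<xi> - l\<bar>" using l by linarith
    have "Q * (n div (2 * Q)) \<le> n div 2"
      by (metis div_mult2_eq mult.commute times_div_less_eq_dividend)
    moreover have "2 * (b * W ^ i) \<le> n div 2" using n(1) by simp
    ultimately have expo: "2 * (b * W ^ i) + Q * (n div (2 * Q)) \<le> n'" using n(2) by linarith
    have "real Q \<le> real P ^ Q"
    proof -
      have "Q < 2 ^ Q" by (rule less_exp)
      also have "(2::nat) ^ Q \<le> P ^ Q" using P2 by (intro power_mono) auto
      finally show ?thesis by (metis less_imp_le of_nat_le_iff of_nat_power)
    qed
    then have Qd: "real Q ^ (n div (2 * Q)) \<le> real P ^ (Q * (n div (2 * Q)))"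
      by (simp add: power_mult power_mono)
    have "real P ^ (2 * (b * W ^ i)) * real Q ^ (n div (2 * Q)) \<le>
        real P ^ (2 * (b * W ^ i)) * real P ^ (Q * (n div (2 * Q)))"
      using Qd by (intro mult_left_mono) auto
    also have "\<dots> \<le> real P ^ n'" unfolding power_add[symmetric] using expo QP by (intro power_increasing) auto
    finally have Pn: "real P ^ (2 * (b * W ^ i)) \<le> real P ^ n' / real Q ^ (n div (2 * Q))"
      using QP by (simp add: field_simps)
    have "C ^ (W ^ i) * (4 / (a * \<gamma>)) \<le> (real P ^ b) ^ (W ^ i) * real P ^ (b * W ^ i)"
    proof (intro mult_mono power_mono)
      have "real P ^ b \<le> real P ^ (b * W ^ i)" using bW QP by (intro power_increasing) auto
      with b(2) show "4 / (a * \<gamma>) \<le> real P ^ (b * W ^ i)" by linarith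
    qed (use b C a \<gamma> in auto)
    also have "\<dots> = real P ^ (2 * (b * W ^ i))" by (simp add: power_mult[symmetric] power_add[symmetric] mult_2)
    also note Pn
    also have "real P ^ n' / real Q ^ (n div (2 * Q)) = \<rho> ^ n' * real Q ^ n"
      using QP n(2) by (simp add: \<rho>_eq power_divide power_add)
    finally have "C ^ (W ^ i) \<le> a * (\<rho> ^ n' * (\<gamma> * real Q ^ n / 4))"
      using a \<gamma>(1) by (simp add: field_simps)
    also have "\<dots> \<le> a * (\<rho> ^ n' * \<bar>\<xi> - l\<bar>)"
      using low a \<rho> by (intro mult_left_mono) auto
    finally have "C ^ (W ^ i) \<le> a * \<bar>\<rho> ^ n' * (\<xi> - l)\<bar>" using \<rho> by (simp add: abs_mult)
    from power_mono[OF decay[OF this], of 2] show ?thesis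
      by (simp flip: power_mult add: mult.commute)
  qed

  \<comment> \<open>Rounding \<open>n / (2 * Q)\<close> down loses at most a factor 2 once n is at
    least 2 Q, so the window indices grow at least at this rate.\<close>
  define g where "g = 1 + 1 / (4 * real Q)"
  have g: "g > 1" using QP by (simp add: g_def)
  \<comment> \<open>After s steps the guaranteed lower bound of the index has grown by W, which
    permits one more factor of decay. So the errors \<open>E k\<close> are constant on blocks of
    length s and geometric from block to block; \<open>i0\<close> will make their total at most 1 /
    2.\<close>
  obtain s where s: "real W \<le> g ^ s" using real_arch_pow[OF g, of "real W"] by (auto intro: less_imp_le)
  have s0: "s > 0" using s W by (intro gr0I) auto
  have \<theta>2: "0 < \<theta>\<^sup>2" "\<theta>\<^sup>2 < 1" using \<theta> by (auto simp: power_less_one_iff)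
  obtain i0 where i0: "(\<theta>\<^sup>2) ^ i0 * (real s / (1 - \<theta>\<^sup>2)) \<le> 1 / 2"
  proof -
    have "(\<lambda>i. (\<theta>\<^sup>2) ^ i * (real s / (1 - \<theta>\<^sup>2))) \<longlonglongrightarrow> 0 * (real s / (1 - \<theta>\<^sup>2))"
      using \<theta>2 by (intro tendsto_intros LIMSEQ_realpow_zero) auto
    then have "eventually (\<lambda>i. (\<theta>\<^sup>2) ^ i * (real s / (1 - \<theta>\<^sup>2)) < 1 / 2) sequentially"
      by (intro order_tendstoD) auto
    then show ?thesis using that by (auto simp: eventually_sequentially intro: less_imp_le)
  qed
  define n where "n = rec_nat (4 * b * W ^ i0) (\<lambda>_ n. n + n div (2 * Q))"
  have n0: "n 0 = 4 * b * W ^ i0" and n_Suc: "n (Suc k) = n k + n k div (2 * Q)" for k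
    by (simp_all add: n_def)
  have n_ge: "2 * Q \<le> n k" for k
  proof (induction k)
    case 0
    have "1 \<le> W ^ i0" using W by simp
    then have "4 * b * 1 \<le> 4 * b * W ^ i0" by (intro mult_left_mono) auto
    then show ?case using b(4) unfolding n0 by linarith
  qed (simp add: n_Suc)
  have n_growth: "real (n 0) * g ^ k \<le> real (n k)" for k
  proof (induction k)
    case (Suc k)
    have "n k div (2 * Q) \<ge> 1" using n_ge[of k] QP by (simp add: Suc_leI div_greater_zero_iff)
    moreover have "n k < 2 * Q * (n k div (2 * Q)) + 2 * Q"
      using QP by (metis add.commute dividend_less_times_div mult_pos_pos zero_less_numeral Q0)
    ultimately have "n k \<le> 4 * Q * (n k div (2 * Q))"
    proof -
      assume "1 \<le> n k div (2 * Q)" "n k < 2 * Q * (n k div (2 * Q)) + 2 * Q"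
      moreover from this(1) have "2 * Q * 1 \<le> 2 * Q * (n k div (2 * Q))" by (intro mult_left_mono) auto
      ultimately show ?thesis by linarith
    qed
    then have "real (n k) \<le> real (4 * Q * (n k div (2 * Q)))" by (simp only: of_nat_le_iff)
    then have "real (n k) / (4 * real Q) \<le> real (n k div (2 * Q))"
      using QP by (simp add: field_simps)
    then have "real (n k) * g \<le> real (n (Suc k))" by (simp add: n_Suc g_def distrib_left)
    moreover have "real (n 0) * g ^ k * g \<le> real (n k) * g" using Suc g by (intro mult_right_mono) auto
    ultimately show ?case by (simp add: mult_ac)
  qed simp
  have n_level: "4 * b * W ^ (i0 + k div s) \<le> n k" for k
  proof -
    have "real W ^ (k div s) \<le> (g ^ s) ^ (k div s)" using s by (intro power_mono) auto
    also have "\<dots> = g ^ (s * (k div s))" by (simp add: power_mult)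
    also have "\<dots> \<le> g ^ k" using g by (intro power_increasing) auto
    finally have "real (n 0) * real W ^ (k div s) \<le> real (n 0) * g ^ k" by (intro mult_left_mono) auto
    also note n_growth[of k]
    finally have "real (4 * b * W ^ (i0 + k div s)) \<le> real (n k)" by (simp add: n0 power_add)
    then show ?thesis by (simp only: of_nat_le_iff)
  qed
  define E where "E k = (\<theta>\<^sup>2) ^ (i0 + k div s)" for k
  have E: "0 \<le> E k" "E k \<le> 1" for k
    unfolding E_def using \<theta>2 by (auto intro: power_le_one)
  have E_sum: "sum E {..<K} \<le> 1 / 2" for K
  proof -
    have "sum E {..<K} \<le> sum E {..<K * s}" using s0 E by (intro sum_mono2) auto
    also have "\<dots> = (\<Sum>i<K. sum E {i * s..<i * s + s})" by (rule sum.nat_group[symmetric])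
    also have "\<dots> = (\<Sum>i<K. real s * (\<theta>\<^sup>2) ^ (i0 + i))"
    proof (rule sum.cong[OF refl])
      fix i
      have "E k = (\<theta>\<^sup>2) ^ (i0 + i)" if "k \<in> {i * s..<i * s + s}" for k
      proof -
        have "k div s = i" using that s0 by (intro div_nat_eqI) (auto simp: mult.commute)
        then show ?thesis by (simp add: E_def)
      qed
      then show "sum E {i * s..<i * s + s} = real s * (\<theta>\<^sup>2) ^ (i0 + i)" by simp
    qed
    also have "\<dots> = (\<theta>\<^sup>2) ^ i0 * (real s * (\<Sum>i<K. (\<theta>\<^sup>2) ^ i))"
      by (simp add: sum_distrib_left power_add mult_ac)
    also have "\<dots> \<le> (\<theta>\<^sup>2) ^ i0 * (real s * (1 / (1 - \<theta>\<^sup>2)))"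
    proof (intro mult_left_mono)
      have "(\<Sum>i<K. (\<theta>\<^sup>2) ^ i) = (1 - (\<theta>\<^sup>2) ^ K) / (1 - \<theta>\<^sup>2)"
        using \<theta>2 by (simp add: sum_gp_strict)
      also have "\<dots> \<le> 1 / (1 - \<theta>\<^sup>2)" using \<theta>2 by (intro divide_right_mono) auto
      finally show "(\<Sum>i<K. (\<theta>\<^sup>2) ^ i) \<le> 1 / (1 - \<theta>\<^sup>2)" .
    qed (use \<theta>2 in auto)
    also have "\<dots> \<le> 1 / 2" using i0 by simp
    finally show ?thesis .
  qed
  \<comment> \<open>The weight of a frequency outside the first window is a defect present at the
    start.\<close>
  obtain l' where l': "l' \<in> \<Lambda>" "l' \<notin> L (n 0)"
  proof -
    have "infinite (\<Lambda> - L (n 0))" using infinite_spectrum fin_L by simp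
    from infinite_imp_nonempty[OF this] that show ?thesis by blast
  qed
  define \<eta> where "\<eta> = A l'"
  have \<eta>: "\<eta> > 0" unfolding \<eta>_def by (rule A_pos[OF l'(1)])
  \<comment> \<open>The product of the factors \<open>1 - E k\<close> is at least 1 minus the sum of
    the \<open>E k\<close>.\<close>
  have defect: "sum A S \<le> 1 - \<eta> * (1 - sum E {..<k})" if "S \<subseteq> L (n k)" "finite S" for k S
    using that
  proof (induction k arbitrary: S)
    case 0
    have "sum A (insert l' S) \<le> 1"
      using 0 l'(1) by (intro finite_sum_le_has_sum[OF A_sum]) (auto simp: L_def A_def)
    moreover have "l' \<notin> S" using 0 l' by auto
    ultimately show ?case using 0 by (simp add: \<eta>_def)
  next
    case (Suc k)
    have "sum A S \<le> 1 - (1 - E k) * (\<eta> * (1 - sum E {..<k}))"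
    proof (rule step[OF E _ Suc.IH Suc.prems])
      fix l assume "\<gamma> * real Q ^ n k / 2 \<le> \<bar>l\<bar>"
      then show "(cmod (fourier \<mu> (\<rho> ^ n (Suc k) * (\<xi> - l))))\<^sup>2 \<le> E k"
        unfolding E_def by (intro far[OF n_level n_Suc])
    qed
    also have "\<dots> \<le> 1 - \<eta> * (1 - sum E {..<Suc k})"
    proof -
      have "0 \<le> sum E {..<k}" using E by (intro sum_nonneg) auto
      then have "0 \<le> \<eta> * (E k * sum E {..<k})" using \<eta> E by simp
      then show ?thesis by (simp add: algebra_simps)
    qed
    finally show ?case .
  qed
  have "sum A S \<le> 1 - \<eta> / 2" if S: "finite S" "S \<subseteq> \<Lambda>" for S
  proof -
    obtain R where R: "\<And>l. l \<in> S \<Longrightarrow> \<bar>l\<bar> \<le> R"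
      using finite_imp_bounded[OF S(1)] unfolding bounded_iff by auto
    obtain K where K: "2 * R / \<gamma> < g ^ K" using real_arch_pow[OF g] by blast
    have "g ^ K \<le> real (n K)"
    proof -
      have "1 * g ^ K \<le> real (n 0) * g ^ K"
        using n_ge[of 0] QP g by (intro mult_right_mono) auto
      with n_growth[of K] show ?thesis by linarith
    qed
    also have "real (n K) < real Q ^ n K"
    proof -
      have "n K < 2 ^ n K" by (rule less_exp)
      also have "(2::nat) ^ n K \<le> Q ^ n K" using QP by (intro power_mono) auto
      finally show ?thesis by (metis of_nat_less_iff of_nat_power)
    qed
    finally have "2 * R / \<gamma> < real Q ^ n K" using K by linarith
    then have "R < \<gamma> * real Q ^ n K / 2" using \<gamma>(1) by (simp add: field_simps)
    then have "S \<subseteq> L (n K)" using S R by (force simp: L_def)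
    from defect[OF this S(1)] have "sum A S \<le> 1 - \<eta> * (1 - sum E {..<K})" .
    moreover have "\<eta> * (1 / 2) \<le> \<eta> * (1 - sum E {..<K})"
      using E_sum[of K] \<eta> by (intro mult_left_mono) auto
    ultimately show ?thesis by simp
  qed
  from has_sum_le_finite_sums[OF A_sum this] \<eta> show False by simp
qed

end

section \<open>Hadamard triples\<close>

definition root_char :: "nat \<Rightarrow> int \<Rightarrow> complex" where
  "root_char N k = cis (- (2 * pi * of_int k / real N))"

lemma root_char_add: "root_char N (k + l) = root_char N k * root_char N l"
  by (simp add: root_char_def cis_mult add_divide_distrib distrib_left)

lemma root_char_0 [simp]: "root_char N 0 = 1"
  by (simp add: root_char_def)

lemma root_char_dvd: "int N dvd k \<Longrightarrow> root_char N k = 1"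
proof (elim dvdE)
  fix q assume k: "k = int N * q"
  show ?thesis
  proof (cases "N = 0")
    case False
    then have "root_char N k = cis (2 * pi * of_int (- q))"
      by (simp add: root_char_def k mult.assoc)
    also have "\<dots> = 1" by (rule cis_multiple_2pi) simp
    finally show ?thesis .
  qed (simp add: root_char_def)
qed

lemma root_char_half:
  assumes "2 * k = int N * r" "odd r" "N > 0"
  shows "root_char N k = -1"
proof -
  have "2 * real_of_int k = real N * of_int r"
    using arg_cong[OF assms(1), of real_of_int] by simp
  then have "2 * pi * of_int k / real N = pi * of_int r"
    using assms(3) by (simp add: field_simps)
  moreover obtain q where "r = 2 * q + 1" using assms(2) by (auto elim: oddE)
  ultimately have "- (2 * pi * of_int k / real N) = 2 * pi * of_int (- q) - pi"
    by (simp add: algebra_simps)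
  then have "root_char N k = cis (2 * pi * of_int (- q) - pi)"
    by (simp only: root_char_def)
  also have "\<dots> = cis (2 * pi * of_int (- q)) * cis (- pi)" by (simp add: cis_mult)
  also have "cis (2 * pi * of_int (- q)) = 1" by (rule cis_multiple_2pi) simp
  finally show ?thesis by (simp add: complex_eq_iff)
qed

lemma root_char_scale: "M > 0 \<Longrightarrow> root_char (M * N) (int M * k) = root_char N k"
  by (simp add: root_char_def mult.assoc)

definition orth :: "nat \<Rightarrow> int set \<Rightarrow> int set \<Rightarrow> bool" where
  "orth N A L \<longleftrightarrow> (\<forall>x\<in>A. \<forall>y\<in>A. x \<noteq> y \<longrightarrow> (\<Sum>l\<in>L. root_char N ((x - y) * l)) = 0)"

text \<open>Both orthogonality relations of the matrix as character sums without the normalising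
  factor; \<open>N \<ge> 2\<close> is added only in
  \<open>hadamard_triple_if_hadamard\<close>.\<close>

definition hadamard :: "nat \<Rightarrow> int set \<Rightarrow> int set \<Rightarrow> bool" where
  "hadamard N A L \<longleftrightarrow> finite A \<and> finite L \<and> A \<noteq> {} \<and> card A = card L \<and> orth N A L \<and> orth N L A"

lemma hadamard_triple_if_hadamard:
  assumes H: "hadamard N A L" and N: "N \<ge> 2"
  shows "hadamard_triple N A L"
proof -
  have fin: "finite A" "finite L" "card A = card L" and pos: "card A > 0"
    using H by (auto simp: hadamard_def card_gt_0_iff)
  define H' where "H' d l = exp (- 2 * of_real pi * \<i> * of_int d * of_int l / of_nat N) / of_real (sqrt (real (card A)))"
    for d l :: int
  have H': "H' d l = root_char N (d * l) / of_real (sqrt (real (card A)))" for d l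
    by (simp add: H'_def root_char_def cis_conv_exp mult_ac)
  have sq: "complex_of_real (sqrt (real (card A))) * of_real (sqrt (real (card A))) = of_nat (card A)"
    by (simp flip: of_real_mult)
  have cnj: "cnj (root_char N k) = root_char N (- k)" for k
    by (simp add: root_char_def cis_cnj)
  have row: "H' d l * cnj (H' d' l) = root_char N ((d - d') * l) / of_nat (card A)" for d d' l
    unfolding H' complex_cnj_divide complex_cnj_complex_of_real cnj times_divide_times_eq sq
    by (simp add: algebra_simps flip: root_char_add)
  have col: "cnj (H' d l) * H' d l' = root_char N ((l' - l) * d) / of_nat (card A)" for d l l'
    unfolding H' complex_cnj_divide complex_cnj_complex_of_real cnj times_divide_times_eq sq
    by (simp add: algebra_simps flip: root_char_add)
  have "unitary_matrix A L H'"
    unfolding unitary_matrix_def row col sum_divide_distrib[symmetric]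
    using H pos fin(3) by (auto simp: hadamard_def orth_def)
  then show ?thesis
    unfolding hadamard_triple_def H'_def[abs_def] using fin N by simp
qed

lemma orth_scale_left: "M > 0 \<Longrightarrow> orth N A L \<Longrightarrow> orth (M * N) ((\<lambda>x. int M * x) ` A) L"
  unfolding orth_def by (auto simp: mult.assoc root_char_scale simp flip: right_diff_distrib)

lemma orth_scale_right: "M > 0 \<Longrightarrow> orth N A L \<Longrightarrow> orth (M * N) A ((\<lambda>x. int M * x) ` L)"
  unfolding orth_def
  by (auto simp: sum.reindex inj_on_def mult.left_commute[of _ "int M"] root_char_scale)

lemma hadamard_scale_left:
  "M > 0 \<Longrightarrow> hadamard N A L \<Longrightarrow> hadamard (M * N) ((\<lambda>x. int M * x) ` A) L"
  unfolding hadamard_def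
  by (auto simp: card_image inj_on_def intro: orth_scale_left orth_scale_right)

lemma hadamard_scale_right:
  "M > 0 \<Longrightarrow> hadamard N A L \<Longrightarrow> hadamard (M * N) A ((\<lambda>x. int M * x) ` L)"
  unfolding hadamard_def
  by (auto simp: card_image inj_on_def intro: orth_scale_left orth_scale_right)

text \<open>The matrix has the rows (1, 1) and (1, -1).\<close>

lemma hadamard_pair:
  assumes "2 * (e * f) = int N * r" "odd r" "N > 0"
  shows "hadamard N {0, e} {0, f}"
proof -
  have ne: "e \<noteq> 0" "f \<noteq> 0" using assms by auto
  have "root_char N (e * f) = -1" by (rule root_char_half[OF assms])
  moreover have "root_char N (- (e * f)) = -1"
    by (rule root_char_half[of _ _ "- r"]) (use assms in auto)
  ultimately show ?thesis
    using ne by (auto simp: hadamard_def orth_def mult.commute)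
qed

section \<open>Unions and compositions of Hadamard pairs\<close>

lemma set_plus_eq_image: "(A :: int set) + B = (\<lambda>(a, b). a + b) ` (A \<times> B)"
  by (auto simp: set_plus_def)

text \<open>
  The condition \<open>N dvd y * l\<close> makes the matrix of the union block triangular up to phases, so that
  one of the two iterated sums vanishes.
\<close>
lemma hadamard_union:
  assumes A: "hadamard N A L1" and B: "\<And>x. x \<in> A \<Longrightarrow> hadamard N (B x) L2"
    and dvd: "\<And>x y l. x \<in> A \<Longrightarrow> y \<in> B x \<Longrightarrow> l \<in> L1 \<Longrightarrow> int N dvd y * l"
  shows "hadamard N (\<Union>x\<in>A. (\<lambda>y. x + y) ` B x) (L1 + L2)"
    and "card (\<Union>x\<in>A. (\<lambda>y. x + y) ` B x) = card A * card L2"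
    and "card (L1 + L2) = card L1 * card L2"
proof -
  have fin: "finite A" "finite L1" "finite L2" "\<And>x. x \<in> A \<Longrightarrow> finite (B x)"
    and ne: "A \<noteq> {}" and card: "card A = card L1" "\<And>x. x \<in> A \<Longrightarrow> card (B x) = card L2"
    using A B unfolding hadamard_def by auto
  have ne_B: "\<And>x. x \<in> A \<Longrightarrow> B x \<noteq> {}" using B by (auto simp: hadamard_def)
  have pos: "card L1 > 0" using ne fin card(1) by (metis card_gt_0_iff)
  obtain x0 where x0: "x0 \<in> A" using ne by blast
  have pos2: "card L2 > 0" using ne_B[OF x0] fin(4)[OF x0] card(2)[OF x0] by (metis card_gt_0_iff)
  have oA: "orth N A L1" "orth N L1 A" and oB: "\<And>x. x \<in> A \<Longrightarrow> orth N (B x) L2" "\<And>x. x \<in> A \<Longrightarrow> orth N L2 (B x)"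
    using A B by (auto simp: hadamard_def)
  have row: "(\<Sum>l2\<in>L2. \<Sum>l1\<in>L1. root_char N (((x + y) - (x' + y')) * (l1 + l2))) = 0"
    if m: "x \<in> A" "y \<in> B x" "x' \<in> A" "y' \<in> B x'" and ne: "(x, y) \<noteq> (x', y')" for x y x' y'
  proof -
    have phase: "root_char N (((x + y) - (x' + y')) * (l1 + l2)) =
        root_char N (((x + y) - (x' + y')) * l2) * root_char N ((x - x') * l1)" if "l1 \<in> L1" for l1 l2
    proof -
      have "int N dvd y * l1 - y' * l1" using dvd m that by (intro dvd_diff) auto
      then have "root_char N (y * l1 - y' * l1) = 1" by (rule root_char_dvd)
      moreover have "((x + y) - (x' + y')) * (l1 + l2) =
          ((x + y) - (x' + y')) * l2 + ((x - x') * l1 + (y * l1 - y' * l1))"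
        by (simp add: algebra_simps)
      ultimately show ?thesis by (simp add: root_char_add)
    qed
    have "(\<Sum>l2\<in>L2. \<Sum>l1\<in>L1. root_char N (((x + y) - (x' + y')) * (l1 + l2))) =
        (\<Sum>l2\<in>L2. root_char N (((x + y) - (x' + y')) * l2) * (\<Sum>l1\<in>L1. root_char N ((x - x') * l1)))"
      by (simp add: phase sum_distrib_left)
    also have "\<dots> = 0"
    proof (cases "x = x'")
      case False
      then have "(\<Sum>l1\<in>L1. root_char N ((x - x') * l1)) = 0" using oA m by (auto simp: orth_def)
      then show ?thesis by simp
    next
      case True
      then have "(\<Sum>l2\<in>L2. root_char N ((y - y') * l2)) = 0"
        using oB(1)[OF m(1)] m ne by (auto simp: orth_def)
      then show ?thesis using True by (simp flip: sum_distrib_right)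
    qed
    finally show ?thesis .
  qed
  have col: "(\<Sum>x\<in>A. \<Sum>y\<in>B x. root_char N (((l1 + l2) - (l1' + l2')) * (x + y))) = 0"
    if m: "l1 \<in> L1" "l1' \<in> L1" "l2 \<in> L2" "l2' \<in> L2" and ne: "(l1, l2) \<noteq> (l1', l2')" for l1 l1' l2 l2'
  proof -
    have phase: "root_char N (((l1 + l2) - (l1' + l2')) * (x + y)) =
        root_char N (((l1 + l2) - (l1' + l2')) * x) * root_char N ((l2 - l2') * y)" if "x \<in> A" "y \<in> B x" for x y
    proof -
      have "int N dvd y * l1 - y * l1'" using dvd m that by (intro dvd_diff) auto
      then have "root_char N (y * l1 - y * l1') = 1" by (rule root_char_dvd)
      moreover have "((l1 + l2) - (l1' + l2')) * (x + y) =
          ((l1 + l2) - (l1' + l2')) * x + ((l2 - l2') * y + (y * l1 - y * l1'))"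
        by (simp add: algebra_simps)
      ultimately show ?thesis by (simp add: root_char_add)
    qed
    have "(\<Sum>x\<in>A. \<Sum>y\<in>B x. root_char N (((l1 + l2) - (l1' + l2')) * (x + y))) =
        (\<Sum>x\<in>A. root_char N (((l1 + l2) - (l1' + l2')) * x) * (\<Sum>y\<in>B x. root_char N ((l2 - l2') * y)))"
      by (simp add: phase sum_distrib_left)
    also have "\<dots> = 0"
    proof (cases "l2 = l2'")
      case False
      then have "(\<Sum>y\<in>B x. root_char N ((l2 - l2') * y)) = 0" if "x \<in> A" for x
        using oB(2)[OF that] m by (auto simp: orth_def)
      then show ?thesis by simp
    next
      case True
      then have "(\<Sum>x\<in>A. root_char N ((l1 - l1') * x)) = 0"
        using oA(2) m ne by (auto simp: orth_def)
      then show ?thesis using True card(2) by (simp flip: sum_distrib_right)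
    qed
    finally show ?thesis .
  qed
  define S where "S = Sigma A B"
  have E: "(\<Union>x\<in>A. (\<lambda>y. x + y) ` B x) = (\<lambda>(x, y). x + y) ` S" by (auto simp: S_def)
  have card_S: "card S = card A * card L2" unfolding S_def using fin card(2) by (simp add: card_SigmaI)
  \<comment> \<open>Coinciding sums would turn a vanishing character sum into a positive number of
    ones, so orthogonality implies that the sums are distinct.\<close>
  have inj_E: "inj_on (\<lambda>(x, y). x + y) S"
  proof (rule inj_onI, rule ccontr)
    fix z z' assume z: "z \<in> S" "z' \<in> S" "(case z of (x, y) \<Rightarrow> x + y) = (case z' of (x, y) \<Rightarrow> x + y)" "z \<noteq> z'"
    obtain x y x' y' where xy: "z = (x, y)" "z' = (x', y')" by (metis surj_pair)
    have "(\<Sum>l2\<in>L2. \<Sum>l1\<in>L1. root_char N (((x + y) - (x' + y')) * (l1 + l2))) = 0"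
      by (rule row) (use z xy in \<open>auto simp: S_def\<close>)
    moreover have "(x + y) - (x' + y') = 0" using z xy by simp
    ultimately show False using pos pos2 by simp
  qed
  have inj_L: "inj_on (\<lambda>(x, y). x + y) (L1 \<times> L2)"
  proof (rule inj_onI, rule ccontr)
    fix z z' assume z: "z \<in> L1 \<times> L2" "z' \<in> L1 \<times> L2" "(case z of (x, y) \<Rightarrow> x + y) = (case z' of (x, y) \<Rightarrow> x + y)" "z \<noteq> z'"
    obtain l1 l2 l1' l2' where l: "z = (l1, l2)" "z' = (l1', l2')" by (metis surj_pair)
    have "(\<Sum>x\<in>A. \<Sum>y\<in>B x. root_char N (((l1 + l2) - (l1' + l2')) * (x + y))) = 0"
      by (rule col) (use z l in auto)
    moreover have "(l1 + l2) - (l1' + l2') = 0" using z l by simp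
    ultimately show False using pos pos2 card ne fin by auto
  qed
  show card_E: "card (\<Union>x\<in>A. (\<lambda>y. x + y) ` B x) = card A * card L2"
    unfolding E card_image[OF inj_E] by (rule card_S)
  show card_L: "card (L1 + L2) = card L1 * card L2"
    unfolding set_plus_eq_image card_image[OF inj_L] by (rule card_cartesian_product)
  have sum_L: "(\<Sum>l\<in>L1 + L2. f l) = (\<Sum>l2\<in>L2. \<Sum>l1\<in>L1. f (l1 + l2))" for f :: "int \<Rightarrow> complex"
    unfolding set_plus_eq_image sum.reindex[OF inj_L]
    by (subst sum.swap) (simp add: sum.cartesian_product split_def)
  have sum_E: "(\<Sum>e\<in>(\<lambda>(x, y). x + y) ` S. f e) = (\<Sum>x\<in>A. \<Sum>y\<in>B x. f (x + y))" for f :: "int \<Rightarrow> complex"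
  proof -
    have "(\<Sum>e\<in>(\<lambda>(x, y). x + y) ` S. f e) = (\<Sum>(x, y)\<in>S. f (x + y))"
      by (subst sum.reindex[OF inj_E]) (simp add: split_def)
    also have "\<dots> = (\<Sum>x\<in>A. \<Sum>y\<in>B x. f (x + y))"
      unfolding S_def using fin by (subst sum.Sigma) auto
    finally show ?thesis .
  qed
  show "hadamard N (\<Union>x\<in>A. (\<lambda>y. x + y) ` B x) (L1 + L2)"
    unfolding hadamard_def
  proof (intro conjI)
    show "finite (\<Union>x\<in>A. (\<lambda>y. x + y) ` B x)" using fin by auto
    show "finite (L1 + L2)" using fin by (simp add: set_plus_eq_image)
    show "(\<Union>x\<in>A. (\<lambda>y. x + y) ` B x) \<noteq> {}" using ne ne_B by auto
    show "card (\<Union>x\<in>A. (\<lambda>y. x + y) ` B x) = card (L1 + L2)"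
      unfolding card_E card_L card ..
    show "orth N (\<Union>x\<in>A. (\<lambda>y. x + y) ` B x) (L1 + L2)"
      unfolding orth_def sum_L by (intro ballI impI) (auto intro!: row)
    show "orth N (L1 + L2) (\<Union>x\<in>A. (\<lambda>y. x + y) ` B x)"
      unfolding orth_def E sum_E by (intro ballI impI) (auto simp: set_plus_eq_image intro!: col)
  qed
qed

lemma set_plus_eq_UN: "(A :: int set) + B = (\<Union>x\<in>A. (\<lambda>y. x + y) ` B)"
  by (auto simp: set_plus_def)

text \<open>The Cooley-Tukey pattern: \<open>N1 * b\<close> times \<open>N2 * c\<close> is a
  multiple of \<open>N1 * N2\<close>, which is the divisibility asked for in
  \<open>hadamard_union\<close>. Each frequency set is scaled opposite to its digit set.\<close>

lemma hadamard_compose: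
  assumes A: "hadamard N1 A L1" and B: "hadamard N2 B L2" and N: "N1 > 0" "N2 > 0"
  shows "hadamard (N1 * N2) (A + (\<lambda>x. int N1 * x) ` B) ((\<lambda>x. int N2 * x) ` L1 + L2)"
    and "card (A + (\<lambda>x. int N1 * x) ` B) = card A * card B"
    and "card ((\<lambda>x. int N2 * x) ` L1 + L2) = card L1 * card L2"
proof -
  have 1: "hadamard (N1 * N2) A ((\<lambda>x. int N2 * x) ` L1)"
    using hadamard_scale_right[OF N(2) A] by (simp add: mult.commute)
  have 2: "hadamard (N1 * N2) ((\<lambda>x. int N1 * x) ` B) L2"
    by (rule hadamard_scale_left[OF N(1) B])
  have 3: "int (N1 * N2) dvd y * l" if "y \<in> (\<lambda>x. int N1 * x) ` B" "l \<in> (\<lambda>x. int N2 * x) ` L1" for y l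
  proof -
    from that obtain b c where "y = int N1 * b" "l = int N2 * c" by auto
    then have "y * l = int (N1 * N2) * (b * c)" by simp
    then show ?thesis by (rule dvdI)
  qed
  note U = hadamard_union[OF 1 2 3, folded set_plus_eq_UN]
  show "hadamard (N1 * N2) (A + (\<lambda>x. int N1 * x) ` B) ((\<lambda>x. int N2 * x) ` L1 + L2)"
    by (rule U(1))
  show "card (A + (\<lambda>x. int N1 * x) ` B) = card A * card B"
    using U(2) B by (simp add: hadamard_def)
  show "card ((\<lambda>x. int N2 * x) ` L1 + L2) = card L1 * card L2"
    using U(3) N by (simp add: card_image inj_on_def)
qed

lemma direct_sum_if_card:
  assumes "finite A" "finite B" "card (A + B) = card A * card B"
  shows "direct_sum A B"
  unfolding direct_sum_def using assms
  by (intro eq_card_imp_inj_on) (auto simp: set_plus_eq_image card_cartesian_product)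

lemma image_times_set_plus: "(\<lambda>x. n * x) ` (A + B) = (\<lambda>x. n * x) ` A + (\<lambda>x. n * x) ` (B :: int set)"
proof (intro equalityI subsetI)
  fix y assume "y \<in> (\<lambda>x. n * x) ` (A + B)"
  then obtain a b where "a \<in> A" "b \<in> B" "y = n * a + n * b"
    by (auto simp: set_plus_eq_image distrib_left)
  then show "y \<in> (\<lambda>x. n * x) ` A + (\<lambda>x. n * x) ` B" by (auto intro: set_plus_intro)
next
  fix y assume "y \<in> (\<lambda>x. n * x) ` A + (\<lambda>x. n * x) ` B"
  then obtain a b where "a \<in> A" "b \<in> B" "y = n * (a + b)"
    by (auto simp: set_plus_eq_image distrib_left)
  then show "y \<in> (\<lambda>x. n * x) ` (A + B)" by (auto intro: set_plus_intro)
qed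

lemma image_times_set_sum:
  "(\<lambda>x. n * x) ` (\<Sum>i\<in>I. S i) = (\<Sum>i\<in>I. (\<lambda>x. n * x) ` (S i :: int set))"
  by (induction I rule: infinite_finite_induct) (auto simp: image_times_set_plus set_zero)

text \<open>
  The first digit of an element of the set \<open>A\<close> is \<open>0\<close> or the odd number \<open>u\<close>, and \<open>N\<close> is even, so
  parity recovers it; this makes \<open>B\<close> a function of the sum.
\<close>
lemma product_form_power:
  fixes N k :: nat and u :: int and B0 :: "int \<Rightarrow> int set"
  assumes N: "N > 0" "even N" and u: "odd u"
    and h1: "hadamard N {0, u} L10" and h2: "\<And>x. x \<in> {0, u} \<Longrightarrow> hadamard N (B0 x) L20"
    and h3: "\<And>x. x \<in> {0, u} \<Longrightarrow> hadamard N ({0, u} + B0 x) (L10 + L20)"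
    and c3: "card (L10 + L20) = card L10 * card L20"
      "\<And>x. x \<in> {0, u} \<Longrightarrow> card ({0, u} + B0 x) = card {0, u} * card (B0 x)"
  defines "E \<equiv> \<Union>x\<in>{0, u}. (\<lambda>b. x + int N ^ k * b) ` B0 x"
  shows "\<exists>A B L1 L2. (\<Sum>j<Suc n. (\<lambda>e. int N ^ j * e) ` E) = (\<Union>x\<in>A. (\<lambda>b. x + int N ^ k * b) ` B x) \<and>
    hadamard (N ^ Suc n) A L1 \<and> card (L1 + L2) = card L1 * card L2 \<and>
    (\<forall>x\<in>A. hadamard (N ^ Suc n) (B x) L2 \<and> hadamard (N ^ Suc n) (A + B x) (L1 + L2) \<and>
      card (A + B x) = card A * card (B x))"
proof (induction n)
  case 0
  show ?case
    by (rule exI[of _ "{0, u}"], rule exI[of _ B0], rule exI[of _ L10], rule exI[of _ L20])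
      (use h1 h2 h3 c3 in \<open>simp add: E_def\<close>)
next
  case (Suc n)
  let ?M = "N ^ Suc n"
  let ?s = "\<lambda>n S. (\<lambda>x. int n * x) ` S"
  obtain A B L1 L2 where IH: "(\<Sum>j<Suc n. (\<lambda>e. int N ^ j * e) ` E) = (\<Union>x\<in>A. (\<lambda>b. x + int N ^ k * b) ` B x)"
    "hadamard ?M A L1" "card (L1 + L2) = card L1 * card L2"
    "\<And>x. x \<in> A \<Longrightarrow> hadamard ?M (B x) L2" "\<And>x. x \<in> A \<Longrightarrow> hadamard ?M (A + B x) (L1 + L2)"
    "\<And>x. x \<in> A \<Longrightarrow> card (A + B x) = card A * card (B x)"
    using Suc.IH by blast
  have M: "?M > 0" using N by simp
  define d where "d x = (if even x then 0 else u)" for x :: int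
  define B' where "B' x = B0 (d x) + ?s N (B ((x - d x) div int N))" for x
  define A' where "A' = {0, u} + ?s N A"
  have d: "d (x0 + int N * x) = x0" if "x0 \<in> {0, u}" for x0 x using that N u by (auto simp: d_def)
  have B': "B' (x0 + int N * x) = B0 x0 + ?s N (B x)" if "x0 \<in> {0, u}" for x0 x
    using d[OF that, of x] N by (simp add: B'_def)
  have A'_cases: "\<exists>x0 x1. x0 \<in> {0, u} \<and> x1 \<in> A \<and> x = x0 + int N * x1" if "x \<in> A'" for x
    using that unfolding A'_def set_plus_eq_UN by blast
  have sum: "(\<Sum>j<Suc (Suc n). (\<lambda>e. int N ^ j * e) ` E) = (\<Union>x\<in>A'. (\<lambda>b. x + int N ^ k * b) ` B' x)"
  proof -
    have "(\<Sum>j<Suc (Suc n). (\<lambda>e. int N ^ j * e) ` E) = E + (\<Sum>j<Suc n. (\<lambda>e. int N ^ Suc j * e) ` E)"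
      by (subst sum.lessThan_Suc_shift) simp
    also have "(\<Sum>j<Suc n. (\<lambda>e. int N ^ Suc j * e) ` E) = ?s N (\<Sum>j<Suc n. (\<lambda>e. int N ^ j * e) ` E)"
      unfolding image_times_set_sum by (simp add: image_image mult.assoc)
    also have "E + ?s N (\<Sum>j<Suc n. (\<lambda>e. int N ^ j * e) ` E) = (\<Union>x\<in>A'. (\<lambda>b. x + int N ^ k * b) ` B' x)"
      unfolding IH(1)
    proof (intro equalityI subsetI)
      fix z assume "z \<in> E + ?s N (\<Union>x\<in>A. (\<lambda>b. x + int N ^ k * b) ` B x)"
      then obtain e w where ew: "z = e + w" "e \<in> E" "w \<in> ?s N (\<Union>x\<in>A. (\<lambda>b. x + int N ^ k * b) ` B x)"
        by (rule set_plus_elim)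
      from ew(2) obtain x0 b0 where m0: "x0 \<in> {0, u}" "b0 \<in> B0 x0" "e = x0 + int N ^ k * b0"
        unfolding E_def by blast
      from ew(3) obtain x b where m1: "x \<in> A" "b \<in> B x" "w = int N * (x + int N ^ k * b)"
        by blast
      note m = m0(1,2) m1(1,2)
      have z: "z = (x0 + int N ^ k * b0) + int N * (x + int N ^ k * b)"
        by (simp only: ew(1) m0(3) m1(3))
      have "x0 + int N * x \<in> A'" using m by (auto simp: A'_def intro: set_plus_intro)
      moreover have "b0 + int N * b \<in> B' (x0 + int N * x)"
        unfolding B'[OF m(1)] using m by (auto intro: set_plus_intro)
      moreover have "z = (x0 + int N * x) + int N ^ k * (b0 + int N * b)" using z by (simp add: algebra_simps)
      ultimately show "z \<in> (\<Union>x\<in>A'. (\<lambda>b. x + int N ^ k * b) ` B' x)" by blast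
    next
      fix z assume "z \<in> (\<Union>x\<in>A'. (\<lambda>b. x + int N ^ k * b) ` B' x)"
      then obtain x' b' where x': "x' \<in> A'" "b' \<in> B' x'" "z = x' + int N ^ k * b'" by blast
      then obtain x0 x where x: "x0 \<in> {0, u}" "x \<in> A" "x' = x0 + int N * x" using A'_cases by blast
      with x' B'[OF x(1)] obtain b0 b where b: "b0 \<in> B0 x0" "b \<in> B x" "b' = b0 + int N * b"
        unfolding set_plus_eq_image by auto
      have "z = (x0 + int N ^ k * b0) + int N * (x + int N ^ k * b)"
        using x x' b by (simp add: algebra_simps)
      moreover have "x0 + int N ^ k * b0 \<in> E" unfolding E_def using x b by blast
      moreover have "int N * (x + int N ^ k * b) \<in> ?s N (\<Union>x\<in>A. (\<lambda>b. x + int N ^ k * b) ` B x)"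
        using x b by blast
      ultimately show "z \<in> E + ?s N (\<Union>x\<in>A. (\<lambda>b. x + int N ^ k * b) ` B x)"
        by (simp only: set_plus_intro)
    qed
    finally show ?thesis .
  qed
  \<comment> \<open>The new digit enters at the lowest place, so by \<open>hadamard_compose\<close>
    its frequencies enter at the top scale.\<close>
  define L1' where "L1' = ?s ?M L10 + L1"
  define L2' where "L2' = ?s ?M L20 + L2"
  have L_sum: "L1' + L2' = ?s ?M (L10 + L20) + (L1 + L2)"
    unfolding L1'_def L2'_def image_times_set_plus by (simp add: ac_simps)
  note hA = hadamard_compose[OF h1 IH(2) N(1) M]
  have card_L: "card (L1' + L2') = card L1' * card L2'"
  proof -
    have "A \<noteq> {}" using IH(2) by (auto simp: hadamard_def)
    then obtain x where x: "x \<in> A" by blast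
    have "card (L1' + L2') = card (L10 + L20) * card (L1 + L2)"
      unfolding L_sum by (rule hadamard_compose(3)[OF h3 IH(5)[OF x] N(1) M, of 0]) simp
    moreover have "card L1' = card L10 * card L1" unfolding L1'_def by (rule hA(3))
    moreover have "card L2' = card L20 * card L2"
      unfolding L2'_def by (rule hadamard_compose(3)[OF h2 IH(4)[OF x] N(1) M, of 0]) simp
    ultimately show ?thesis using c3(1) IH(3) by simp
  qed
  have pieces: "hadamard (N ^ Suc (Suc n)) (B' x) L2' \<and> hadamard (N ^ Suc (Suc n)) (A' + B' x) (L1' + L2') \<and>
      card (A' + B' x) = card A' * card (B' x)" if x: "x \<in> A'" for x
  proof -
    obtain x0 x1 where x01: "x0 \<in> {0, u}" "x1 \<in> A" "x = x0 + int N * x1" using A'_cases[OF x] by blast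
    have Bx: "B' x = B0 x0 + ?s N (B x1)" unfolding x01(3) by (rule B'[OF x01(1)])
    have AB: "A' + B' x = ({0, u} + B0 x0) + ?s N (A + B x1)"
      unfolding Bx A'_def image_times_set_plus by (simp add: ac_simps)
    note c1 = hadamard_compose[OF h2[OF x01(1)] IH(4)[OF x01(2)] N(1) M]
    note c2 = hadamard_compose[OF h3[OF x01(1)] IH(5)[OF x01(2)] N(1) M]
    have "hadamard (N ^ Suc (Suc n)) (B' x) L2'" unfolding Bx L2'_def using c1(1) by simp
    moreover have "hadamard (N ^ Suc (Suc n)) (A' + B' x) (L1' + L2')"
      unfolding AB L_sum using c2(1) by simp
    moreover have "card (A' + B' x) = card A' * card (B' x)"
    proof -
      have "card (A' + B' x) = card ({0, u} + B0 x0) * card (A + B x1)" unfolding AB by (rule c2(2))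
      moreover have "card (B' x) = card (B0 x0) * card (B x1)" unfolding Bx by (rule c1(2))
      moreover have "card A' = card {0, u} * card A" unfolding A'_def by (rule hA(2))
      ultimately show ?thesis using c3(2)[OF x01(1)] IH(6)[OF x01(2)] by simp
    qed
    ultimately show ?thesis by blast
  qed
  have "hadamard (N ^ Suc (Suc n)) A' L1'" unfolding A'_def L1'_def using hA(1) by simp
  with sum card_L pieces show ?case by blast
qed

section \<open>Digit sets of cardinality four\<close>

locale four_digits =
  fixes \<beta> m t k r :: nat and N :: nat and a l l' :: int
  assumes N: "N = 2 ^ \<beta> * m" and odd: "odd m" "odd a" "odd l" "odd l'"
    and t: "t = \<beta> * k + r" and r: "0 < r" "r \<le> \<beta> - 1"
begin

definition u :: int where "u = int m ^ k * a"

definition L10 :: "int set" where "L10 = {0, int (N div 2)}"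

text \<open>Twice \<open>2 ^ r * l\<close> times this frequency is \<open>N * l\<close>, an odd
  multiple of N as \<open>hadamard_pair\<close> requires; \<open>r \<le> \<beta> - 1\<close> makes
  the division exact.\<close>

definition L20 :: "int set" where "L20 = {0, int (N div 2 ^ (r + 1))}"

definition B0 :: "int \<Rightarrow> int set" where "B0 x = {0, 2 ^ r * (if x = 0 then l else l')}"

lemma N_facts: "N \<ge> 2" "even N" "2 * int (N div 2) = int N"
  "2 * (2 ^ r * int (N div 2 ^ (r + 1))) = int N"
proof -
  have \<beta>: "\<beta> = (r + 1) + (\<beta> - (r + 1))" using r by simp
  then have "N = 2 ^ (r + 1) * (2 ^ (\<beta> - (r + 1)) * m)"
    unfolding N by (metis mult.assoc power_add)
  then have dvd: "2 ^ (r + 1) dvd N" by simp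
  then show even: "even N" by (metis add.commute dvd_mult_left plus_1_eq_Suc power_Suc)
  have "N > 0" using odd(1) by (auto simp: N intro: Nat.gr0I)
  with even show "N \<ge> 2" by (auto elim!: evenE)
  show "2 * int (N div 2) = int N" using even by (metis dvd_mult_div_cancel of_nat_mult of_nat_numeral)
  have "2 * (2 ^ r * (N div 2 ^ (r + 1))) = N" using dvd_mult_div_cancel[OF dvd] by simp
  then have "int (2 * (2 ^ r * (N div 2 ^ (r + 1)))) = int N" by (simp only:)
  then show "2 * (2 ^ r * int (N div 2 ^ (r + 1))) = int N" by simp
qed

lemma u_odd: "odd u" using odd by (simp add: u_def)

lemma hadamard_first: "hadamard N {0, u} L10"
  unfolding L10_def
proof (rule hadamard_pair)
  show "2 * (u * int (N div 2)) = int N * u" using N_facts(3) by (simp add: mult_ac)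
qed (use u_odd N_facts in auto)

lemma hadamard_second: "hadamard N (B0 x) L20"
  unfolding L20_def B0_def
proof (rule hadamard_pair)
  let ?l = "if x = 0 then l else l'"
  show "2 * (2 ^ r * ?l * int (N div 2 ^ (r + 1))) = int N * ?l"
    unfolding N_facts(4)[symmetric] by (simp add: mult_ac)
qed (use odd N_facts in auto)

text \<open>Since r is positive, \<open>2 ^ r\<close> supplies the factor 2 that completes
  \<open>N div 2\<close> to N.\<close>

lemma compatible:
  assumes "y \<in> B0 x" "n \<in> L10"
  shows "int N dvd y * n"
proof -
  have pw: "(2::int) ^ r = 2 * 2 ^ (r - 1)" using r by (metis power_Suc Suc_pred')
  have "int N dvd 2 ^ r * w * int (N div 2)" for w
  proof -
    have "2 ^ r * w * int (N div 2) = (2 * int (N div 2)) * (2 ^ (r - 1) * w)"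
      unfolding pw by (simp only: mult_ac)
    then show ?thesis unfolding N_facts(3) by (rule dvdI)
  qed
  then show ?thesis using assms by (auto simp: B0_def L10_def)
qed

lemma hadamard_both:
  shows "hadamard N ({0, u} + B0 x) (L10 + L20)"
    and "card ({0, u} + B0 x) = card {0, u} * card (B0 x)"
    and "card (L10 + L20) = card L10 * card L20"
proof -
  show "hadamard N ({0, u} + B0 x) (L10 + L20)"
    unfolding set_plus_eq_UN[of "{0, u}"]
    by (rule hadamard_union(1)[OF hadamard_first hadamard_second]) (erule (1) compatible)
  show "card (L10 + L20) = card L10 * card L20"
    by (rule hadamard_union(3)[OF hadamard_first hadamard_second]) (erule (1) compatible)
  have "card ({0, u} + B0 x) = card {0, u} * card L20"
    unfolding set_plus_eq_UN[of "{0, u}"]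
    by (rule hadamard_union(2)[OF hadamard_first hadamard_second]) (erule (1) compatible)
  also have "card L20 = card (B0 x)" using hadamard_second[of x] by (simp only: hadamard_def)
  finally show "card ({0, u} + B0 x) = card {0, u} * card (B0 x)" .
qed

definition E :: "int set" where "E = (\<lambda>d. int m ^ k * d) ` {0, a, 2 ^ t * l, a + 2 ^ t * l'}"

text \<open>The identity \<open>m ^ k * 2 ^ t = N ^ k * 2 ^ r\<close> explains the factor
  \<open>m ^ k\<close>: it turns \<open>\<beta> * k\<close> of the powers of 2 into k full places in
  base N.\<close>

lemma E_eq: "E = (\<Union>x\<in>{0, u}. (\<lambda>b. x + int N ^ k * b) ` B0 x)"
proof -
  have "u \<noteq> 0" using u_odd by auto
  have "int m ^ k * (2 ^ t * w) = int N ^ k * (2 ^ r * w)" for w :: int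
    by (simp add: N t power_add power_mult power_mult_distrib mult_ac)
  then have "E = {0, u, int N ^ k * (2 ^ r * l), u + int N ^ k * (2 ^ r * l')}"
    by (simp only: E_def u_def image_insert image_empty distrib_left mult_zero_right)
  moreover have "B0 0 = {0, 2 ^ r * l}" "B0 u = {0, 2 ^ r * l'}"
    using \<open>u \<noteq> 0\<close> by (simp_all add: B0_def)
  ultimately show ?thesis by auto
qed

lemma product_form_at: "product_form_hadamard_triple_at k N E L10 L20"
  unfolding product_form_hadamard_triple_at_def
proof (intro exI conjI ballI)
  show "E = (\<Union>x\<in>{0, u}. (\<lambda>b. x + int N ^ k * b) ` B0 x)" by (rule E_eq)
  show "direct_sum L10 L20"
    by (rule direct_sum_if_card[OF _ _ hadamard_both(3)]) (simp_all add: L10_def L20_def)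
  fix x
  show "direct_sum {0, u} (B0 x)"
    by (rule direct_sum_if_card[OF _ _ hadamard_both(2)]) (simp_all add: B0_def)
qed (intro hadamard_triple_if_hadamard hadamard_first hadamard_second hadamard_both N_facts)+

text \<open>With K = k, the cut after k places in base N becomes the cut after the first place in
  base \<open>N ^ k\<close>. For k = 0 there is nothing to cut: the digits already form a Hadamard
  set modulo N and the second factor is trivial.\<close>

lemma product_form_iterated:
  "\<exists>K>0. \<exists>L1 L2. product_form_hadamard_triple (N ^ K) (\<Sum>j<K. (\<lambda>e. int N ^ j * e) ` E) L1 L2"
proof (cases "k = 0")
  case True
  have "hadamard N (\<Union>x\<in>{0, u}. (\<lambda>y. x + y) ` B0 x) (L10 + L20)"
    by (rule hadamard_union(1)[OF hadamard_first hadamard_second]) (erule (1) compatible)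
  moreover have "int N ^ k = 1" using True by simp
  ultimately have H: "hadamard N E (L10 + L20)" by (simp only: E_eq mult_1)
  have unit: "hadamard N {0} {0}" by (simp add: hadamard_def orth_def)
  have "product_form_hadamard_triple_at 1 N E (L10 + L20) {0}"
    unfolding product_form_hadamard_triple_at_def
  proof (intro exI[of _ E] exI[of _ "\<lambda>_. {0}"] conjI ballI)
    show "E = (\<Union>x\<in>E. (\<lambda>b. x + int N ^ 1 * b) ` {0})" by simp
    show "hadamard_triple N (E + {0}) (L10 + L20 + {0})"
      using hadamard_triple_if_hadamard[OF H N_facts(1)] by (simp flip: set_zero)
  qed (use hadamard_triple_if_hadamard[OF H N_facts(1)] hadamard_triple_if_hadamard[OF unit N_facts(1)]
        in \<open>auto simp: direct_sum_def inj_on_def\<close>)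
  then show ?thesis
    by (intro exI[of _ 1] conjI exI[of _ "L10 + L20"] exI[of _ "{0}"])
      (simp_all add: product_form_hadamard_triple_def)
next
  case False
  then obtain n where n: "k = Suc n" by (cases k) auto
  have "N > 0" using N_facts(1) by simp
  from product_form_power[of N u L10 B0 L20 k n, OF this N_facts(2) u_odd hadamard_first
      hadamard_second hadamard_both(1,3,2), folded E_eq n]
  obtain A B L1 L2 where F: "(\<Sum>j<k. (\<lambda>e. int N ^ j * e) ` E) = (\<Union>x\<in>A. (\<lambda>b. x + int N ^ k * b) ` B x)"
    "hadamard (N ^ k) A L1" "card (L1 + L2) = card L1 * card L2"
    "\<And>x. x \<in> A \<Longrightarrow> hadamard (N ^ k) (B x) L2"
    "\<And>x. x \<in> A \<Longrightarrow> hadamard (N ^ k) (A + B x) (L1 + L2)"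
    "\<And>x. x \<in> A \<Longrightarrow> card (A + B x) = card A * card (B x)"
    by (elim exE conjE) blast
  have Nk: "N ^ k \<ge> 2"
  proof -
    have "N ^ 1 \<le> N ^ k" using N_facts(1) n by (intro power_increasing) auto
    with N_facts(1) show ?thesis by simp
  qed
  obtain x0 where x0: "x0 \<in> A" using F(2) by (auto simp: hadamard_def)
  have "product_form_hadamard_triple_at 1 (N ^ k) (\<Sum>j<k. (\<lambda>e. int N ^ j * e) ` E) L1 L2"
    unfolding product_form_hadamard_triple_at_def
  proof (intro exI[of _ A] exI[of _ B] conjI ballI)
    show "(\<Sum>j<k. (\<lambda>e. int N ^ j * e) ` E) = (\<Union>x\<in>A. (\<lambda>b. x + int (N ^ k) ^ 1 * b) ` B x)"
      using F(1) by simp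
    show "direct_sum L1 L2"
      using F(2) F(4)[OF x0] by (intro direct_sum_if_card F(3)) (auto simp: hadamard_def)
    show "hadamard_triple (N ^ k) A L1" by (rule hadamard_triple_if_hadamard[OF F(2) Nk])
    fix x assume x: "x \<in> A"
    show "hadamard_triple (N ^ k) (B x) L2" by (rule hadamard_triple_if_hadamard[OF F(4)[OF x] Nk])
    show "hadamard_triple (N ^ k) (A + B x) (L1 + L2)"
      by (rule hadamard_triple_if_hadamard[OF F(5)[OF x] Nk])
    show "direct_sum A (B x)"
      using F(2) F(4)[OF x] by (intro direct_sum_if_card F(6)[OF x]) (auto simp: hadamard_def)
  qed
  then show ?thesis
    using n by (intro exI[of _ k] conjI exI[of _ L1] exI[of _ L2])
      (simp_all add: product_form_hadamard_triple_def)
qed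

end

section \<open>Assembly of the classification\<close>

context spectral_four
begin

theorem ratio_and_digits:
  obtains N \<beta> m :: nat and c :: real and a l l' :: int and t :: nat
  where "\<rho> = 1 / real N" "N = 2 ^ \<beta> * m" "\<beta> \<ge> 1" "odd m" "digit_form D c a l l' t" "\<not> \<beta> dvd t"
proof -
  obtain c a l l' t where form: "digit_form D c a l l' t" using ex_digit_form by blast
  then have t: "t \<ge> 1" by (simp add: digit_form_def)
  obtain \<kappa> where \<kappa>: "\<kappa> \<noteq> 0"
    "\<And>w. mask_poly D p w = 0 \<Longrightarrow> \<exists>s. two_level t s \<and> w = \<kappa> * of_int s"
    using mask_zero_two_level[OF form] by blast
  interpret spectral_four_levels \<rho> D p \<mu> \<Lambda> t \<kappa> by unfold_locales (use t \<kappa> in auto)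
  obtain P Q :: nat where PQ: "Q \<noteq> 0" "\<bar>\<rho>\<bar> = real P / real Q" "coprime P Q"
    using ratio_rational by (rule Rats_abs_nat_div_natE)
  have \<rho>_eq: "\<rho> = real P / real Q" using PQ \<rho> by simp
  have "P > 0" using \<rho> PQ \<rho>_eq by (intro Nat.gr0I) auto
  moreover have "P < Q" using \<rho> PQ \<rho>_eq by (simp add: divide_less_eq)
  ultimately interpret spectral_four_rational \<rho> D p \<mu> \<Lambda> t \<kappa> P Q
    by unfold_locales (use PQ \<rho>_eq in auto)
  have P1: "P = 1" by (rule numerator_eq_one)
  obtain \<beta> b where b: "odd b" "int Q = 2 ^ \<beta> * b"
    using pow2_odd_decomposition[of "int Q"] Q0 by auto
  have "b > 0" using b Q0 by (metis of_nat_0_less_iff zero_less_mult_pos zero_less_numeral zero_less_power)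
  then have "int Q = int (2 ^ \<beta> * nat b)" using b by simp
  then have Q: "Q = 2 ^ \<beta> * nat b" by (simp only: of_nat_eq_iff)
  have odd: "odd (nat b)" using b(1) \<open>b > 0\<close> by (simp add: even_nat_iff)
  have "\<beta> \<noteq> 0" using Q odd denominator_even by (metis mult_1 power_0)
  then show ?thesis
    using that[OF _ Q _ odd form exponent_not_dvd[OF Q odd]] \<rho>_eq P1 by simp
qed

end

theorem theorem1p7:
  fixes \<rho> :: real and D :: "real set" and p :: "real \<Rightarrow> real" and \<mu> :: "real measure"
  assumes "0 < \<rho>" and "\<rho> < 1"
    and "D \<subseteq> {0..}" and "0 \<in> D" and "card D = 4"
    and "probability_vector D p"
    and "self_similar_measure \<rho> D p \<mu>"
    and "spectral_measure \<mu>"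
  shows "equal_weighted D p \<and>
    (\<exists>(N::nat) (\<beta>::nat) (m::nat). \<rho> = 1 / real N \<and> N = 2 ^ \<beta> * m \<and> \<beta> \<ge> 1 \<and> odd m \<and>
      (\<exists>(c::real) (a::int) (l::int) (l'::int) (t::nat).
         c > 0 \<and> odd a \<and> odd l \<and> odd l' \<and> t \<ge> 1 \<and> \<not> \<beta> dvd t \<and>
         (\<lambda>d. c * d) ` D = real_of_int ` {0, a, 2 ^ t * l, a + 2 ^ t * l'} \<and>
         (\<forall>(k::nat) (r::nat). t = \<beta> * k + r \<and> 0 < r \<and> r \<le> \<beta> - 1 \<longrightarrow>
            product_form_hadamard_triple_at k N
              ((\<lambda>d. int m ^ k * d) ` {0, a, 2 ^ t * l, a + 2 ^ t * l'})
              {0, int (N div 2)} {0, int (N div 2 ^ (r + 1))}))) \<and>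
    modified_Laba_Wang \<rho> D p \<mu>"
proof -
  have fin: "finite D" using assms(5) by (metis card.infinite zero_neq_numeral)
  have rd: "real_distribution \<mu>"
    using assms(8) by (simp add: spectral_measure_def real_distribution_def real_distribution_axioms_def)
  obtain \<Lambda> where \<Lambda>: "orthonormal_basis_L2 \<mu> \<Lambda> exponential"
    using assms(8) by (auto simp: spectral_measure_def)
  interpret spectral_self_similar \<rho> D p \<mu> \<Lambda>
    by unfold_locales (use assms fin real_distribution.parseval_if_basis[OF rd \<Lambda>] in auto)
  have w: "p d = 1 / 4" if "d \<in> D" for d
    by (rule spectral_equal_weights[OF spectral_self_similar_axioms assms(5) that])
  interpret spectral_four \<rho> D p \<mu> \<Lambda> by unfold_locales (use assms(5) w in auto)
  have equal: "equal_weighted D p" using w assms(5) by (simp add: equal_weighted_def)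
  obtain N \<beta> m :: nat and c :: real and a l l' :: int and t :: nat
    where N: "\<rho> = 1 / real N" "N = 2 ^ \<beta> * m" "\<beta> \<ge> 1" "odd m"
      and form: "digit_form D c a l l' t" and ndvd: "\<not> \<beta> dvd t"
    using ratio_and_digits .
  have c: "c > 0" and odd: "odd a" "odd l" "odd l'" and t: "t \<ge> 1"
    and cD: "(\<lambda>d. c * d) ` D = real_of_int ` {0, a, 2 ^ t * l, a + 2 ^ t * l'}"
    using form by (auto simp: digit_form_def)
  have digits: "four_digits \<beta> m t k r N a l l'" if "t = \<beta> * k + r" "0 < r" "r \<le> \<beta> - 1" for k r
    by unfold_locales (use N odd that in auto)
  have triple: "product_form_hadamard_triple_at k N
      ((\<lambda>d. int m ^ k * d) ` {0, a, 2 ^ t * l, a + 2 ^ t * l'})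
      {0, int (N div 2)} {0, int (N div 2 ^ (r + 1))}"
    if "t = \<beta> * k + r \<and> 0 < r \<and> r \<le> \<beta> - 1" for k r
  proof -
    interpret four_digits \<beta> m t k r N a l l' using that by (intro digits) auto
    show ?thesis using product_form_at unfolding E_def L10_def L20_def .
  qed
  define k where "k = t div \<beta>"
  define r where "r = t mod \<beta>"
  have kr: "t = \<beta> * k + r" "0 < r" "r \<le> \<beta> - 1"
  proof -
    show "t = \<beta> * k + r" by (simp add: k_def r_def)
    show "0 < r" using ndvd by (simp add: r_def dvd_eq_mod_eq_0)
    have "r < \<beta>" using N(3) by (simp add: r_def)
    then show "r \<le> \<beta> - 1" by simp
  qed
  interpret F: four_digits \<beta> m t k r N a l l' by (rule digits[OF kr])
  define C where "C = {0, a, 2 ^ t * l, a + 2 ^ t * l'}"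
  obtain K L1 L2 where K: "K > 0"
    "product_form_hadamard_triple (N ^ K) (\<Sum>j<K. (\<lambda>e. int N ^ j * e) ` F.E) L1 L2"
    using F.product_form_iterated by blast
  have sum_eq: "(\<Sum>j<K. (\<lambda>e. int N ^ j * e) ` F.E) = (\<Sum>j<K. (\<lambda>e. int N ^ j * (int m ^ k * e)) ` C)"
    by (rule sum.cong) (auto simp: F.E_def C_def image_image)
  have "D = (\<lambda>d. 1 / c * d) ` (\<lambda>d. c * d) ` D" using c by (simp add: image_image)
  also have "\<dots> = (\<lambda>e. 1 / c * real_of_int e) ` C" unfolding cD C_def by (simp add: image_image)
  finally have DC: "D = (\<lambda>e. 1 / c * real_of_int e) ` C" .
  have m0: "int m ^ k > 0" using N(4) by (auto intro!: zero_less_power Nat.gr0I)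
  have "modified_Laba_Wang \<rho> D p \<mu>"
    unfolding modified_Laba_Wang_def
  proof (intro impI conjI)
    show "equal_weighted D p" by (rule equal)
    show "\<exists>N::nat. N \<ge> 2 \<and> \<rho> = 1 / real N \<and>
      (\<exists>\<alpha> > 0. \<exists>C :: int set. D = (\<lambda>c. \<alpha> * real_of_int c) ` C \<and>
        (\<exists>M > 0. \<exists>K > 0. \<exists>L1 L2. product_form_hadamard_triple (N ^ K)
           (\<Sum>j<K. (\<lambda>c. int N ^ j * (M * c)) ` C) L1 L2))"
    proof (intro exI[of _ N] conjI)
      show "N \<ge> 2" by (rule F.N_facts(1))
      show "\<rho> = 1 / real N" by (rule N(1))
      show "\<exists>\<alpha> > 0. \<exists>C :: int set. D = (\<lambda>c. \<alpha> * real_of_int c) ` C \<and>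
        (\<exists>M > 0. \<exists>K > 0. \<exists>L1 L2. product_form_hadamard_triple (N ^ K)
           (\<Sum>j<K. (\<lambda>c. int N ^ j * (M * c)) ` C) L1 L2)"
      \<comment> \<open>The factor \<open>1 / c\<close> undoes the rescaling of the digits, and
        \<open>m ^ k\<close> serves as M.\<close>
      proof (intro exI[of _ "1 / c"] exI[of _ C] conjI)
        show "0 < 1 / c" using c by simp
        show "D = (\<lambda>e. 1 / c * real_of_int e) ` C" by (rule DC)
        show "\<exists>M > 0. \<exists>K > 0. \<exists>L1 L2. product_form_hadamard_triple (N ^ K)
           (\<Sum>j<K. (\<lambda>c. int N ^ j * (M * c)) ` C) L1 L2"
          using m0 K unfolding sum_eq by blast
      qed
    qed
  qed
  with equal N c odd t ndvd cD triple show ?thesis by blast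
qed

end
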